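(* Let $\mathbb{X}$ be a semi-abelian category. For each $n\in\mathbb{Z}$: 1. The adjunction $\mathbf{tr}_{n-1}\dashv\mathbf{cosk}_{n-1}$, with $\mathbf{tr}_{n-1}: ch(\mathbb{X})\to ch(\mathbb{X})_{n-1\geq}$, is a localization, and thus it induces a hereditary torsion theory $(\mathcal{T}_{\mathbf{tr}_{n-1}},\mathcal{F}_{\mathbf{tr}_{n-1}})$ in $ch(\mathbb{X})$. 2. The category $\mathcal{T}_{\mathbf{tr}_{n-1}}$ is equivalent to $ch(\mathbb{X})_{\geq n}$. 3. The coreflector of $ch(\mathbb{X})_{\geq n}$ is given by $\mathbf{cot}'_n$. 4. The restriction of $(ch(\mathbb{X})_{\geq n},\mathcal{F}_{\mathbf{tr}_{n-1}})$ to $pch(\mathbb{X})$ is the torsion theory $(pch(\mathbb{X})_{\geq n},\mathcal{MN}_n)$ in $pch(\mathbb{X})$.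
   Context: A chain complex $M$ in $\mathbb{X}$ is a family of morphisms $\delta_i:M_i\to M_{i-1}$ ($i\in\mathbb{Z}$) with $\delta_i\delta_{i+1}=0$; it is proper if in each normal epi/mono factorization $\delta_i=m_ie_i$ the image $m_i$ is a normal monomorphism. $ch(\mathbb{X})$ is the (semi-abelian) category of chain complexes and $pch(\mathbb{X})$ its full subcategory of proper chain complexes. A short exact sequence in $pch(\mathbb{X})$ means a short exact sequence in $ch(\mathbb{X})$ all of whose terms are proper. A torsion theory is a pair $(\mathcal{T},\mathcal{F})$ of full replete subcategories such that every morphism $T\to F$ with $T\in\mathcal{T}$, $F\in\mathcal{F}$ is zero, and every object $X$ admits a short exact sequence $0\to T_X\to X\to F_X\to0$ with $T_X\in\mathcal{T}$, $F_X\in\mathcal{F}$. It is hereditary if $\mathcal{T}$ is closed under subobjects. A localization is a (full) reflective subcategory whose reflector $L$ preserves finite limits; with unit $\eta$, set $\mathcal{T}_L=\{X\mid L(X)\cong0\}$ and $\mathcal{F}_L=\{X\mid\eta_X\text{ is monic}\}$. $ch(\mathbb{X})_{n-1\geq}$ is the category of chain complexes defined in degrees $\le n-1$; $\mathbf{tr}_{n-1}$ forgets the degrees $\ge n$; its right adjoint $\mathbf{cosk}_{n-1}$ sends $M$ to $\dots\to0\to\mathrm{Ker}(\delta_{n-1})\to M_{n-1}\to M_{n-2}\to\dots$ (with $\mathrm{Ker}(\delta_{n-1})$ in degree $n$). $ch(\mathbb{X})_{\geq n}$ (resp. $pch(\mathbb{X})_{\geq n}$) is the category of (proper) chain complexes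 with $M_i=0$ for $i<n$. $\mathbf{cot}'_n: ch(\mathbb{X})\to ch(\mathbb{X})_{\geq n}$ sends $M$ to $\dots\to M_{n+2}\to M_{n+1}\to\mathrm{Ker}(\delta_n)$, with $\mathrm{Ker}(\delta_n)$ in degree $n$. $\mathcal{MN}_n$ is the full subcategory of $pch(\mathbb{X})$ of those $M$ with $\delta_n$ a normal monomorphism and $M_i=0$ for $i>n$. The restriction of a pair of subcategories to $pch(\mathbb{X})$ is obtained by intersecting each with $pch(\mathbb{X})$. *)

theory Defs
  imports Main "HOL-Library.FuncSet"
begin

section \<open>Categories, functors, adjunctions\<close>

text \<open>\<open>g \<cdot>\<^bsub>C\<^esub> f\<close> is the composite \<open>g\<close> after \<open>f\<close>; it is meaningful only if \<open>Dom C g = Cod C f\<close>.\<close>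

record ('o, 'a) cat =
  Obj :: "'o set"
  Arr :: "'a set"
  Dom :: "'a \<Rightarrow> 'o"
  Cod :: "'a \<Rightarrow> 'o"
  Ident :: "'o \<Rightarrow> 'a"
  Comp :: "'a \<Rightarrow> 'a \<Rightarrow> 'a" (infixr "\<cdot>\<index>" 70)

definition hom :: "('o, 'a) cat \<Rightarrow> 'o \<Rightarrow> 'o \<Rightarrow> 'a set" where
  "hom C A B = {f \<in> Arr C. Dom C f = A \<and> Cod C f = B}"

locale category =
  fixes C :: "('o, 'a) cat"
  assumes Dom_Obj: "f \<in> Arr C \<Longrightarrow> Dom C f \<in> Obj C"
    and Cod_Obj: "f \<in> Arr C \<Longrightarrow> Cod C f \<in> Obj C"
    and Ident_hom: "A \<in> Obj C \<Longrightarrow> Ident C A \<in> hom C A A"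
    and Comp_hom: "\<lbrakk>f \<in> hom C A B; g \<in> hom C B D\<rbrakk> \<Longrightarrow> g \<cdot>\<^bsub>C\<^esub> f \<in> hom C A D"
    and Comp_Ident: "f \<in> hom C A B \<Longrightarrow> f \<cdot>\<^bsub>C\<^esub> Ident C A = f"
    and Ident_Comp: "f \<in> hom C A B \<Longrightarrow> Ident C B \<cdot>\<^bsub>C\<^esub> f = f"
    and Comp_assoc: "\<lbrakk>f \<in> hom C A B; g \<in> hom C B D; h \<in> hom C D E\<rbrakk>
      \<Longrightarrow> h \<cdot>\<^bsub>C\<^esub> (g \<cdot>\<^bsub>C\<^esub> f) = (h \<cdot>\<^bsub>C\<^esub> g) \<cdot>\<^bsub>C\<^esub> f"



definition full_subcat :: "('o, 'a) cat \<Rightarrow> 'o set \<Rightarrow> ('o, 'a) cat" where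
  "full_subcat C S = C\<lparr>Obj := Obj C \<inter> S, Arr := {f \<in> Arr C. Dom C f \<in> S \<and> Cod C f \<in> S}\<rparr>"

record ('o, 'a, 'p, 'b) fctr =
  Fobj :: "'o \<Rightarrow> 'p"
  Farr :: "'a \<Rightarrow> 'b"

definition is_functor :: "('o, 'a) cat \<Rightarrow> ('p, 'b) cat \<Rightarrow> ('o, 'a, 'p, 'b) fctr \<Rightarrow> bool" where
  "is_functor C D F \<longleftrightarrow> category C \<and> category D \<and>
    (\<forall>A \<in> Obj C. Fobj F A \<in> Obj D) \<and>
    (\<forall>f \<in> Arr C. Farr F f \<in> hom D (Fobj F (Dom C f)) (Fobj F (Cod C f))) \<and>
    (\<forall>A \<in> Obj C. Farr F (Ident C A) = Ident D (Fobj F A)) \<and>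
    (\<forall>f \<in> Arr C. \<forall>g \<in> Arr C. Dom C g = Cod C f \<longrightarrow>
      Farr F (g \<cdot>\<^bsub>C\<^esub> f) = Farr F g \<cdot>\<^bsub>D\<^esub> Farr F f)"

definition id_fctr :: "('o, 'a, 'o, 'a) fctr" where
  "id_fctr = \<lparr>Fobj = (\<lambda>A. A), Farr = (\<lambda>f. f)\<rparr>"

definition comp_fctr ::
  "('p, 'b, 'q, 'c) fctr \<Rightarrow> ('o, 'a, 'p, 'b) fctr \<Rightarrow> ('o, 'a, 'q, 'c) fctr" where
  "comp_fctr G F = \<lparr>Fobj = (\<lambda>A. Fobj G (Fobj F A)), Farr = (\<lambda>f. Farr G (Farr F f))\<rparr>"

definition full_faithful :: "('o, 'a) cat \<Rightarrow> ('p, 'b) cat \<Rightarrow> ('o, 'a, 'p, 'b) fctr \<Rightarrow> bool" where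
  "full_faithful C D F \<longleftrightarrow> (\<forall>A \<in> Obj C. \<forall>B \<in> Obj C.
    bij_betw (Farr F) (hom C A B) (hom D (Fobj F A) (Fobj F B)))"

definition nat_trans :: "('o, 'a) cat \<Rightarrow> ('p, 'b) cat \<Rightarrow> ('o, 'a, 'p, 'b) fctr \<Rightarrow>
    ('o, 'a, 'p, 'b) fctr \<Rightarrow> ('o \<Rightarrow> 'b) \<Rightarrow> bool" where
  "nat_trans C D F G \<tau> \<longleftrightarrow>
    (\<forall>A \<in> Obj C. \<tau> A \<in> hom D (Fobj F A) (Fobj G A)) \<and>
    (\<forall>f \<in> Arr C. Farr G f \<cdot>\<^bsub>D\<^esub> \<tau> (Dom C f) = \<tau> (Cod C f) \<cdot>\<^bsub>D\<^esub> Farr F f)"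

definition iso :: "('o, 'a) cat \<Rightarrow> 'a \<Rightarrow> bool" where
  "iso C f \<longleftrightarrow> f \<in> Arr C \<and> (\<exists>g \<in> hom C (Cod C f) (Dom C f).
    g \<cdot>\<^bsub>C\<^esub> f = Ident C (Dom C f) \<and> f \<cdot>\<^bsub>C\<^esub> g = Ident C (Cod C f))"

definition isomorphic :: "('o, 'a) cat \<Rightarrow> 'o \<Rightarrow> 'o \<Rightarrow> bool" where
  "isomorphic C A B \<longleftrightarrow> (\<exists>f \<in> hom C A B. iso C f)"

definition equivalent_cats :: "('o, 'a) cat \<Rightarrow> ('p, 'b) cat \<Rightarrow> bool" where
  "equivalent_cats C D \<longleftrightarrow> (\<exists>F G \<eta> \<epsilon>. is_functor C D F \<and> is_functor D C G \<and>
    nat_trans C C id_fctr (comp_fctr G F) \<eta> \<and> (\<forall>A \<in> Obj C. iso C (\<eta> A)) \<and>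
    nat_trans D D (comp_fctr F G) id_fctr \<epsilon> \<and> (\<forall>B \<in> Obj D. iso D (\<epsilon> B)))"

text \<open>\<open>F : C \<rightarrow> D\<close> is left adjoint to \<open>G : D \<rightarrow> C\<close> with unit \<open>\<eta>\<close>.\<close>

definition adjunction :: "('o, 'a) cat \<Rightarrow> ('p, 'b) cat \<Rightarrow> ('o, 'a, 'p, 'b) fctr \<Rightarrow>
    ('p, 'b, 'o, 'a) fctr \<Rightarrow> ('o \<Rightarrow> 'a) \<Rightarrow> bool" where
  "adjunction C D F G \<eta> \<longleftrightarrow> is_functor C D F \<and> is_functor D C G \<and>
    nat_trans C C id_fctr (comp_fctr G F) \<eta> \<and>
    (\<forall>A \<in> Obj C. \<forall>B \<in> Obj D. \<forall>f \<in> hom C A (Fobj G B).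
      \<exists>!g. g \<in> hom D (Fobj F A) B \<and> Farr G g \<cdot>\<^bsub>C\<^esub> \<eta> A = f)"

text \<open>\<open>R : C \<rightarrow> full_subcat C S\<close> is right adjoint to the inclusion.\<close>

definition coreflector :: "('o, 'a) cat \<Rightarrow> 'o set \<Rightarrow> ('o, 'a, 'o, 'a) fctr \<Rightarrow> bool" where
  "coreflector C S R \<longleftrightarrow> (\<exists>\<eta>. adjunction (full_subcat C S) C id_fctr R \<eta>)"

section \<open>Limits\<close>

text \<open>Every finite category is isomorphic to one whose objects and arrows are natural numbers,
  so these serve as the shapes of finite diagrams.\<close>

definition finite_cat :: "('o, 'a) cat \<Rightarrow> bool" where
  "finite_cat J \<longleftrightarrow> category J \<and> finite (Obj J) \<and> finite (Arr J)"

definition cone :: "('j, 'k) cat \<Rightarrow> ('o, 'a) cat \<Rightarrow> ('j, 'k, 'o, 'a) fctr \<Rightarrow> 'o \<Rightarrow>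
    ('j \<Rightarrow> 'a) \<Rightarrow> bool" where
  "cone J C D A l \<longleftrightarrow> A \<in> Obj C \<and> (\<forall>j \<in> Obj J. l j \<in> hom C A (Fobj D j)) \<and>
    (\<forall>u \<in> Arr J. Farr D u \<cdot>\<^bsub>C\<^esub> l (Dom J u) = l (Cod J u))"

definition limit_cone :: "('j, 'k) cat \<Rightarrow> ('o, 'a) cat \<Rightarrow> ('j, 'k, 'o, 'a) fctr \<Rightarrow> 'o \<Rightarrow>
    ('j \<Rightarrow> 'a) \<Rightarrow> bool" where
  "limit_cone J C D A l \<longleftrightarrow> cone J C D A l \<and>
    (\<forall>B m. cone J C D B m \<longrightarrow> (\<exists>!h. h \<in> hom C B A \<and> (\<forall>j \<in> Obj J. l j \<cdot>\<^bsub>C\<^esub> h = m j)))"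

definition has_finite_limits :: "('o, 'a) cat \<Rightarrow> bool" where
  "has_finite_limits C \<longleftrightarrow> (\<forall>(J :: (nat, nat) cat) D. finite_cat J \<and> is_functor J C D \<longrightarrow>
    (\<exists>A l. limit_cone J C D A l))"

definition preserves_finite_limits ::
  "('o, 'a) cat \<Rightarrow> ('p, 'b) cat \<Rightarrow> ('o, 'a, 'p, 'b) fctr \<Rightarrow> bool" where
  "preserves_finite_limits C C' F \<longleftrightarrow> (\<forall>(J :: (nat, nat) cat) D A l.
    finite_cat J \<and> is_functor J C D \<and> limit_cone J C D A l \<longrightarrow>
    limit_cone J C' (comp_fctr F D) (Fobj F A) (\<lambda>j. Farr F (l j)))"

definition is_pullback :: "('o, 'a) cat \<Rightarrow> 'a \<Rightarrow> 'a \<Rightarrow> 'a \<Rightarrow> 'a \<Rightarrow> bool" where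
  "is_pullback C f g p q \<longleftrightarrow>
    f \<in> Arr C \<and> g \<in> Arr C \<and> Cod C f = Cod C g \<and>
    p \<in> Arr C \<and> q \<in> Arr C \<and> Dom C p = Dom C q \<and> Cod C p = Dom C f \<and> Cod C q = Dom C g \<and>
    f \<cdot>\<^bsub>C\<^esub> p = g \<cdot>\<^bsub>C\<^esub> q \<and>
    (\<forall>T. \<forall>s \<in> hom C T (Dom C f). \<forall>t \<in> hom C T (Dom C g). f \<cdot>\<^bsub>C\<^esub> s = g \<cdot>\<^bsub>C\<^esub> t \<longrightarrow>
      (\<exists>!u. u \<in> hom C T (Dom C p) \<and> p \<cdot>\<^bsub>C\<^esub> u = s \<and> q \<cdot>\<^bsub>C\<^esub> u = t))"

definition is_coequalizer :: "('o, 'a) cat \<Rightarrow> 'a \<Rightarrow> 'a \<Rightarrow> 'a \<Rightarrow> bool" where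
  "is_coequalizer C u v e \<longleftrightarrow>
    u \<in> Arr C \<and> v \<in> Arr C \<and> Dom C u = Dom C v \<and> Cod C u = Cod C v \<and>
    e \<in> Arr C \<and> Dom C e = Cod C u \<and> e \<cdot>\<^bsub>C\<^esub> u = e \<cdot>\<^bsub>C\<^esub> v \<and>
    (\<forall>T. \<forall>t \<in> hom C (Cod C u) T. t \<cdot>\<^bsub>C\<^esub> u = t \<cdot>\<^bsub>C\<^esub> v \<longrightarrow>
      (\<exists>!w. w \<in> hom C (Cod C e) T \<and> w \<cdot>\<^bsub>C\<^esub> e = t))"

definition is_coproduct :: "('o, 'a) cat \<Rightarrow> 'o \<Rightarrow> 'o \<Rightarrow> 'a \<Rightarrow> 'a \<Rightarrow> bool" where
  "is_coproduct C A B i j \<longleftrightarrow>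
    i \<in> hom C A (Cod C i) \<and> j \<in> hom C B (Cod C i) \<and>
    (\<forall>T. \<forall>s \<in> hom C A T. \<forall>t \<in> hom C B T.
      (\<exists>!w. w \<in> hom C (Cod C i) T \<and> w \<cdot>\<^bsub>C\<^esub> i = s \<and> w \<cdot>\<^bsub>C\<^esub> j = t))"

definition has_binary_coproducts :: "('o, 'a) cat \<Rightarrow> bool" where
  "has_binary_coproducts C \<longleftrightarrow> (\<forall>A \<in> Obj C. \<forall>B \<in> Obj C. \<exists>i j. is_coproduct C A B i j)"

definition monic :: "('o, 'a) cat \<Rightarrow> 'a \<Rightarrow> bool" where
  "monic C m \<longleftrightarrow> m \<in> Arr C \<and> (\<forall>T. \<forall>s \<in> hom C T (Dom C m). \<forall>t \<in> hom C T (Dom C m).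
    m \<cdot>\<^bsub>C\<^esub> s = m \<cdot>\<^bsub>C\<^esub> t \<longrightarrow> s = t)"

section \<open>Zero objects, kernels and cokernels\<close>

definition is_zero :: "('o, 'a) cat \<Rightarrow> 'o \<Rightarrow> bool" where
  "is_zero C Z \<longleftrightarrow> Z \<in> Obj C \<and>
    (\<forall>A \<in> Obj C. (\<exists>!f. f \<in> hom C A Z) \<and> (\<exists>!f. f \<in> hom C Z A))"

definition pointed :: "('o, 'a) cat \<Rightarrow> bool" where
  "pointed C \<longleftrightarrow> (\<exists>Z. is_zero C Z)"

definition zero_mor :: "('o, 'a) cat \<Rightarrow> 'a \<Rightarrow> bool" where
  "zero_mor C f \<longleftrightarrow> f \<in> Arr C \<and> (\<exists>Z g h. is_zero C Z \<and>
    g \<in> hom C (Dom C f) Z \<and> h \<in> hom C Z (Cod C f) \<and> f = h \<cdot>\<^bsub>C\<^esub> g)"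

definition is_kernel :: "('o, 'a) cat \<Rightarrow> 'a \<Rightarrow> 'a \<Rightarrow> bool" where
  "is_kernel C f k \<longleftrightarrow> f \<in> Arr C \<and> k \<in> Arr C \<and> Cod C k = Dom C f \<and> zero_mor C (f \<cdot>\<^bsub>C\<^esub> k) \<and>
    (\<forall>T. \<forall>t \<in> hom C T (Dom C f). zero_mor C (f \<cdot>\<^bsub>C\<^esub> t) \<longrightarrow>
      (\<exists>!u. u \<in> hom C T (Dom C k) \<and> k \<cdot>\<^bsub>C\<^esub> u = t))"

definition is_cokernel :: "('o, 'a) cat \<Rightarrow> 'a \<Rightarrow> 'a \<Rightarrow> bool" where
  "is_cokernel C f q \<longleftrightarrow> f \<in> Arr C \<and> q \<in> Arr C \<and> Dom C q = Cod C f \<and> zero_mor C (q \<cdot>\<^bsub>C\<^esub> f) \<and>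
    (\<forall>T. \<forall>t \<in> hom C (Cod C f) T. zero_mor C (t \<cdot>\<^bsub>C\<^esub> f) \<longrightarrow>
      (\<exists>!u. u \<in> hom C (Cod C q) T \<and> u \<cdot>\<^bsub>C\<^esub> q = t))"

definition normal_mono :: "('o, 'a) cat \<Rightarrow> 'a \<Rightarrow> bool" where
  "normal_mono C m \<longleftrightarrow> (\<exists>f. is_kernel C f m)"

definition normal_epi :: "('o, 'a) cat \<Rightarrow> 'a \<Rightarrow> bool" where
  "normal_epi C e \<longleftrightarrow> (\<exists>f. is_cokernel C f e)"

text \<open>\<open>0 \<rightarrow> K \<rightarrow> A \<rightarrow> Q \<rightarrow> 0\<close> with maps \<open>k\<close> and \<open>q\<close>.\<close>

definition short_exact :: "('o, 'a) cat \<Rightarrow> 'a \<Rightarrow> 'a \<Rightarrow> bool" where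
  "short_exact C k q \<longleftrightarrow> is_kernel C q k \<and> is_cokernel C k q"

text \<open>Chosen zero object, zero morphisms, kernels, and the factorization of \<open>t\<close> through a
  kernel (or any monomorphism) \<open>k\<close>.\<close>

definition zero_of :: "('o, 'a) cat \<Rightarrow> 'o" where
  "zero_of C = (SOME Z. is_zero C Z)"

definition zero_arr :: "('o, 'a) cat \<Rightarrow> 'o \<Rightarrow> 'o \<Rightarrow> 'a" where
  "zero_arr C A B = (THE f. f \<in> hom C A B \<and> zero_mor C f)"

definition ker :: "('o, 'a) cat \<Rightarrow> 'a \<Rightarrow> 'a" where
  "ker C f = (SOME k. is_kernel C f k)"

definition Ker :: "('o, 'a) cat \<Rightarrow> 'a \<Rightarrow> 'o" where
  "Ker C f = Dom C (ker C f)"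

definition lift :: "('o, 'a) cat \<Rightarrow> 'a \<Rightarrow> 'a \<Rightarrow> 'a" where
  "lift C k t = (THE u. u \<in> hom C (Dom C t) (Dom C k) \<and> k \<cdot>\<^bsub>C\<^esub> u = t)"

section \<open>Semi-abelian categories\<close>

definition regular_epi :: "('o, 'a) cat \<Rightarrow> 'a \<Rightarrow> bool" where
  "regular_epi C e \<longleftrightarrow> (\<exists>u v. is_coequalizer C u v e)"

definition regular_cat :: "('o, 'a) cat \<Rightarrow> bool" where
  "regular_cat C \<longleftrightarrow> category C \<and> has_finite_limits C \<and>
    (\<forall>f p q. is_pullback C f f p q \<longrightarrow> (\<exists>e. is_coequalizer C p q e)) \<and>
    (\<forall>f g p q. is_pullback C f g p q \<and> regular_epi C f \<longrightarrow> regular_epi C q)"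

definition equiv_relation :: "('o, 'a) cat \<Rightarrow> 'a \<Rightarrow> 'a \<Rightarrow> bool" where
  "equiv_relation C r1 r2 \<longleftrightarrow>
    r1 \<in> Arr C \<and> r2 \<in> Arr C \<and> Dom C r1 = Dom C r2 \<and> Cod C r1 = Cod C r2 \<and>
    (\<forall>T. \<forall>s \<in> hom C T (Dom C r1). \<forall>t \<in> hom C T (Dom C r1).
      r1 \<cdot>\<^bsub>C\<^esub> s = r1 \<cdot>\<^bsub>C\<^esub> t \<and> r2 \<cdot>\<^bsub>C\<^esub> s = r2 \<cdot>\<^bsub>C\<^esub> t \<longrightarrow> s = t) \<and>
    (\<exists>d \<in> hom C (Cod C r1) (Dom C r1).
      r1 \<cdot>\<^bsub>C\<^esub> d = Ident C (Cod C r1) \<and> r2 \<cdot>\<^bsub>C\<^esub> d = Ident C (Cod C r1)) \<and>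
    (\<exists>t \<in> hom C (Dom C r1) (Dom C r1). r1 \<cdot>\<^bsub>C\<^esub> t = r2 \<and> r2 \<cdot>\<^bsub>C\<^esub> t = r1) \<and>
    (\<forall>p q. is_pullback C r2 r1 p q \<longrightarrow> (\<exists>c \<in> hom C (Dom C p) (Dom C r1).
      r1 \<cdot>\<^bsub>C\<^esub> c = r1 \<cdot>\<^bsub>C\<^esub> p \<and> r2 \<cdot>\<^bsub>C\<^esub> c = r2 \<cdot>\<^bsub>C\<^esub> q))"

definition barr_exact :: "('o, 'a) cat \<Rightarrow> bool" where
  "barr_exact C \<longleftrightarrow> regular_cat C \<and>
    (\<forall>r1 r2. equiv_relation C r1 r2 \<longrightarrow> (\<exists>f. is_pullback C f f r1 r2))"

text \<open>A point is a split epimorphism \<open>p\<close> with a chosen section \<open>s\<close>.\<close>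

definition point :: "('o, 'a) cat \<Rightarrow> 'a \<Rightarrow> 'a \<Rightarrow> bool" where
  "point C p s \<longleftrightarrow> p \<in> Arr C \<and> s \<in> hom C (Cod C p) (Dom C p) \<and>
    p \<cdot>\<^bsub>C\<^esub> s = Ident C (Cod C p)"

text \<open>Bourn's definition: every change-of-base functor \<open>v\<^sup>* : Pt\<^sub>B \<rightarrow> Pt\<^sub>E\<close> of the fibration of points
  reflects isomorphisms.  Here \<open>h : (p, s) \<rightarrow> (p', s')\<close> is a morphism of points over
  \<open>B = Cod C v\<close>, and \<open>h'\<close> is its image under \<open>v\<^sup>*\<close>, computed with arbitrary pullbacks of \<open>p\<close> and
  \<open>p'\<close> along \<open>v\<close>.  A morphism of points is invertible iff its underlying morphism is.\<close>

definition protomodular :: "('o, 'a) cat \<Rightarrow> bool" where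
  "protomodular C \<longleftrightarrow> (\<forall>v p s p' s' h a q a' q' h'.
    point C p s \<and> point C p' s' \<and>
    h \<in> hom C (Dom C p) (Dom C p') \<and> p' \<cdot>\<^bsub>C\<^esub> h = p \<and> h \<cdot>\<^bsub>C\<^esub> s = s' \<and>
    is_pullback C p v a q \<and> is_pullback C p' v a' q' \<and>
    h' \<in> hom C (Dom C q) (Dom C q') \<and> a' \<cdot>\<^bsub>C\<^esub> h' = h \<cdot>\<^bsub>C\<^esub> a \<and> q' \<cdot>\<^bsub>C\<^esub> h' = q \<and>
    iso C h' \<longrightarrow> iso C h)"

definition semi_abelian :: "('o, 'a) cat \<Rightarrow> bool" where
  "semi_abelian C \<longleftrightarrow> category C \<and> pointed C \<and> barr_exact C \<and> protomodular C \<and>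
    has_binary_coproducts C"

section \<open>Torsion theories and localizations\<close>

definition replete :: "('o, 'a) cat \<Rightarrow> 'o set \<Rightarrow> bool" where
  "replete C S \<longleftrightarrow> S \<subseteq> Obj C \<and> (\<forall>A \<in> S. \<forall>B \<in> Obj C. isomorphic C A B \<longrightarrow> B \<in> S)"

text \<open>The parameter \<open>E\<close> says which pairs of morphisms count as short exact sequences; full
  subcategories are identified with their classes of objects.\<close>

definition torsion_theory ::
  "('o, 'a) cat \<Rightarrow> ('a \<Rightarrow> 'a \<Rightarrow> bool) \<Rightarrow> 'o set \<Rightarrow> 'o set \<Rightarrow> bool" where
  "torsion_theory C E T F \<longleftrightarrow> replete C T \<and> replete C F \<and>
    (\<forall>A \<in> T. \<forall>B \<in> F. \<forall>f \<in> hom C A B. zero_mor C f) \<and>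
    (\<forall>A \<in> Obj C. \<exists>K \<in> T. \<exists>Q \<in> F. \<exists>k \<in> hom C K A. \<exists>q \<in> hom C A Q. E k q)"

definition hereditary_torsion_theory ::
  "('o, 'a) cat \<Rightarrow> ('a \<Rightarrow> 'a \<Rightarrow> bool) \<Rightarrow> 'o set \<Rightarrow> 'o set \<Rightarrow> bool" where
  "hereditary_torsion_theory C E T F \<longleftrightarrow> torsion_theory C E T F \<and>
    (\<forall>m. monic C m \<and> Cod C m \<in> T \<longrightarrow> Dom C m \<in> T)"

text \<open>The full reflective subcategory is presented by its inclusion, a fully faithful right
  adjoint \<open>G\<close>; the reflector is \<open>L\<close>.\<close>

definition localization :: "('o, 'a) cat \<Rightarrow> ('p, 'b) cat \<Rightarrow> ('o, 'a, 'p, 'b) fctr \<Rightarrow>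
    ('p, 'b, 'o, 'a) fctr \<Rightarrow> ('o \<Rightarrow> 'a) \<Rightarrow> bool" where
  "localization C D L G \<eta> \<longleftrightarrow> adjunction C D L G \<eta> \<and> full_faithful D C G \<and>
    preserves_finite_limits C D L"

definition loc_torsion :: "('o, 'a) cat \<Rightarrow> ('p, 'b) cat \<Rightarrow> ('o, 'a, 'p, 'b) fctr \<Rightarrow> 'o set" where
  "loc_torsion C D L = {A \<in> Obj C. \<exists>Z. is_zero D Z \<and> isomorphic D (Fobj L A) Z}"

definition loc_free :: "('o, 'a) cat \<Rightarrow> ('o \<Rightarrow> 'a) \<Rightarrow> 'o set" where
  "loc_free C \<eta> = {A \<in> Obj C. monic C (\<eta> A)}"

section \<open>Chain complexes\<close>

text \<open>Complexes defined in the degrees belonging to \<open>I\<close> (below: all degrees, or an initial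
  segment); the differential \<open>cdiff M i\<close> goes from degree \<open>i\<close> to degree \<open>i - 1\<close>.  Outside
  their range of definition the families have the value \<open>undefined\<close>, so that equality of
  complexes is equality of the actual data.\<close>

record ('o, 'a) cplx =
  cobj :: "int \<Rightarrow> 'o"
  cdiff :: "int \<Rightarrow> 'a"

record ('o, 'a) cmor =
  csrc :: "('o, 'a) cplx"
  ctgt :: "('o, 'a) cplx"
  ccomp :: "int \<Rightarrow> 'a"

definition chain_complex :: "('o, 'a) cat \<Rightarrow> int set \<Rightarrow> ('o, 'a) cplx \<Rightarrow> bool" where
  "chain_complex X I M \<longleftrightarrow>
    (\<forall>i. if i \<in> I then cobj M i \<in> Obj X else cobj M i = undefined) \<and>
    (\<forall>i. if i \<in> I \<and> i - 1 \<in> I then cdiff M i \<in> hom X (cobj M i) (cobj M (i - 1))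
      else cdiff M i = undefined) \<and>
    (\<forall>i. i + 1 \<in> I \<and> i \<in> I \<and> i - 1 \<in> I \<longrightarrow> zero_mor X (cdiff M i \<cdot>\<^bsub>X\<^esub> cdiff M (i + 1)))"

definition chain_map :: "('o, 'a) cat \<Rightarrow> int set \<Rightarrow> ('o, 'a) cmor \<Rightarrow> bool" where
  "chain_map X I f \<longleftrightarrow> chain_complex X I (csrc f) \<and> chain_complex X I (ctgt f) \<and>
    (\<forall>i. if i \<in> I then ccomp f i \<in> hom X (cobj (csrc f) i) (cobj (ctgt f) i)
      else ccomp f i = undefined) \<and>
    (\<forall>i. i \<in> I \<and> i - 1 \<in> I \<longrightarrow>
      cdiff (ctgt f) i \<cdot>\<^bsub>X\<^esub> ccomp f i = ccomp f (i - 1) \<cdot>\<^bsub>X\<^esub> cdiff (csrc f) i)"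

definition ch_on :: "('o, 'a) cat \<Rightarrow> int set \<Rightarrow> (('o, 'a) cplx, ('o, 'a) cmor) cat" where
  "ch_on X I = \<lparr>
    Obj = {M. chain_complex X I M},
    Arr = {f. chain_map X I f},
    Dom = csrc,
    Cod = ctgt,
    Ident = (\<lambda>M. \<lparr>csrc = M, ctgt = M, ccomp = restrict (\<lambda>i. Ident X (cobj M i)) I\<rparr>),
    Comp = (\<lambda>g f. \<lparr>csrc = csrc f, ctgt = ctgt g,
                    ccomp = restrict (\<lambda>i. ccomp g i \<cdot>\<^bsub>X\<^esub> ccomp f i) I\<rparr>)\<rparr>"

definition ch :: "('o, 'a) cat \<Rightarrow> (('o, 'a) cplx, ('o, 'a) cmor) cat" where
  "ch X = ch_on X UNIV"

definition ch_le :: "('o, 'a) cat \<Rightarrow> int \<Rightarrow> (('o, 'a) cplx, ('o, 'a) cmor) cat" where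
  "ch_le X m = ch_on X {..m}"

definition proper :: "('o, 'a) cat \<Rightarrow> ('o, 'a) cplx \<Rightarrow> bool" where
  "proper X M \<longleftrightarrow> (\<forall>i m e. normal_epi X e \<and> monic X m \<and> Dom X m = Cod X e \<and>
    cdiff M i = m \<cdot>\<^bsub>X\<^esub> e \<longrightarrow> normal_mono X m)"

definition pch :: "('o, 'a) cat \<Rightarrow> (('o, 'a) cplx, ('o, 'a) cmor) cat" where
  "pch X = full_subcat (ch X) {M. proper X M}"

definition pch_short_exact ::
  "('o, 'a) cat \<Rightarrow> ('o, 'a) cmor \<Rightarrow> ('o, 'a) cmor \<Rightarrow> bool" where
  "pch_short_exact X k q \<longleftrightarrow> short_exact (ch X) k q \<and> k \<in> Arr (pch X) \<and> q \<in> Arr (pch X)"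

text \<open>The condition \<open>M\<^sub>i = 0\<close> means that \<open>M\<^sub>i\<close> is a zero object, not that it equals a chosen
  one; this makes the following classes replete.\<close>

definition ch_ge_obj :: "('o, 'a) cat \<Rightarrow> int \<Rightarrow> ('o, 'a) cplx set" where
  "ch_ge_obj X n = {M \<in> Obj (ch X). \<forall>i<n. is_zero X (cobj M i)}"

definition pch_ge_obj :: "('o, 'a) cat \<Rightarrow> int \<Rightarrow> ('o, 'a) cplx set" where
  "pch_ge_obj X n = {M \<in> Obj (pch X). \<forall>i<n. is_zero X (cobj M i)}"

definition MN_obj :: "('o, 'a) cat \<Rightarrow> int \<Rightarrow> ('o, 'a) cplx set" where
  "MN_obj X n = {M \<in> Obj (pch X). normal_mono X (cdiff M n) \<and> (\<forall>i>n. is_zero X (cobj M i))}"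

definition ch_ge :: "('o, 'a) cat \<Rightarrow> int \<Rightarrow> (('o, 'a) cplx, ('o, 'a) cmor) cat" where
  "ch_ge X n = full_subcat (ch X) (ch_ge_obj X n)"

type_synonym ('o, 'a) cplx_fctr =
  "(('o, 'a) cplx, ('o, 'a) cmor, ('o, 'a) cplx, ('o, 'a) cmor) fctr"

definition tr_obj :: "int \<Rightarrow> ('o, 'a) cplx \<Rightarrow> ('o, 'a) cplx" where
  "tr_obj m M = \<lparr>cobj = restrict (cobj M) {..m}, cdiff = restrict (cdiff M) {..m}\<rparr>"

definition tr :: "int \<Rightarrow> ('o, 'a) cplx_fctr" where
  "tr m = \<lparr>
    Fobj = tr_obj m,
    Farr = (\<lambda>f. \<lparr>csrc = tr_obj m (csrc f), ctgt = tr_obj m (ctgt f),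
                  ccomp = restrict (ccomp f) {..m}\<rparr>)\<rparr>"

text \<open>\<open>cosk X m N\<close> is
  \<open>\<dots> \<rightarrow> 0 \<rightarrow> Ker (\<delta>\<^sub>m) \<rightarrow> N\<^sub>m \<rightarrow> N\<^sub>m\<^sub>-\<^sub>1 \<rightarrow> \<dots>\<close> with the kernel in degree \<open>m + 1\<close>.\<close>

definition cosk_cobj :: "('o, 'a) cat \<Rightarrow> int \<Rightarrow> ('o, 'a) cplx \<Rightarrow> int \<Rightarrow> 'o" where
  "cosk_cobj X m N i =
    (if i \<le> m then cobj N i
     else if i = m + 1 then Ker X (cdiff N m)
     else zero_of X)"

definition cosk_obj :: "('o, 'a) cat \<Rightarrow> int \<Rightarrow> ('o, 'a) cplx \<Rightarrow> ('o, 'a) cplx" where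
  "cosk_obj X m N = \<lparr>
    cobj = cosk_cobj X m N,
    cdiff = (\<lambda>i. if i \<le> m then cdiff N i
                 else if i = m + 1 then ker X (cdiff N m)
                 else zero_arr X (cosk_cobj X m N i) (cosk_cobj X m N (i - 1)))\<rparr>"

definition cosk :: "('o, 'a) cat \<Rightarrow> int \<Rightarrow> ('o, 'a) cplx_fctr" where
  "cosk X m = \<lparr>
    Fobj = cosk_obj X m,
    Farr = (\<lambda>f. \<lparr>csrc = cosk_obj X m (csrc f), ctgt = cosk_obj X m (ctgt f),
      ccomp = (\<lambda>i. if i \<le> m then ccomp f i
                   else if i = m + 1
                     then lift X (ker X (cdiff (ctgt f) m))
                            (ccomp f m \<cdot>\<^bsub>X\<^esub> ker X (cdiff (csrc f) m))
                   else zero_arr X (cosk_cobj X m (csrc f) i) (cosk_cobj X m (ctgt f) i))\<rparr>)\<rparr>"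

text \<open>\<open>cot' X n M\<close> is \<open>\<dots> \<rightarrow> M\<^sub>n\<^sub>+\<^sub>2 \<rightarrow> M\<^sub>n\<^sub>+\<^sub>1 \<rightarrow> Ker (\<delta>\<^sub>n) \<rightarrow> 0 \<rightarrow> \<dots>\<close> with the kernel in
  degree \<open>n\<close>.\<close>

definition cot'_cobj :: "('o, 'a) cat \<Rightarrow> int \<Rightarrow> ('o, 'a) cplx \<Rightarrow> int \<Rightarrow> 'o" where
  "cot'_cobj X n M i =
    (if i > n then cobj M i
     else if i = n then Ker X (cdiff M n)
     else zero_of X)"

definition cot'_obj :: "('o, 'a) cat \<Rightarrow> int \<Rightarrow> ('o, 'a) cplx \<Rightarrow> ('o, 'a) cplx" where
  "cot'_obj X n M = \<lparr>
    cobj = cot'_cobj X n M,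
    cdiff = (\<lambda>i. if i > n + 1 then cdiff M i
                 else if i = n + 1 then lift X (ker X (cdiff M n)) (cdiff M (n + 1))
                 else zero_arr X (cot'_cobj X n M i) (cot'_cobj X n M (i - 1)))\<rparr>"

definition cot' :: "('o, 'a) cat \<Rightarrow> int \<Rightarrow> ('o, 'a) cplx_fctr" where
  "cot' X n = \<lparr>
    Fobj = cot'_obj X n,
    Farr = (\<lambda>f. \<lparr>csrc = cot'_obj X n (csrc f), ctgt = cot'_obj X n (ctgt f),
      ccomp = (\<lambda>i. if i > n then ccomp f i
                   else if i = n
                     then lift X (ker X (cdiff (ctgt f) n))
                            (ccomp f n \<cdot>\<^bsub>X\<^esub> ker X (cdiff (csrc f) n))
                   else zero_arr X (cot'_cobj X n (csrc f) i) (cot'_cobj X n (ctgt f) i))\<rparr>)\<rparr>"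

end

theory Submission
  imports Defs
begin

text \<open>Kernels and cokernels of chain maps are computed degreewise as soon as they exist degreewise, and
  \<open>tr\<close> preserves limits because extension by zero is left adjoint to it.  The kernel of the unit
  \<open>A \<rightarrow> cosk (tr A)\<close> is \<open>cot' A\<close>, so the unit is monic iff \<open>\<delta>\<^sub>n\<close> is monic and \<open>A\<^sub>i = 0\<close> for \<open>i > n\<close>.
  The torsion-free quotient of \<open>A\<close> is \<open>0 \<rightarrow> Im \<delta>\<^sub>n \<rightarrow> A\<^sub>n\<^sub>-\<^sub>1 \<rightarrow> A\<^sub>n\<^sub>-\<^sub>2 \<rightarrow> \<dots>\<close>, where
  \<open>\<delta>\<^sub>n\<close> is factored as the cokernel of its kernel followed by a monomorphism.  If \<open>A\<close> is proper,
  that monomorphism is normal, which is why the quotient lies in \<open>MN\<close>.  Semi-abelianness enters only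
  through this factorization and the fact that a morphism with zero kernel is monic; both rest on
  the joint epicity of the section and the kernel of a point.\<close>

section \<open>Categories with a zero object\<close>

text \<open>Bourn's form of protomodularity speaks of isomorphisms between points, so it has to be
  turned into a statement about kernels. A projection of the kernel pair of a morphism, with the
  diagonal as section, is a point whose kernel is the kernel of that morphism in the second
  coordinate; this makes the coequalizer of the kernel pair, supplied by regularity, a cokernel of
  the kernel. Zero objects, kernels and lifts are chosen by descriptions, so the constructed
  complexes are controlled through universal properties: the monic \<open>ker X f\<close> plays the
  part of an inclusion, and identities are checked after composing with it. Exactness in
  \<open>ch X\<close> is verified degree by degree for the sequence that occurs, and heredity by
  testing against one morphism. A last obstacle is that the theorem allows every unit of the
  adjunction: the arguments use one explicit unit, and the torsion-free class is shown to be the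
  same for all units.\<close>

lemma full_subcat_simps:
  "Obj (full_subcat C S) = Obj C \<inter> S" "Arr (full_subcat C S) = {f \<in> Arr C. Dom C f \<in> S \<and> Cod C f \<in> S}"
  "Dom (full_subcat C S) = Dom C" "Cod (full_subcat C S) = Cod C" "Ident (full_subcat C S) = Ident C"
  "Comp (full_subcat C S) = Comp C"
  by (simp_all add: full_subcat_def)

lemma full_subcat_hom: "f \<in> hom (full_subcat C S) A B \<longleftrightarrow> f \<in> hom C A B \<and> A \<in> S \<and> B \<in> S"
  unfolding hom_def by (auto simp: full_subcat_simps)

lemma category_full_subcat:
  assumes "category C"
  shows "category (full_subcat C S)"
proof -
  interpret C: category C by fact
  show ?thesis
    by standard (auto simp: full_subcat_hom full_subcat_simps C.Dom_Obj C.Cod_Obj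
        C.Ident_hom C.Comp_Ident C.Ident_Comp intro: C.Comp_hom C.Comp_assoc)
qed

text \<open>The torsion class turns out to be literally \<open>ch_ge_obj X n\<close>, so the
  equivalence of item 2 compares a category with itself.\<close>

lemma equivalent_cats_refl:
  assumes "category C"
  shows "equivalent_cats C C"
proof -
  interpret category C by fact
  have I: "Ident C A \<in> hom C A A" "Ident C A \<cdot>\<^bsub>C\<^esub> Ident C A = Ident C A" if "A \<in> Obj C" for A
    using Ident_hom[OF that] Comp_Ident by blast+
  have f: "f \<in> hom C (Dom C f) (Cod C f)" if "f \<in> Arr C" for f using that by (simp add: hom_def)
  have F: "is_functor C C id_fctr"
    unfolding is_functor_def id_fctr_def using assms f by simp
  have N: "nat_trans C C id_fctr id_fctr (Ident C)"
    unfolding nat_trans_def id_fctr_def using I(1) Comp_Ident[OF f] Ident_Comp[OF f] by simp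
  have "iso C (Ident C A)" if "A \<in> Obj C" for A
    using I[OF that] unfolding iso_def hom_def by auto
  moreover have "comp_fctr id_fctr id_fctr = id_fctr" by (simp add: comp_fctr_def id_fctr_def)
  ultimately show ?thesis
    unfolding equivalent_cats_def using F N by metis
qed

text \<open>The formulas for a coskeleton change at \<open>m + 1\<close>, which carries the kernel.
  The same split serves the differentials of \<open>cot'_obj\<close>, whose lift sits one degree
  above the kernel.\<close>

lemma degree_cases: "(i \<le> m \<Longrightarrow> P) \<Longrightarrow> (i = m + 1 \<Longrightarrow> P) \<Longrightarrow> (i > m + 1 \<Longrightarrow> P) \<Longrightarrow> P" for i m :: int
  by force

lemma degree_trichotomy: "(i > n \<Longrightarrow> P) \<Longrightarrow> (i = n \<Longrightarrow> P) \<Longrightarrow> (i < n \<Longrightarrow> P) \<Longrightarrow> P" for i n :: int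
  by force

locale pointed_category = category X for X :: "('o, 'a) cat" (structure) +
  assumes pointed: "pointed X"
begin

lemma homD: "f \<in> hom X A B \<Longrightarrow> f \<in> Arr X \<and> Dom X f = A \<and> Cod X f = B \<and> A \<in> Obj X \<and> B \<in> Obj X"
  unfolding hom_def using Dom_Obj Cod_Obj by blast

lemma Arr_hom: "f \<in> Arr X \<Longrightarrow> f \<in> hom X (Dom X f) (Cod X f)"
  unfolding hom_def by simp

lemma is_zero_zero_of: "is_zero X (zero_of X)"
  using pointed unfolding pointed_def zero_of_def by (rule someI_ex)

lemma zero_of_Obj [simp]: "zero_of X \<in> Obj X"
  using is_zero_zero_of unfolding is_zero_def by blast

text \<open>The two morphisms may factor through different zero objects; the unique map
  \<open>i\<close> between these identifies the two factorizations.\<close>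

lemma zero_mor_unique:
  assumes f: "f \<in> hom X A B" "zero_mor X f" and g: "g \<in> hom X A B" "zero_mor X g"
  shows "f = g"
proof -
  obtain Z a b where Z: "is_zero X Z" "a \<in> hom X A Z" "b \<in> hom X Z B" "f = b \<cdot> a"
    using f unfolding zero_mor_def hom_def by auto
  obtain W c d where W: "is_zero X W" "c \<in> hom X A W" "d \<in> hom X W B" "g = d \<cdot> c"
    using g unfolding zero_mor_def hom_def by auto
  have obj: "Z \<in> Obj X" "W \<in> Obj X" "A \<in> Obj X" "B \<in> Obj X"
    using homD Z W by blast+
  obtain i where i: "i \<in> hom X Z W" using Z(1) obj unfolding is_zero_def by blast
  have "i \<cdot> a = c" using W(1,2) Comp_hom[OF Z(2) i] obj unfolding is_zero_def by blast
  moreover have "d \<cdot> i = b" using Z(1,3) Comp_hom[OF i W(3)] obj unfolding is_zero_def by blast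
  ultimately show ?thesis using Comp_assoc[OF Z(2) i W(3)] Z(4) W(4) by simp
qed

lemma zero_mor_ex:
  assumes "A \<in> Obj X" "B \<in> Obj X"
  shows "\<exists>f. f \<in> hom X A B \<and> zero_mor X f"
proof -
  have Z: "\<exists>a. a \<in> hom X A (zero_of X)" "\<exists>b. b \<in> hom X (zero_of X) B"
    using is_zero_zero_of assms unfolding is_zero_def by auto
  then obtain a b where ab: "a \<in> hom X A (zero_of X)" "b \<in> hom X (zero_of X) B"
    by blast
  have h: "b \<cdot> a \<in> hom X A B" using Comp_hom[OF ab] .
  then have "b \<cdot> a \<in> Arr X" "Dom X (b \<cdot> a) = A" "Cod X (b \<cdot> a) = B" using homD by blast+
  with ab is_zero_zero_of have "zero_mor X (b \<cdot> a)" unfolding zero_mor_def by blast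
  with h show ?thesis by blast
qed

text \<open>Justifies the definite description behind \<open>zero_arr\<close>; from here on zero
  morphisms can be handled as equations.\<close>

lemma zero_arr:
  assumes "A \<in> Obj X" "B \<in> Obj X"
  shows zero_arr_hom: "zero_arr X A B \<in> hom X A B" and zero_mor_zero_arr: "zero_mor X (zero_arr X A B)"
proof -
  have "\<exists>!f. f \<in> hom X A B \<and> zero_mor X f"
    using zero_mor_ex[OF assms] zero_mor_unique by blast
  from theI'[OF this] show "zero_arr X A B \<in> hom X A B" "zero_mor X (zero_arr X A B)"
    unfolding zero_arr_def by auto
qed

lemma zero_mor_iff: "f \<in> hom X A B \<Longrightarrow> zero_mor X f \<longleftrightarrow> f = zero_arr X A B"
  using zero_arr zero_mor_unique homD by metis

lemma zero_comp:
  assumes f: "f \<in> hom X A B" and D: "D \<in> Obj X"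
  shows "zero_arr X B D \<cdot> f = zero_arr X A D"
proof -
  have B: "B \<in> Obj X" and A: "A \<in> Obj X" using f homD by blast+
  obtain Z a b where Z: "is_zero X Z" "a \<in> hom X B Z" "b \<in> hom X Z D" "zero_arr X B D = b \<cdot> a"
    using zero_arr[OF B D] unfolding zero_mor_def hom_def by auto
  have "zero_arr X B D \<cdot> f = b \<cdot> (a \<cdot> f)" using Comp_assoc[OF f Z(2,3)] Z(4) by simp
  moreover have "a \<cdot> f \<in> hom X A Z" using Comp_hom f Z by blast
  ultimately have "zero_mor X (zero_arr X B D \<cdot> f)"
    using Z(1,3) Comp_hom[OF f zero_arr_hom[OF B D]] unfolding zero_mor_def hom_def by auto
  then show ?thesis using zero_mor_iff Comp_hom[OF f zero_arr_hom[OF B D]] by blast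
qed

lemma comp_zero:
  assumes f: "f \<in> hom X A B" and D: "D \<in> Obj X"
  shows "f \<cdot> zero_arr X D A = zero_arr X D B"
proof -
  have B: "B \<in> Obj X" and A: "A \<in> Obj X" using f homD by blast+
  obtain Z a b where Z: "is_zero X Z" "a \<in> hom X D Z" "b \<in> hom X Z A" "zero_arr X D A = b \<cdot> a"
    using zero_arr[OF D A] unfolding zero_mor_def hom_def by auto
  have "f \<cdot> zero_arr X D A = (f \<cdot> b) \<cdot> a" using Comp_assoc[OF Z(2,3) f] Z(4) by simp
  moreover have "f \<cdot> b \<in> hom X Z B" using Comp_hom f Z by blast
  ultimately have "zero_mor X (f \<cdot> zero_arr X D A)"
    using Z(1,2) Comp_hom[OF zero_arr_hom[OF D A] f] unfolding zero_mor_def hom_def by auto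
  then show ?thesis using zero_mor_iff Comp_hom[OF zero_arr_hom[OF D A] f] by blast
qed

lemma from_zero: "is_zero X A \<Longrightarrow> f \<in> hom X A B \<Longrightarrow> f = zero_arr X A B"
  using zero_arr_hom homD unfolding is_zero_def by metis

lemma to_zero: "is_zero X B \<Longrightarrow> f \<in> hom X A B \<Longrightarrow> f = zero_arr X A B"
  using zero_arr_hom homD unfolding is_zero_def by metis

text \<open>Being a zero object becomes one equation between endomorphisms, a form that passes to
  the components of a complex and can be obtained by cancellation.\<close>

lemma is_zero_iff:
  assumes "A \<in> Obj X"
  shows "is_zero X A \<longleftrightarrow> Ident X A = zero_arr X A A"
proof
  assume "is_zero X A" then show "Ident X A = zero_arr X A A"
    using from_zero Ident_hom assms by blast
next
  assume I: "Ident X A = zero_arr X A A"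
  show "is_zero X A" unfolding is_zero_def
  proof (intro conjI assms ballI)
    fix B assume B: "B \<in> Obj X"
    have "f = zero_arr X B A" if "f \<in> hom X B A" for f
      using Ident_Comp[OF that] zero_comp[OF that assms] I by simp
    then show "\<exists>!f. f \<in> hom X B A" using zero_arr_hom[OF B assms] by blast
    have "f = zero_arr X A B" if "f \<in> hom X A B" for f
      using Comp_Ident[OF that] comp_zero[OF that assms] I by simp
    then show "\<exists>!f. f \<in> hom X A B" using zero_arr_hom[OF assms B] by blast
  qed
qed

section \<open>Monomorphisms, kernels and cokernels in a pointed category\<close>

lemma monicD:
  "\<lbrakk>monic X m; m \<in> hom X A B; s \<in> hom X T A; t \<in> hom X T A; m \<cdot> s = m \<cdot> t\<rbrakk> \<Longrightarrow> s = t"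
  unfolding monic_def hom_def by auto

lemma monicI:
  "\<lbrakk>m \<in> hom X A B; \<And>T s t. \<lbrakk>s \<in> hom X T A; t \<in> hom X T A; m \<cdot> s = m \<cdot> t\<rbrakk> \<Longrightarrow> s = t\<rbrakk> \<Longrightarrow> monic X m"
  unfolding monic_def hom_def by auto

lemma monic_zeroD:
  assumes "monic X m" "m \<in> hom X A B" "s \<in> hom X T A" "m \<cdot> s = zero_arr X T B"
  shows "s = zero_arr X T A"
  using assms comp_zero[OF assms(2)] zero_arr_hom monicD homD by metis

lemma monic_comp:
  assumes f: "f \<in> hom X A B" "monic X f" and g: "g \<in> hom X B D" "monic X g"
  shows "monic X (g \<cdot> f)"
proof (rule monicI[OF Comp_hom[OF f(1) g(1)]])
  fix T s t assume s: "s \<in> hom X T A" and t: "t \<in> hom X T A" and e: "(g \<cdot> f) \<cdot> s = (g \<cdot> f) \<cdot> t"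
  have "g \<cdot> (f \<cdot> s) = g \<cdot> (f \<cdot> t)" using e Comp_assoc[OF s f(1) g(1)] Comp_assoc[OF t f(1) g(1)] by simp
  then have "f \<cdot> s = f \<cdot> t" using monicD[OF g(2,1) Comp_hom[OF s f(1)] Comp_hom[OF t f(1)]] by blast
  then show "s = t" using monicD[OF f(2,1) s t] by blast
qed

lemma monic_cancel:
  assumes f: "f \<in> hom X A B" and g: "g \<in> hom X B D" and m: "monic X (g \<cdot> f)"
  shows "monic X f"
proof (rule monicI[OF f])
  fix T s t assume s: "s \<in> hom X T A" and t: "t \<in> hom X T A" and e: "f \<cdot> s = f \<cdot> t"
  have "(g \<cdot> f) \<cdot> s = (g \<cdot> f) \<cdot> t" using e Comp_assoc[OF s f g] Comp_assoc[OF t f g] by simp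
  then show "s = t" using monicD[OF m Comp_hom[OF f g] s t] by blast
qed

text \<open>Monicity of \<open>k\<close> replaces the uniqueness clause, so each use only has to
  produce a factorization.\<close>

lemma is_kernelI:
  assumes f: "f \<in> hom X A B" and k: "k \<in> hom X K A" and z: "f \<cdot> k = zero_arr X K B"
    and m: "monic X k"
    and ex: "\<And>T t. \<lbrakk>t \<in> hom X T A; f \<cdot> t = zero_arr X T B\<rbrakk> \<Longrightarrow> \<exists>u. u \<in> hom X T K \<and> k \<cdot> u = t"
  shows "is_kernel X f k"
proof -
  have [simp]: "f \<in> Arr X" "Dom X f = A" "k \<in> Arr X" "Dom X k = K" "Cod X k = A" using f k homD by auto
  have "\<exists>!u. u \<in> hom X T K \<and> k \<cdot> u = t" if t: "t \<in> hom X T A" and "zero_mor X (f \<cdot> t)" for T t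
  proof -
    have "f \<cdot> t = zero_arr X T B" using that Comp_hom[OF t f] zero_mor_iff by blast
    from ex[OF t this] show ?thesis using monicD[OF m k] by blast
  qed
  moreover have "zero_mor X (f \<cdot> k)" using z zero_mor_zero_arr f k homD by metis
  ultimately show ?thesis unfolding is_kernel_def by auto
qed

lemma is_kernelD:
  assumes K: "is_kernel X f k" and f: "f \<in> hom X A B"
  shows "k \<in> hom X (Dom X k) A" "f \<cdot> k = zero_arr X (Dom X k) B" "monic X k"
    "\<And>T t. \<lbrakk>t \<in> hom X T A; f \<cdot> t = zero_arr X T B\<rbrakk> \<Longrightarrow> \<exists>u. u \<in> hom X T (Dom X k) \<and> k \<cdot> u = t"
proof -
  show k: "k \<in> hom X (Dom X k) A" using K f unfolding is_kernel_def hom_def by auto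
  show z: "f \<cdot> k = zero_arr X (Dom X k) B"
    using K zero_mor_iff[OF Comp_hom[OF k f]] unfolding is_kernel_def by auto
  have fD: "Dom X f = A" using f homD by blast
  have U: "\<exists>!u. u \<in> hom X T (Dom X k) \<and> k \<cdot> u = t"
    if t: "t \<in> hom X T A" and "f \<cdot> t = zero_arr X T B" for T t
    using K that zero_mor_iff[OF Comp_hom[OF t f]] fD unfolding is_kernel_def by blast
  show "\<exists>u. u \<in> hom X T (Dom X k) \<and> k \<cdot> u = t"
    if t: "t \<in> hom X T A" and "f \<cdot> t = zero_arr X T B" for T t using U[OF that] by blast
  show "monic X k"
  proof (rule monicI[OF k])
    fix T s t assume s: "s \<in> hom X T (Dom X k)" and t: "t \<in> hom X T (Dom X k)" and e: "k \<cdot> s = k \<cdot> t"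
    have T: "k \<cdot> t \<in> hom X T A" using Comp_hom[OF t k] .
    have "f \<cdot> (k \<cdot> t) = zero_arr X T B"
      using Comp_assoc[OF t k f] z zero_comp[OF t] f homD by metis
    from U[OF T this] s t e show "s = t" by blast
  qed
qed

lemma is_cokernelI:
  assumes f: "f \<in> hom X A B" and q: "q \<in> hom X B Q" and z: "q \<cdot> f = zero_arr X A Q"
    and ex: "\<And>T t. \<lbrakk>t \<in> hom X B T; t \<cdot> f = zero_arr X A T\<rbrakk> \<Longrightarrow> \<exists>!u. u \<in> hom X Q T \<and> u \<cdot> q = t"
  shows "is_cokernel X f q"
proof -
  have [simp]: "f \<in> Arr X" "Cod X f = B" "q \<in> Arr X" "Dom X q = B" "Cod X q = Q" using f q homD by auto
  have "\<exists>!u. u \<in> hom X Q T \<and> u \<cdot> q = t" if t: "t \<in> hom X B T" and "zero_mor X (t \<cdot> f)" for T t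
  proof -
    have "t \<cdot> f = zero_arr X A T" using that Comp_hom[OF f t] zero_mor_iff by blast
    from ex[OF t this] show ?thesis .
  qed
  moreover have "zero_mor X (q \<cdot> f)" using z zero_mor_zero_arr f q homD by metis
  ultimately show ?thesis unfolding is_cokernel_def by auto
qed

lemma is_cokernelD:
  assumes Q: "is_cokernel X f q" and f: "f \<in> hom X A B"
  shows "q \<in> hom X B (Cod X q)" "q \<cdot> f = zero_arr X A (Cod X q)"
    "\<And>T t. \<lbrakk>t \<in> hom X B T; t \<cdot> f = zero_arr X A T\<rbrakk> \<Longrightarrow> \<exists>!u. u \<in> hom X (Cod X q) T \<and> u \<cdot> q = t"
    "\<And>T s t. \<lbrakk>s \<in> hom X (Cod X q) T; t \<in> hom X (Cod X q) T; s \<cdot> q = t \<cdot> q\<rbrakk> \<Longrightarrow> s = t"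
proof -
  show q: "q \<in> hom X B (Cod X q)" using Q f unfolding is_cokernel_def hom_def by auto
  show z: "q \<cdot> f = zero_arr X A (Cod X q)"
    using Q zero_mor_iff[OF Comp_hom[OF f q]] unfolding is_cokernel_def by auto
  have fD: "Cod X f = B" using f homD by blast
  show U: "\<exists>!u. u \<in> hom X (Cod X q) T \<and> u \<cdot> q = t"
    if t: "t \<in> hom X B T" and "t \<cdot> f = zero_arr X A T" for T t
    using Q that zero_mor_iff[OF Comp_hom[OF f t]] fD unfolding is_cokernel_def by blast
  fix T s t assume s: "s \<in> hom X (Cod X q) T" and t: "t \<in> hom X (Cod X q) T" and e: "s \<cdot> q = t \<cdot> q"
  have T: "t \<cdot> q \<in> hom X B T" using Comp_hom[OF q t] .
  have "(t \<cdot> q) \<cdot> f = zero_arr X A T"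
    using Comp_assoc[OF f q t] z comp_zero[OF t] f homD by metis
  from U[OF T this] s t e show "s = t" by blast
qed

lemma normal_epiD:
  assumes "normal_epi X e" "e \<in> hom X A B" "s \<in> hom X B T" "t \<in> hom X B T" "s \<cdot> e = t \<cdot> e"
  shows "s = t"
proof -
  obtain f where c: "is_cokernel X f e" using assms unfolding normal_epi_def by blast
  then have "f \<in> hom X (Dom X f) (Cod X f)" unfolding is_cokernel_def using Arr_hom by blast
  from is_cokernelD(4)[OF c this] assms homD show ?thesis by blast
qed

lemma normal_monoD:
  assumes "normal_mono X m"
  obtains f where "f \<in> hom X (Cod X m) (Cod X f)" "is_kernel X f m"
  using assms unfolding normal_mono_def is_kernel_def using Arr_hom by metis

lemma normal_mono_monic: "normal_mono X m \<Longrightarrow> monic X m"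
  using normal_monoD is_kernelD(3) by metis

text \<open>This and the next three lemmas cover the degenerate exact sequences with an identity on
  one side and a zero object on the other. The torsion sequence has this shape in every degree other
  than \<open>n\<close>.\<close>

lemma Ident_cokernel_zero:
  assumes "is_zero X Z" "f \<in> hom X Z A"
  shows "is_cokernel X f (Ident X A)"
proof (rule is_cokernelI[OF assms(2)])
  have A: "A \<in> Obj X" using assms homD by blast
  show I: "Ident X A \<in> hom X A A" using Ident_hom A .
  show "Ident X A \<cdot> f = zero_arr X Z A" using Ident_Comp assms from_zero by metis
  fix T t assume t: "t \<in> hom X A T"
  show "\<exists>!u. u \<in> hom X A T \<and> u \<cdot> Ident X A = t" using Comp_Ident t by metis
qed

lemma zero_kernel_Ident:
  assumes "is_zero X Z" "f \<in> hom X Z A"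
  shows "is_kernel X (Ident X A) f"
proof (rule is_kernelI)
  have A: "A \<in> Obj X" and Z: "Z \<in> Obj X" using assms homD by blast+
  show I: "Ident X A \<in> hom X A A" using Ident_hom A .
  show "f \<in> hom X Z A" by fact
  show "Ident X A \<cdot> f = zero_arr X Z A" using Ident_Comp assms from_zero by metis
  show "monic X f" by (rule monicI[OF assms(2)]) (metis to_zero assms(1))
  fix T t assume t: "t \<in> hom X T A" and "Ident X A \<cdot> t = zero_arr X T A"
  then have "t = zero_arr X T A" using Ident_Comp by metis
  moreover have "zero_arr X T A = f \<cdot> zero_arr X T Z" using comp_zero assms t homD by metis
  ultimately show "\<exists>u. u \<in> hom X T Z \<and> f \<cdot> u = t" using zero_arr_hom Z t homD by metis
qed

lemma Ident_kernel_zero: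
  assumes "is_zero X Z" "f \<in> hom X A Z"
  shows "is_kernel X f (Ident X A)"
proof (rule is_kernelI)
  have A: "A \<in> Obj X" using assms homD by blast
  show "f \<in> hom X A Z" by fact
  show I: "Ident X A \<in> hom X A A" using Ident_hom A .
  show "f \<cdot> Ident X A = zero_arr X A Z" using Comp_Ident assms to_zero by metis
  show "monic X (Ident X A)" by (rule monicI[OF I]) (metis Ident_Comp)
  fix T t assume "t \<in> hom X T A"
  then show "\<exists>u. u \<in> hom X T A \<and> Ident X A \<cdot> u = t" using Ident_Comp by blast
qed

lemma zero_cokernel_Ident:
  assumes "is_zero X Z" "f \<in> hom X A Z"
  shows "is_cokernel X (Ident X A) f"
proof (rule is_cokernelI)
  have A: "A \<in> Obj X" and Z: "Z \<in> Obj X" using assms homD by blast+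
  show I: "Ident X A \<in> hom X A A" using Ident_hom A .
  show "f \<in> hom X A Z" by fact
  show "f \<cdot> Ident X A = zero_arr X A Z" using Comp_Ident assms to_zero by metis
  fix T t assume t: "t \<in> hom X A T" and "t \<cdot> Ident X A = zero_arr X A T"
  then have t0: "t = zero_arr X A T" using Comp_Ident by metis
  have T: "T \<in> Obj X" using t homD by blast
  show "\<exists>!u. u \<in> hom X Z T \<and> u \<cdot> f = t"
  proof (rule ex1I[of _ "zero_arr X Z T"])
    show "zero_arr X Z T \<in> hom X Z T \<and> zero_arr X Z T \<cdot> f = t"
      using zero_comp assms t0 T zero_arr_hom Z by metis
  qed (use from_zero assms in blast)
qed

lemma normal_mono_from_zero: "is_zero X (Dom X m) \<Longrightarrow> m \<in> Arr X \<Longrightarrow> normal_mono X m"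
  unfolding normal_mono_def using zero_kernel_Ident Arr_hom by blast

text \<open>The identity and the zero endomorphism of \<open>A\<close> agree after composing with
  \<open>m\<close>, so cancelling \<open>m\<close> makes the identity zero.\<close>

lemma monic_to_zero:
  assumes "monic X m" "m \<in> hom X A Z" "is_zero X Z"
  shows "is_zero X A"
proof -
  have A: "A \<in> Obj X" using assms homD by blast
  have "Ident X A = zero_arr X A A"
    using monic_zeroD[OF assms(1,2) Ident_hom[OF A]] to_zero[OF assms(3)] Comp_Ident assms(2) by metis
  then show ?thesis using is_zero_iff A by blast
qed

lemma normal_epi_from_zero:
  assumes "normal_epi X e" "e \<in> hom X Z B" "is_zero X Z"
  shows "is_zero X B"
proof -
  have B: "B \<in> Obj X" using assms homD by blast
  have Z: "zero_arr X B B \<in> hom X B B" using zero_arr_hom B by blast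
  have "Ident X B \<cdot> e = zero_arr X B B \<cdot> e"
    using from_zero[OF assms(3)] Comp_hom[OF assms(2)] Ident_hom[OF B] Z by metis
  then have "Ident X B = zero_arr X B B"
    using normal_epiD[OF assms(1,2) Ident_hom[OF B] Z] by blast
  then show ?thesis using is_zero_iff B by blast
qed

text \<open>If \<open>h \<cdot> g\<close> is a kernel of \<open>f\<close>, then \<open>g\<close> is
  a kernel of \<open>f \<cdot> h\<close>: a map killed by \<open>f \<cdot> h\<close> factors through
  \<open>h \<cdot> g\<close> after composing with \<open>h\<close>, and \<open>h\<close>
  cancels.\<close>

lemma normal_mono_cancel:
  assumes g: "g \<in> hom X A B" and h: "h \<in> hom X B D" and hm: "monic X h"
    and n: "normal_mono X (h \<cdot> g)"
  shows "normal_mono X g"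
proof -
  have hg: "h \<cdot> g \<in> hom X A D" using Comp_hom g h .
  obtain f where f: "f \<in> hom X D (Cod X f)" and k: "is_kernel X f (h \<cdot> g)"
    using normal_monoD[OF n] hg homD by metis
  note K = is_kernelD[OF k f]
  have D: "Dom X (h \<cdot> g) = A" using hg homD by blast
  have "is_kernel X (f \<cdot> h) g"
  proof (rule is_kernelI[OF Comp_hom[OF h f] g])
    show "(f \<cdot> h) \<cdot> g = zero_arr X A (Cod X f)" using Comp_assoc[OF g h f] K(2) D by simp
    show "monic X g" using monic_cancel[OF g h K(3)] .
    fix T t assume t: "t \<in> hom X T B" and z: "(f \<cdot> h) \<cdot> t = zero_arr X T (Cod X f)"
    have "f \<cdot> (h \<cdot> t) = zero_arr X T (Cod X f)" using Comp_assoc[OF t h f] z by simp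
    from K(4)[OF Comp_hom[OF t h] this] obtain u where u: "u \<in> hom X T A" "(h \<cdot> g) \<cdot> u = h \<cdot> t"
      using D by auto
    have "h \<cdot> (g \<cdot> u) = h \<cdot> t" using u Comp_assoc[OF u(1) g h] by simp
    then have "g \<cdot> u = t" using monicD[OF hm h Comp_hom[OF u(1) g] t] by blast
    then show "\<exists>u. u \<in> hom X T A \<and> g \<cdot> u = t" using u by blast
  qed
  then show ?thesis unfolding normal_mono_def by blast
qed

section \<open>Isomorphisms, and factorizations through monomorphisms\<close>

lemma isoE:
  assumes "iso X f" "f \<in> hom X A B"
  obtains g where "g \<in> hom X B A" "g \<cdot> f = Ident X A" "f \<cdot> g = Ident X B"
  using assms unfolding iso_def hom_def by auto

lemma isoI:
  "\<lbrakk>f \<in> hom X A B; g \<in> hom X B A; g \<cdot> f = Ident X A; f \<cdot> g = Ident X B\<rbrakk> \<Longrightarrow> iso X f"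
  unfolding iso_def hom_def by auto

lemma iso_Ident: "A \<in> Obj X \<Longrightarrow> iso X (Ident X A)"
  using isoI Ident_hom Ident_Comp by metis

lemma isomorphic_sym: "isomorphic X A B \<Longrightarrow> isomorphic X B A"
  unfolding isomorphic_def using isoE isoI by metis

lemma is_zero_iso:
  assumes "is_zero X A" "isomorphic X A B"
  shows "is_zero X B"
proof -
  obtain f where f: "f \<in> hom X A B" "iso X f" using assms unfolding isomorphic_def by blast
  then obtain g where g: "g \<in> hom X B A" "f \<cdot> g = Ident X B" using isoE by metis
  have B: "B \<in> Obj X" using f homD by blast
  have "Ident X B = zero_arr X B B"
    using zero_comp[OF g(1) B] from_zero[OF assms(1) f(1)] g(2) by simp
  then show ?thesis using is_zero_iff B by blast
qed

lemma zero_isomorphic: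
  assumes "is_zero X A" "is_zero X B"
  shows "isomorphic X A B"
proof -
  have o: "A \<in> Obj X" "B \<in> Obj X" using assms unfolding is_zero_def by auto
  have h: "zero_arr X A B \<in> hom X A B" "zero_arr X B A \<in> hom X B A" using zero_arr_hom o by auto
  have "zero_arr X B A \<cdot> zero_arr X A B = Ident X A" "zero_arr X A B \<cdot> zero_arr X B A = Ident X B"
    using zero_comp h o is_zero_iff assms by simp_all
  then have "iso X (zero_arr X A B)" using isoI[OF h] by blast
  then show ?thesis unfolding isomorphic_def using h by blast
qed

text \<open>A monic \<open>m \<cdot> i\<close> makes the split epimorphism \<open>i\<close>
  invertible, so \<open>m\<close> and \<open>m \<cdot> i\<close> are the same subobject. Accordingly
  \<open>m = (m \<cdot> i) \<cdot> j\<close> is a kernel of the same \<open>f\<close>.\<close>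

lemma normal_mono_precomp_split_epi:
  assumes i: "i \<in> hom X A' A" "j \<in> hom X A A'" "i \<cdot> j = Ident X A"
    and m: "m \<in> hom X A B" and n: "normal_mono X (m \<cdot> i)"
  shows "normal_mono X m"
proof -
  have mi: "m \<cdot> i \<in> hom X A' B" using Comp_hom i m by blast
  then have D: "Dom X (m \<cdot> i) = A'" using homD by blast
  obtain f where f: "f \<in> hom X B (Cod X f)" and k: "is_kernel X f (m \<cdot> i)"
    using normal_monoD[OF n] mi homD by metis
  note K = is_kernelD[OF k f]
  have mij: "m = (m \<cdot> i) \<cdot> j" using Comp_assoc[OF i(2,1) m] i(3) Comp_Ident m by metis
  have jm: "monic X j"
    by (rule monic_cancel[OF i(2,1)]) (use i(3) Ident_Comp monicI Ident_hom homD m in metis)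
  have "is_kernel X f m"
  proof (rule is_kernelI[OF f m])
    have B: "Cod X f \<in> Obj X" using f homD by blast
    show "f \<cdot> m = zero_arr X A (Cod X f)"
      using Comp_assoc[OF i(2) mi f] mij K(2) D zero_comp[OF i(2) B] by metis
    show "monic X m" using monic_comp[OF i(2) jm mi K(3)] mij by simp
    fix T t assume "t \<in> hom X T B" "f \<cdot> t = zero_arr X T (Cod X f)"
    then obtain u where u: "u \<in> hom X T A'" "(m \<cdot> i) \<cdot> u = t" using K(4) D by metis
    then show "\<exists>u. u \<in> hom X T A \<and> m \<cdot> u = t"
      using Comp_assoc[OF u(1) i(1) m] Comp_hom[OF u(1) i(1)] by metis
  qed
  then show ?thesis unfolding normal_mono_def by blast
qed

text \<open>A cokernel of \<open>f\<close> that is monic forces \<open>f\<close> to be zero. Then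
  the identity of \<open>A\<close> factors through \<open>e\<close>, and the factor is the
  inverse.\<close>

lemma normal_epi_monic_split:
  assumes e: "e \<in> hom X A B" "normal_epi X e" "monic X e"
  obtains g where "g \<in> hom X B A" "g \<cdot> e = Ident X A" "e \<cdot> g = Ident X B"
proof -
  obtain f where c: "is_cokernel X f e" using e unfolding normal_epi_def by blast
  obtain D where f: "f \<in> hom X D A"
    using c e(1) Arr_hom homD unfolding is_cokernel_def by metis
  have B: "Cod X e = B" using e homD by blast
  note Q = is_cokernelD[OF c f, unfolded B]
  have A: "A \<in> Obj X" using f homD by blast
  have "f = zero_arr X D A" using monic_zeroD[OF e(3,1) f Q(2)] .
  then have "Ident X A \<cdot> f = zero_arr X D A" using Ident_Comp f by metis
  then obtain g where g: "g \<in> hom X B A" "g \<cdot> e = Ident X A" using Q(3)[OF Ident_hom[OF A]] by blast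
  have "(e \<cdot> g) \<cdot> e = Ident X B \<cdot> e"
    using Comp_assoc[OF e(1) g(1) e(1)] g(2) Comp_Ident Ident_Comp e(1) by metis
  then have "e \<cdot> g = Ident X B"
    using normal_epiD[OF e(2,1) Comp_hom[OF g(1) e(1)]] Ident_hom homD e(1) by metis
  with g that show ?thesis by blast
qed

text \<open>Evaluates the definite description in \<open>lift\<close>, which is well defined because
  \<open>k\<close> is monic.\<close>

lemma lift:
  assumes k: "monic X k" "k \<in> hom X K A" and t: "t \<in> hom X T A" and u: "u \<in> hom X T K" "k \<cdot> u = t"
  shows "lift X k t = u"
proof -
  have [simp]: "Dom X t = T" "Dom X k = K" using homD k t by auto
  show ?thesis unfolding lift_def using monicD[OF k] u by (auto intro!: the_equality)
qed

lemma lift_kernel: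
  assumes K: "is_kernel X f k" and f: "f \<in> hom X A B" and t: "t \<in> hom X T A"
    and z: "f \<cdot> t = zero_arr X T B"
  shows "lift X k t \<in> hom X T (Dom X k)" "k \<cdot> lift X k t = t"
proof -
  note D = is_kernelD[OF K f]
  obtain u where u: "u \<in> hom X T (Dom X k)" "k \<cdot> u = t" using D(4)[OF t z] by blast
  from lift[OF D(3,1) t u] u show "lift X k t \<in> hom X T (Dom X k)" "k \<cdot> lift X k t = t" by auto
qed

lemma monic_Ident: "A \<in> Obj X \<Longrightarrow> monic X (Ident X A)"
  by (rule monicI[OF Ident_hom]) (auto simp: Ident_Comp)

lemma monic_from_zero:
  assumes "is_zero X Z" "f \<in> hom X Z A"
  shows "monic X f"
  by (rule monicI[OF assms(2)]) (use to_zero[OF assms(1)] in metis)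

text \<open>By the universal property of \<eta>', the unit \<eta> at \<open>A\<close> is \<eta>' at
  \<open>A\<close> followed by a morphism in the image of \<open>G\<close>; so if \<eta> is monic
  there, \<eta>' is too. With the roles exchanged this makes the torsion-free class independent of
  the unit.\<close>

lemma loc_free_unit_cong:
  assumes adj: "adjunction X D L G \<eta>" "adjunction X D L G \<eta>'"
  shows "loc_free X \<eta> \<subseteq> loc_free X \<eta>'"
proof
  fix A assume "A \<in> loc_free X \<eta>"
  then have A: "A \<in> Obj X" and m: "monic X (\<eta> A)" unfolding loc_free_def by auto
  have L: "Fobj L A \<in> Obj D" using adj(1) A unfolding adjunction_def is_functor_def by blast
  have h: "\<eta> A \<in> hom X A (Fobj G (Fobj L A))" "\<eta>' A \<in> hom X A (Fobj G (Fobj L A))"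
    using adj A unfolding adjunction_def nat_trans_def by (auto simp: id_fctr_def comp_fctr_def)
  obtain g where g: "g \<in> hom D (Fobj L A) (Fobj L A)" "Farr G g \<cdot> \<eta>' A = \<eta> A"
    using adj(2) A L h(1) unfolding adjunction_def by blast
  have "Farr G g \<in> hom X (Fobj G (Fobj L A)) (Fobj G (Fobj L A))"
    using adj(1) g(1) unfolding adjunction_def is_functor_def hom_def by auto
  then have "monic X (\<eta>' A)" using monic_cancel h(2) g(2) m by metis
  then show "A \<in> loc_free X \<eta>'" using A unfolding loc_free_def by simp
qed

end

section \<open>Image factorization in semi-abelian categories\<close>

text \<open>The cospan 0 -> 2 <- 1, with arrows 3 and 4 and each identity numbered like its object;
  \<open>has_finite_limits\<close> speaks only of shapes on natural numbers. In a composite, a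
  \<open>u\<close> above 2 leaves only the identity of 2 for \<open>v\<close>.\<close>

definition cospan_shape :: "(nat, nat) cat" where
  "cospan_shape = \<lparr>Obj = {0, 1, 2}, Arr = {0, 1, 2, 3, 4},
    Dom = (\<lambda>u. if u = 3 then 0 else if u = 4 then 1 else u),
    Cod = (\<lambda>u. if u \<ge> 3 then 2 else u), Ident = (\<lambda>j. j), Comp = (\<lambda>v u. if u \<le> 2 then v else u)\<rparr>"

lemma finite_cat_cospan_shape: "finite_cat cospan_shape"
  unfolding finite_cat_def cospan_shape_def by (auto simp: category_def hom_def)

definition cospan_diagram :: "('o, 'a) cat \<Rightarrow> 'a \<Rightarrow> 'a \<Rightarrow> (nat, nat, 'o, 'a) fctr" where
  "cospan_diagram C f g = \<lparr>Fobj = (\<lambda>j. if j = 0 then Dom C f else if j = 1 then Dom C g else Cod C f),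
    Farr = (\<lambda>u. if u = 3 then f else if u = 4 then g else if u = 0 then Ident C (Dom C f)
      else if u = 1 then Ident C (Dom C g) else Ident C (Cod C f))\<rparr>"

lemma cospan_diagram_functor:
  assumes "category C" "f \<in> hom C A B" "g \<in> hom C D B"
  shows "is_functor cospan_shape C (cospan_diagram C f g)"
proof -
  interpret category C by fact
  have [simp]: "f \<in> Arr C" "g \<in> Arr C" "Dom C f = A" "Dom C g = D" "Cod C f = B" "Cod C g = B"
    using assms by (auto simp: hom_def)
  have [simp]: "A \<in> Obj C" "B \<in> Obj C" "D \<in> Obj C"
    using Dom_Obj[of f] Cod_Obj[of f] Dom_Obj[of g] by auto
  note [simp] = Ident_hom[of A] Ident_hom[of B] Ident_hom[of D] Ident_Comp[OF assms(2)] Comp_Ident[OF assms(2)]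
    Ident_Comp[OF assms(3)] Comp_Ident[OF assms(3)] assms(2,3)
    Ident_Comp[of "Ident C A" A A] Ident_Comp[of "Ident C B" B B] Ident_Comp[of "Ident C D" D D]
  show ?thesis
    unfolding is_functor_def using finite_cat_cospan_shape assms(1)
    by (simp add: finite_cat_def) (simp add: cospan_shape_def cospan_diagram_def)
qed

section \<open>Pullbacks, kernels and equalizers from finite limits\<close>

locale semi_abelian_category = pointed_category X for X :: "('o, 'a) cat" (structure) +
  assumes semi_abelian: "semi_abelian X"
begin

lemma pullback_ex:
  assumes f: "f \<in> hom X A B" and g: "g \<in> hom X D B"
  obtains P p q where "p \<in> hom X P A" "q \<in> hom X P D" "is_pullback X f g p q"
proof -
  let ?F = "cospan_diagram X f g"
  have "has_finite_limits X"
    using semi_abelian unfolding semi_abelian_def barr_exact_def regular_cat_def by blast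
  then obtain P l where L: "limit_cone cospan_shape X ?F P l"
    unfolding has_finite_limits_def
    using finite_cat_cospan_shape cospan_diagram_functor[OF category_axioms f g] by blast
  have [simp]: "Dom X f = A" "Dom X g = D" "Cod X f = B" "Cod X g = B" "f \<in> Arr X" "g \<in> Arr X"
    using f g homD by blast+
  have C: "cone cospan_shape X ?F P l" using L unfolding limit_cone_def by blast
  have l: "l 0 \<in> hom X P A" "l 1 \<in> hom X P D" "l 2 \<in> hom X P B"
    and e: "f \<cdot> l 0 = l 2" "g \<cdot> l 1 = l 2"
    using C unfolding cone_def cospan_shape_def cospan_diagram_def by auto
  have "\<exists>!u. u \<in> hom X T P \<and> l 0 \<cdot> u = s \<and> l 1 \<cdot> u = t"
    if s: "s \<in> hom X T A" and t: "t \<in> hom X T D" and st: "f \<cdot> s = g \<cdot> t" for T s t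
  proof -
    \<comment> \<open>A cone over the cospan has a third leg, forced to be the common
      composite.\<close>
    define m where "m = (\<lambda>j::nat. if j = 0 then s else if j = 1 then t else f \<cdot> s)"
    have "cone cospan_shape X ?F T m"
      unfolding cone_def cospan_shape_def cospan_diagram_def m_def
      using s t st Comp_hom[OF s f] homD[OF s] Ident_Comp[OF s] Ident_Comp[OF t] Ident_Comp[OF Comp_hom[OF s f]]
      by auto
    then have U: "\<exists>!h. h \<in> hom X T P \<and> (\<forall>j \<in> Obj cospan_shape. l j \<cdot> h = m j)"
      using L unfolding limit_cone_def by blast
    have "(\<forall>j \<in> Obj cospan_shape. l j \<cdot> h = m j) \<longleftrightarrow> l 0 \<cdot> h = s \<and> l 1 \<cdot> h = t"
      if h: "h \<in> hom X T P" for h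
      using Comp_assoc[OF h l(1) f] e(1) by (auto simp: cospan_shape_def m_def)
    with U show ?thesis by metis
  qed
  then have "is_pullback X f g (l 0) (l 1)"
    unfolding is_pullback_def using l e homD[OF l(1)] homD[OF l(2)] by auto
  with l that show thesis by blast
qed

lemma pullbackD:
  assumes P: "is_pullback X f g p q" and f: "f \<in> hom X A B" and g: "g \<in> hom X D B" and p: "p \<in> hom X P A"
  shows "q \<in> hom X P D" "f \<cdot> p = g \<cdot> q"
    "\<And>T s t. \<lbrakk>s \<in> hom X T A; t \<in> hom X T D; f \<cdot> s = g \<cdot> t\<rbrakk>
      \<Longrightarrow> \<exists>u. u \<in> hom X T P \<and> p \<cdot> u = s \<and> q \<cdot> u = t"
    "\<And>T u v. \<lbrakk>u \<in> hom X T P; v \<in> hom X T P; p \<cdot> u = p \<cdot> v; q \<cdot> u = q \<cdot> v\<rbrakk> \<Longrightarrow> u = v"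
proof -
  have d: "Dom X f = A" "Dom X g = D" "Dom X p = P" using f g p homD by blast+
  have "q \<in> Arr X" "Dom X p = Dom X q" "Cod X q = Dom X g" and e': "f \<cdot> p = g \<cdot> q"
    using P unfolding is_pullback_def by blast+
  then show q: "q \<in> hom X P D" and e: "f \<cdot> p = g \<cdot> q"
    unfolding hom_def by (simp_all add: d)
  have U: "\<exists>!u. u \<in> hom X T P \<and> p \<cdot> u = s \<and> q \<cdot> u = t"
    if "s \<in> hom X T A" "t \<in> hom X T D" "f \<cdot> s = g \<cdot> t" for T s t
    using P[unfolded is_pullback_def d] that by blast
  show "\<exists>u. u \<in> hom X T P \<and> p \<cdot> u = s \<and> q \<cdot> u = t"
    if "s \<in> hom X T A" "t \<in> hom X T D" "f \<cdot> s = g \<cdot> t" for T s t using U[OF that] by blast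
  fix T u v assume u: "u \<in> hom X T P" and v: "v \<in> hom X T P" and "p \<cdot> u = p \<cdot> v" "q \<cdot> u = q \<cdot> v"
  moreover have "f \<cdot> (p \<cdot> v) = g \<cdot> (q \<cdot> v)" using Comp_assoc[OF v p f] Comp_assoc[OF v q g] e by simp
  ultimately show "u = v" using U[OF Comp_hom[OF v p] Comp_hom[OF v q]] by blast
qed

text \<open>The kernel is the pullback of \<open>f\<close> along the map out of the zero object; the
  other projection carries no information because it lands in a zero object.\<close>

lemma kernel_ex:
  assumes f: "f \<in> hom X A B"
  shows "\<exists>k. is_kernel X f k"
proof -
  let ?Z = "zero_of X"
  have B: "B \<in> Obj X" using f homD by blast
  note z = zero_arr_hom[OF zero_of_Obj B]
  obtain K k q where k: "k \<in> hom X K A" and q: "q \<in> hom X K ?Z"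
    and P: "is_pullback X f (zero_arr X ?Z B) k q"
    using pullback_ex[OF f z] .
  note D = pullbackD[OF P f z k]
  have "is_kernel X f k"
  proof (rule is_kernelI[OF f k])
    show "f \<cdot> k = zero_arr X K B" using D(2) zero_comp[OF q B] by simp
    show "monic X k"
    proof (rule monicI[OF k])
      fix T s t assume s: "s \<in> hom X T K" and t: "t \<in> hom X T K" and e: "k \<cdot> s = k \<cdot> t"
      have "q \<cdot> s = q \<cdot> t" using to_zero[OF is_zero_zero_of Comp_hom[OF s q]] to_zero[OF is_zero_zero_of Comp_hom[OF t q]] by simp
      from D(4)[OF s t e this] show "s = t" .
    qed
    fix T t assume t: "t \<in> hom X T A" and "f \<cdot> t = zero_arr X T B"
    then have "f \<cdot> t = zero_arr X ?Z B \<cdot> zero_arr X T ?Z"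
      using zero_comp[OF zero_arr_hom[of T ?Z] B] homD[OF t] by simp
    from D(3)[OF t zero_arr_hom this] homD[OF t] show "\<exists>u. u \<in> hom X T K \<and> k \<cdot> u = t" by auto
  qed
  then show ?thesis by blast
qed

lemma ker_is_kernel: "f \<in> hom X A B \<Longrightarrow> is_kernel X f (ker X f)"
  unfolding ker_def using kernel_ex by (rule someI_ex)

lemma kerD:
  assumes f: "f \<in> hom X A B"
  shows "ker X f \<in> hom X (Ker X f) A" "f \<cdot> ker X f = zero_arr X (Ker X f) B" "monic X (ker X f)"
    "\<And>T t. \<lbrakk>t \<in> hom X T A; f \<cdot> t = zero_arr X T B\<rbrakk> \<Longrightarrow> \<exists>u. u \<in> hom X T (Ker X f) \<and> ker X f \<cdot> u = t"
  using is_kernelD[OF ker_is_kernel[OF f] f] unfolding Ker_def by blast+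

lemma lift_ker:
  assumes f: "f \<in> hom X A B" and "t \<in> hom X T A" "f \<cdot> t = zero_arr X T B"
  shows "lift X (ker X f) t \<in> hom X T (Ker X f)" "ker X f \<cdot> lift X (ker X f) t = t"
  using lift_kernel[OF ker_is_kernel[OF f] assms] unfolding Ker_def by blast+

lemma Ker_Obj: "f \<in> hom X A B \<Longrightarrow> Ker X f \<in> Obj X"
  using kerD(1) homD by metis

text \<open>The equalizer is the pullback of the pairing \<open>c\<close> of \<open>a\<close> and
  \<open>b\<close> along the diagonal \<open>d\<close> of the product of \<open>T\<close> with
  itself, a product that is in turn a pullback over the zero object.\<close>

lemma equalizer_ex:
  assumes a: "a \<in> hom X R T" and b: "b \<in> hom X R T"
  obtains W w where "w \<in> hom X W R" "monic X w" "a \<cdot> w = b \<cdot> w"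
    "\<And>S t. \<lbrakk>t \<in> hom X S R; a \<cdot> t = b \<cdot> t\<rbrakk> \<Longrightarrow> \<exists>u. u \<in> hom X S W \<and> w \<cdot> u = t"
proof -
  let ?Z = "zero_of X"
  have T: "T \<in> Obj X" and R: "R \<in> Obj X" using a homD by blast+
  have z: "zero_arr X T ?Z \<in> hom X T ?Z" using zero_arr_hom T by simp
  obtain P p q where p: "p \<in> hom X P T" and q: "q \<in> hom X P T"
    and PB: "is_pullback X (zero_arr X T ?Z) (zero_arr X T ?Z) p q"
    using pullback_ex[OF z z] .
  note D = pullbackD[OF PB z z p]
  \<comment> \<open>Over the zero object the compatibility condition of the pullback is automatic,
    so \<open>P\<close> is a product.\<close>
  have zz: "zero_arr X T ?Z \<cdot> s = zero_arr X T ?Z \<cdot> t" if "s \<in> hom X S T" "t \<in> hom X S T" for S s t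
    using zero_comp that zero_of_Obj by metis
  obtain c where c: "c \<in> hom X R P" "p \<cdot> c = a" "q \<cdot> c = b" using D(3)[OF a b zz[OF a b]] by blast
  note I = Ident_hom[OF T]
  obtain d where d: "d \<in> hom X T P" "p \<cdot> d = Ident X T" "q \<cdot> d = Ident X T"
    using D(3)[OF I I refl] by blast
  obtain W w v where w: "w \<in> hom X W R" and v: "v \<in> hom X W T" and WB: "is_pullback X c d w v"
    using pullback_ex[OF c(1) d(1)] .
  note E = pullbackD[OF WB c(1) d(1) w]
  have aw: "a \<cdot> w = v" using Comp_assoc[OF w c(1) p] Comp_assoc[OF v d(1) p] E(2) c d Ident_Comp[OF v] by simp
  have bw: "b \<cdot> w = v" using Comp_assoc[OF w c(1) q] Comp_assoc[OF v d(1) q] E(2) c d Ident_Comp[OF v] by simp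
  have "monic X w"
  proof (rule monicI[OF w])
    fix S s t assume s: "s \<in> hom X S W" and t: "t \<in> hom X S W" and e: "w \<cdot> s = w \<cdot> t"
    have "v \<cdot> s = v \<cdot> t" using Comp_assoc[OF s w a] Comp_assoc[OF t w a] aw e by simp
    from E(4)[OF s t e this] show "s = t" .
  qed
  moreover have "\<exists>u. u \<in> hom X S W \<and> w \<cdot> u = t" if t: "t \<in> hom X S R" and e: "a \<cdot> t = b \<cdot> t" for S t
  proof -
    have at: "a \<cdot> t \<in> hom X S T" using Comp_hom[OF t a] .
    have "c \<cdot> t = d \<cdot> (a \<cdot> t)"
    proof (rule D(4)[OF Comp_hom[OF t c(1)] Comp_hom[OF at d(1)]])
      show "p \<cdot> (c \<cdot> t) = p \<cdot> (d \<cdot> (a \<cdot> t))"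
        using Comp_assoc[OF t c(1) p] Comp_assoc[OF at d(1) p] c d Ident_Comp[OF at] by simp
      show "q \<cdot> (c \<cdot> t) = q \<cdot> (d \<cdot> (a \<cdot> t))"
        using Comp_assoc[OF t c(1) q] Comp_assoc[OF at d(1) q] c d Ident_Comp[OF at] e by simp
    qed
    from E(3)[OF t at this] show ?thesis by blast
  qed
  ultimately show thesis using that w aw bw by simp
qed

section \<open>Points, kernel pairs and the use of protomodularity\<close>

lemma kernel_pullback:
  assumes k: "is_kernel X f k" and f: "f \<in> hom X A B"
  shows "is_pullback X f (zero_arr X (zero_of X) B) k (zero_arr X (Dom X k) (zero_of X))"
proof -
  let ?Z = "zero_of X" and ?K = "Dom X k"
  note D = is_kernelD[OF k f]
  have B: "B \<in> Obj X" and K: "?K \<in> Obj X" using f D(1) homD by blast+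
  note z = zero_arr_hom[OF zero_of_Obj B] and z' = zero_arr_hom[OF K zero_of_Obj]
  have "\<exists>!u. u \<in> hom X T ?K \<and> k \<cdot> u = s \<and> zero_arr X ?K ?Z \<cdot> u = t"
    if s: "s \<in> hom X T A" and t: "t \<in> hom X T ?Z" and e: "f \<cdot> s = zero_arr X ?Z B \<cdot> t" for T s t
  proof -
    have "f \<cdot> s = zero_arr X T B" using e zero_comp[OF t B] by simp
    from D(4)[OF s this] obtain u where u: "u \<in> hom X T ?K" "k \<cdot> u = s" by blast
    have "zero_arr X ?K ?Z \<cdot> u = t"
      using to_zero[OF is_zero_zero_of t] to_zero[OF is_zero_zero_of Comp_hom[OF u(1) z']] by simp
    then show ?thesis using u monicD[OF D(3,1)] by blast
  qed
  moreover have "f \<cdot> k = zero_arr X ?Z B \<cdot> zero_arr X ?K ?Z" using D(2) zero_comp[OF z' B] by simp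
  ultimately show ?thesis
    unfolding is_pullback_def using homD[OF f] homD[OF D(1)] homD[OF z] homD[OF z'] by auto
qed

text \<open>Protomodularity is applied to the equalizer of \<open>a\<close> and \<open>b\<close>, which contains both the section
  and the kernel of the point and hence is invertible.\<close>

lemma point_jointly_epic:
  assumes p: "p \<in> hom X R A" and s: "s \<in> hom X A R" and ps: "p \<cdot> s = Ident X A"
    and k: "is_kernel X p k"
    and a: "a \<in> hom X R T" and b: "b \<in> hom X R T" and ak: "a \<cdot> k = b \<cdot> k" and as: "a \<cdot> s = b \<cdot> s"
  shows "a = b"
proof -
  let ?Z = "zero_of X" and ?K = "Dom X k"
  note D = is_kernelD[OF k p]
  obtain W w where w: "w \<in> hom X W R" "monic X w" "a \<cdot> w = b \<cdot> w"
    and U: "\<And>S t. \<lbrakk>t \<in> hom X S R; a \<cdot> t = b \<cdot> t\<rbrakk> \<Longrightarrow> \<exists>u. u \<in> hom X S W \<and> w \<cdot> u = t"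
    using equalizer_ex[OF a b] by metis
  obtain s' where s': "s' \<in> hom X A W" "w \<cdot> s' = s" using U[OF s as] by blast
  obtain j where j: "j \<in> hom X ?K W" "w \<cdot> j = k" using U[OF D(1) ak] by blast
  have pw: "p \<cdot> w \<in> hom X W A" using Comp_hom w p by blast
  \<comment> \<open>Restricting \<open>p\<close> to the equalizer leaves its kernel object
    unchanged.\<close>
  have j_kernel: "is_kernel X (p \<cdot> w) j"
  proof (rule is_kernelI[OF pw j(1)])
    show "(p \<cdot> w) \<cdot> j = zero_arr X ?K A" using Comp_assoc[OF j(1) w(1) p] j(2) D(2) by simp
    show "monic X j" using monic_cancel[OF j(1) w(1)] j(2) D(3) by simp
    fix S t assume t: "t \<in> hom X S W" and "(p \<cdot> w) \<cdot> t = zero_arr X S A"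
    then have "p \<cdot> (w \<cdot> t) = zero_arr X S A" using Comp_assoc[OF t w(1) p] by simp
    from D(4)[OF Comp_hom[OF t w(1)] this] obtain u where u: "u \<in> hom X S ?K" "k \<cdot> u = w \<cdot> t" by blast
    have "w \<cdot> (j \<cdot> u) = w \<cdot> t" using Comp_assoc[OF u(1) j(1) w(1)] j(2) u(2) by simp
    then show "\<exists>u. u \<in> hom X S ?K \<and> j \<cdot> u = t" using monicD[OF w(2,1) Comp_hom[OF u(1) j(1)] t] u by blast
  qed
  have jD: "Dom X j = ?K" using homD[OF j(1)] by blast
  have K: "?K \<in> Obj X" using homD[OF D(1)] by blast
  note z' = zero_arr_hom[OF K zero_of_Obj]
  have pws: "(p \<cdot> w) \<cdot> s' = Ident X A" using Comp_assoc[OF s'(1) w(1) p] s' ps by simp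
  have pt: "point X (p \<cdot> w) s'" "point X p s"
    unfolding point_def using homD[OF pw] homD[OF p] s s' ps pws by simp_all
  have A: "protomodular X" using semi_abelian unfolding semi_abelian_def by blast
  \<comment> \<open>Base change along the map from the zero object to \<open>A\<close> sends a point
    to its kernel. It sends \<open>w\<close> to the identity of \<open>Dom X k\<close>, so
    reflection of isomorphisms applies.\<close>
  have "iso X w"
    using A[unfolded protomodular_def, rule_format, of "p \<cdot> w" s' p s w "zero_arr X ?Z A" j "zero_arr X ?K ?Z"
        k "zero_arr X ?K ?Z" "Ident X ?K"]
      pt homD[OF pw] homD[OF p] w(1) s'(2) kernel_pullback[OF k p] kernel_pullback[OF j_kernel pw]
      homD[OF z'] Ident_hom[OF K] Comp_Ident[OF D(1)] j(2) Comp_Ident[OF z'] iso_Ident[OF K] jD by simp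
  then obtain v where v: "v \<in> hom X R W" "w \<cdot> v = Ident X R" using isoE[OF _ w(1)] by metis
  have "a = (a \<cdot> w) \<cdot> v" "b = (b \<cdot> w) \<cdot> v"
    using Comp_assoc[OF v(1) w(1) a] Comp_assoc[OF v(1) w(1) b] v Comp_Ident a b by simp_all
  then show ?thesis using w(3) by simp
qed

text \<open>Turns the projection \<open>p\<close> of a kernel pair into a point, to which
  \<open>point_jointly_epic\<close> applies.\<close>

lemma kernel_pair_diagonal:
  assumes f: "f \<in> hom X A B" and P: "is_pullback X f f p q" and p: "p \<in> hom X R A"
  obtains s where "s \<in> hom X A R" "p \<cdot> s = Ident X A" "q \<cdot> s = Ident X A"
proof -
  have "A \<in> Obj X" using f homD by blast
  from pullbackD(3)[OF P f f p Ident_hom[OF this] Ident_hom[OF this] refl] that show thesis by blast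
qed

text \<open>The two projections of the kernel pair agree on the diagonal. On the kernel of
  \<open>p\<close> both are zero, since there the composite with \<open>q\<close> is killed by
  \<open>m\<close> and vanishes by assumption. So the projections coincide, which makes
  \<open>m\<close> monic.\<close>

lemma monic_if_trivial_kernel:
  assumes m: "m \<in> hom X A B"
    and triv: "\<And>T t. \<lbrakk>t \<in> hom X T A; m \<cdot> t = zero_arr X T B\<rbrakk> \<Longrightarrow> t = zero_arr X T A"
  shows "monic X m"
proof -
  obtain R p q where p: "p \<in> hom X R A" and q: "q \<in> hom X R A" and P: "is_pullback X m m p q"
    using pullback_ex[OF m m] .
  note D = pullbackD[OF P m m p]
  obtain s where s: "s \<in> hom X A R" "p \<cdot> s = Ident X A" "q \<cdot> s = Ident X A"
    using kernel_pair_diagonal[OF m P p] .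
  obtain j where j: "is_kernel X p j" using kernel_ex[OF p] by blast
  note J = is_kernelD[OF j p]
  have B: "B \<in> Obj X" using m homD by blast
  have "m \<cdot> (q \<cdot> j) = m \<cdot> (p \<cdot> j)" using Comp_assoc[OF J(1) q m] Comp_assoc[OF J(1) p m] D(2) by simp
  also have "\<dots> = zero_arr X (Dom X j) B" using J(2) comp_zero[OF m] homD[OF J(1)] by simp
  finally have "q \<cdot> j = p \<cdot> j" using triv[OF Comp_hom[OF J(1) q]] J(2) by simp
  then have pq: "p = q" using point_jointly_epic[OF p s(1,2) j p q] s by simp
  show ?thesis
  proof (rule monicI[OF m])
    fix T a b assume "a \<in> hom X T A" "b \<in> hom X T A" "m \<cdot> a = m \<cdot> b"
    from D(3)[OF this] pq show "a = b" by blast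
  qed
qed

text \<open>The kernel of \<open>p\<close> is the map \<open>j\<close> with coordinates 0 and
  \<open>k\<close>. On it \<open>t \<cdot> p\<close> and \<open>t \<cdot> q\<close> become 0 and
  \<open>t \<cdot> k\<close>, while on the diagonal they always agree, so joint epicity gives the
  equivalence. Hence a coequalizer of the kernel pair is the same as a cokernel of the
  kernel.\<close>

lemma kernel_pair_coequalizes_iff:
  assumes f: "f \<in> hom X A B" and P: "is_pullback X f f p q" and p: "p \<in> hom X R A"
    and k: "is_kernel X f k" and t: "t \<in> hom X A T"
  shows "t \<cdot> p = t \<cdot> q \<longleftrightarrow> t \<cdot> k = zero_arr X (Dom X k) T"
proof -
  let ?K = "Dom X k"
  note D = pullbackD[OF P f f p] and E = is_kernelD[OF k f]
  have o: "A \<in> Obj X" "B \<in> Obj X" "?K \<in> Obj X" using f E(1) homD by blast+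
  obtain s where s: "s \<in> hom X A R" "p \<cdot> s = Ident X A" "q \<cdot> s = Ident X A"
    using kernel_pair_diagonal[OF f P p] .
  note z = zero_arr_hom[OF o(3,1)]
  have "f \<cdot> zero_arr X ?K A = f \<cdot> k" using comp_zero[OF f o(3)] E(2) by simp
  from D(3)[OF z E(1) this] obtain j where j: "j \<in> hom X ?K R" "p \<cdot> j = zero_arr X ?K A" "q \<cdot> j = k"
    by blast
  have tpj: "(t \<cdot> p) \<cdot> j = zero_arr X ?K T" using Comp_assoc[OF j(1) p t] j(2) comp_zero[OF t o(3)] by simp
  have tqj: "(t \<cdot> q) \<cdot> j = t \<cdot> k" using Comp_assoc[OF j(1) D(1) t] j(3) by simp
  have "is_kernel X p j"
  proof (rule is_kernelI[OF p j(1,2)])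
    show "monic X j" using monic_cancel[OF j(1) D(1)] j(3) E(3) by simp
    fix S x assume x: "x \<in> hom X S R" and z: "p \<cdot> x = zero_arr X S A"
    have S: "S \<in> Obj X" using x homD by blast
    have qx: "q \<cdot> x \<in> hom X S A" using Comp_hom[OF x D(1)] .
    have "f \<cdot> (q \<cdot> x) = f \<cdot> (p \<cdot> x)" using Comp_assoc[OF x p f] Comp_assoc[OF x D(1) f] D(2) by simp
    also have "\<dots> = zero_arr X S B" using z comp_zero[OF f S] by simp
    finally obtain u where u: "u \<in> hom X S ?K" "k \<cdot> u = q \<cdot> x" using E(4)[OF qx] by blast
    have "j \<cdot> u = x"
    proof (rule D(4)[OF Comp_hom[OF u(1) j(1)] x])
      show "p \<cdot> (j \<cdot> u) = p \<cdot> x" using Comp_assoc[OF u(1) j(1) p] j(2) z zero_comp[OF u(1) o(1)] by simp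
      show "q \<cdot> (j \<cdot> u) = q \<cdot> x" using Comp_assoc[OF u(1) j(1) D(1)] j(3) u(2) by simp
    qed
    then show "\<exists>u. u \<in> hom X S ?K \<and> j \<cdot> u = x" using u by blast
  qed
  moreover have "(t \<cdot> p) \<cdot> s = (t \<cdot> q) \<cdot> s"
    using Comp_assoc[OF s(1) p t] Comp_assoc[OF s(1) D(1) t] s by simp
  ultimately have "t \<cdot> k = zero_arr X ?K T \<Longrightarrow> t \<cdot> p = t \<cdot> q"
    using point_jointly_epic[OF p s(1,2) _ Comp_hom[OF p t] Comp_hom[OF D(1) t]] tpj tqj by simp
  then show ?thesis using tpj tqj by auto
qed

text \<open>Regularity provides the coequalizer \<open>e\<close> of the kernel pair, which is a
  cokernel of \<open>k\<close> by the preceding lemma. Pullback stability of regular epimorphisms is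
  what makes the induced \<open>m\<close> monic.\<close>

lemma image_factorization:
  assumes f: "f \<in> hom X A B" and k: "is_kernel X f k"
  obtains I e m where "e \<in> hom X A I" "m \<in> hom X I B" "m \<cdot> e = f" "monic X m" "is_cokernel X k e"
proof -
  let ?K = "Dom X k"
  obtain R p q where p: "p \<in> hom X R A" and q: "q \<in> hom X R A" and P: "is_pullback X f f p q"
    using pullback_ex[OF f f] .
  note D = pullbackD[OF P f f p] and E = is_kernelD[OF k f] and C = kernel_pair_coequalizes_iff[OF f P p k]
  have reg: "regular_cat X" using semi_abelian unfolding semi_abelian_def barr_exact_def by blast
  then obtain e where e: "is_coequalizer X p q e" using P unfolding regular_cat_def by blast
  define I where "I = Cod X e"
  have eh: "e \<in> hom X A I" using e homD[OF p] unfolding is_coequalizer_def hom_def I_def by auto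
  have epq: "e \<cdot> p = e \<cdot> q" using e unfolding is_coequalizer_def by blast
  have U: "\<exists>!w. w \<in> hom X I T \<and> w \<cdot> e = t" if "t \<in> hom X A T" "t \<cdot> p = t \<cdot> q" for T t
    using e that homD[OF p] unfolding is_coequalizer_def I_def by blast
  obtain m where m: "m \<in> hom X I B" "m \<cdot> e = f" using U[OF f D(2)] by blast
  have ek: "e \<cdot> k = zero_arr X ?K I" using C[OF eh] epq by blast
  have coker: "is_cokernel X k e"
    by (rule is_cokernelI[OF E(1) eh ek]) (use U C in blast)
  have B: "B \<in> Obj X" and I: "I \<in> Obj X" using m homD by blast+
  have "monic X m"
  proof (rule monic_if_trivial_kernel[OF m(1)])
    fix T t assume t: "t \<in> hom X T I" and z: "m \<cdot> t = zero_arr X T B"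
    have T: "T \<in> Obj X" using t homD by blast
    \<comment> \<open>Pulling \<open>t\<close> back along \<open>e\<close> replaces it by a map
      \<open>p'\<close> into \<open>A\<close>, where being killed by \<open>f\<close> means
      factoring through \<open>k\<close>. This shows that \<open>t \<cdot> t'\<close> is
      zero.\<close>
    obtain Q p' t' where p': "p' \<in> hom X Q A" and t': "t' \<in> hom X Q T" and PB: "is_pullback X e t p' t'"
      using pullback_ex[OF eh t] .
    note F = pullbackD[OF PB eh t p']
    have "f \<cdot> p' = (m \<cdot> t) \<cdot> t'" using Comp_assoc[OF p' eh m(1)] Comp_assoc[OF t' t m(1)] F(2) m(2) by simp
    also have "\<dots> = zero_arr X Q B" using z zero_comp[OF t' B] by simp
    finally obtain u where u: "u \<in> hom X Q ?K" "k \<cdot> u = p'" using E(4)[OF p'] by blast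
    have "t \<cdot> t' = (e \<cdot> k) \<cdot> u" using F(2) Comp_assoc[OF u(1) E(1) eh] u(2) by simp
    also have "\<dots> = zero_arr X Q I" using ek zero_comp[OF u(1) I] by simp
    also have "\<dots> = zero_arr X T I \<cdot> t'" using zero_comp[OF t' I] by simp
    finally have eq: "t \<cdot> t' = zero_arr X T I \<cdot> t'" .
    \<comment> \<open>As a pullback of \<open>e\<close>, the map \<open>t'\<close> is a coequalizer
      and cancels on the right, which leaves \<open>t\<close> zero.\<close>
    have "regular_epi X t'"
      using reg PB e unfolding regular_cat_def regular_epi_def by blast
    then obtain a b where ab: "is_coequalizer X a b t'" unfolding regular_epi_def by blast
    define N where "N = Dom X a"
    have ah: "a \<in> hom X N Q" "b \<in> hom X N Q" and tab: "t' \<cdot> a = t' \<cdot> b"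
      using ab homD[OF t'] unfolding is_coequalizer_def hom_def N_def by auto
    have "(t \<cdot> t') \<cdot> a = (t \<cdot> t') \<cdot> b" using Comp_assoc[OF ah(1) t' t] Comp_assoc[OF ah(2) t' t] tab by simp
    moreover have "t \<cdot> t' \<in> hom X (Cod X a) I" using Comp_hom[OF t' t] homD[OF ah(1)] by simp
    moreover have "Cod X t' = T" using homD[OF t'] by blast
    ultimately have "\<exists>!w. w \<in> hom X T I \<and> w \<cdot> t' = t \<cdot> t'"
      using ab unfolding is_coequalizer_def by blast
    then show "t = zero_arr X T I" using t zero_arr_hom[OF T I] eq by metis
  qed
  with that eh m coker show thesis by blast
qed

end

section \<open>Chain complexes over a pointed category\<close>

context pointed_category
begin

lemma chain_complexD:
  assumes "chain_complex X I M"
  shows "i \<in> I \<Longrightarrow> cobj M i \<in> Obj X" "i \<notin> I \<Longrightarrow> cobj M i = undefined"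
    "\<lbrakk>i \<in> I; i - 1 \<in> I\<rbrakk> \<Longrightarrow> cdiff M i \<in> hom X (cobj M i) (cobj M (i - 1))"
    "\<not> (i \<in> I \<and> i - 1 \<in> I) \<Longrightarrow> cdiff M i = undefined"
    "\<lbrakk>i + 1 \<in> I; i \<in> I; i - 1 \<in> I\<rbrakk>
      \<Longrightarrow> cdiff M i \<cdot> cdiff M (i + 1) = zero_arr X (cobj M (i + 1)) (cobj M (i - 1))"
proof -
  have O: "if i \<in> I then cobj M i \<in> Obj X else cobj M i = undefined" for i
    using assms unfolding chain_complex_def by blast
  have D: "if i \<in> I \<and> i - 1 \<in> I then cdiff M i \<in> hom X (cobj M i) (cobj M (i - 1))
      else cdiff M i = undefined" for i
    using assms unfolding chain_complex_def by blast
  show "i \<in> I \<Longrightarrow> cobj M i \<in> Obj X" "i \<notin> I \<Longrightarrow> cobj M i = undefined" using O[of i] by simp_all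
  show "\<lbrakk>i \<in> I; i - 1 \<in> I\<rbrakk> \<Longrightarrow> cdiff M i \<in> hom X (cobj M i) (cobj M (i - 1))"
    "\<not> (i \<in> I \<and> i - 1 \<in> I) \<Longrightarrow> cdiff M i = undefined" using D[of i] by (auto split: if_splits)
  assume i: "i + 1 \<in> I" "i \<in> I" "i - 1 \<in> I"
  have "cdiff M (i + 1) \<in> hom X (cobj M (i + 1)) (cobj M i)" "cdiff M i \<in> hom X (cobj M i) (cobj M (i - 1))"
    using D[of i] D[of "i + 1"] i by simp_all
  from Comp_hom[OF this]
  have "cdiff M i \<cdot> cdiff M (i + 1) \<in> hom X (cobj M (i + 1)) (cobj M (i - 1))" .
  moreover have "zero_mor X (cdiff M i \<cdot> cdiff M (i + 1))" using assms i unfolding chain_complex_def by blast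
  ultimately show "cdiff M i \<cdot> cdiff M (i + 1) = zero_arr X (cobj M (i + 1)) (cobj M (i - 1))"
    using zero_mor_iff by blast
qed

lemma chain_complexI:
  assumes "\<And>i. i \<in> I \<Longrightarrow> cobj M i \<in> Obj X" "\<And>i. i \<notin> I \<Longrightarrow> cobj M i = undefined"
    "\<And>i. \<lbrakk>i \<in> I; i - 1 \<in> I\<rbrakk> \<Longrightarrow> cdiff M i \<in> hom X (cobj M i) (cobj M (i - 1))"
    "\<And>i. \<not> (i \<in> I \<and> i - 1 \<in> I) \<Longrightarrow> cdiff M i = undefined"
    "\<And>i. \<lbrakk>i + 1 \<in> I; i \<in> I; i - 1 \<in> I\<rbrakk>
      \<Longrightarrow> cdiff M i \<cdot> cdiff M (i + 1) = zero_arr X (cobj M (i + 1)) (cobj M (i - 1))"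
  shows "chain_complex X I M"
proof -
  have "zero_mor X (cdiff M i \<cdot> cdiff M (i + 1))" if "i + 1 \<in> I" "i \<in> I" "i - 1 \<in> I" for i
    using assms(5)[OF that] zero_mor_zero_arr assms(1) that by simp
  then show ?thesis unfolding chain_complex_def using assms by auto
qed

section \<open>The category of complexes over an arbitrary set of degrees\<close>

lemma ch_on_Obj: "M \<in> Obj (ch_on X I) \<longleftrightarrow> chain_complex X I M"
  unfolding ch_on_def by simp

lemma ch_on_hom_iff: "f \<in> hom (ch_on X I) M N \<longleftrightarrow> chain_map X I f \<and> csrc f = M \<and> ctgt f = N"
  unfolding ch_on_def hom_def by auto

lemma ch_on_homI:
  assumes "chain_complex X I M" "chain_complex X I N" "csrc f = M" "ctgt f = N"
    "\<And>i. i \<in> I \<Longrightarrow> ccomp f i \<in> hom X (cobj M i) (cobj N i)"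
    "\<And>i. i \<notin> I \<Longrightarrow> ccomp f i = undefined"
    "\<And>i. \<lbrakk>i \<in> I; i - 1 \<in> I\<rbrakk> \<Longrightarrow> cdiff N i \<cdot> ccomp f i = ccomp f (i - 1) \<cdot> cdiff M i"
  shows "f \<in> hom (ch_on X I) M N"
  unfolding ch_on_hom_iff chain_map_def using assms by simp

lemma ch_on_homD:
  assumes "f \<in> hom (ch_on X I) M N"
  shows "csrc f = M" "ctgt f = N" "chain_complex X I M" "chain_complex X I N"
    "i \<in> I \<Longrightarrow> ccomp f i \<in> hom X (cobj M i) (cobj N i)" "i \<notin> I \<Longrightarrow> ccomp f i = undefined"
    "\<lbrakk>i \<in> I; i - 1 \<in> I\<rbrakk> \<Longrightarrow> cdiff N i \<cdot> ccomp f i = ccomp f (i - 1) \<cdot> cdiff M i"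
proof -
  have f: "chain_map X I f" and [simp]: "csrc f = M" "ctgt f = N" using assms unfolding ch_on_hom_iff by auto
  show "csrc f = M" "ctgt f = N" "chain_complex X I M" "chain_complex X I N"
    using f unfolding chain_map_def by simp_all
  have "if i \<in> I then ccomp f i \<in> hom X (cobj (csrc f) i) (cobj (ctgt f) i) else ccomp f i = undefined"
    using f unfolding chain_map_def by blast
  then show "i \<in> I \<Longrightarrow> ccomp f i \<in> hom X (cobj M i) (cobj N i)" "i \<notin> I \<Longrightarrow> ccomp f i = undefined" by simp_all
  show "\<lbrakk>i \<in> I; i - 1 \<in> I\<rbrakk> \<Longrightarrow> cdiff N i \<cdot> ccomp f i = ccomp f (i - 1) \<cdot> cdiff M i"
    using f unfolding chain_map_def by simp
qed

text \<open>Components outside \<open>I\<close> are \<open>undefined\<close> on both sides, so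
  agreement on \<open>I\<close> already gives equality of the records.\<close>

lemma ch_on_eqI:
  assumes f: "f \<in> hom (ch_on X I) M N" and g: "g \<in> hom (ch_on X I) M N"
    and "\<And>i. i \<in> I \<Longrightarrow> ccomp f i = ccomp g i"
  shows "f = g"
proof -
  have "ccomp f = ccomp g"
    using assms(3) ch_on_homD(6)[OF f] ch_on_homD(6)[OF g] by (metis ext)
  then show ?thesis using ch_on_homD(1,2)[OF f] ch_on_homD(1,2)[OF g] by simp
qed

lemma ccomp_Comp [simp]: "i \<in> I \<Longrightarrow> ccomp (g \<cdot>\<^bsub>ch_on X I\<^esub> f) i = ccomp g i \<cdot> ccomp f i"
  unfolding ch_on_def by simp

lemma ccomp_Ident [simp]: "i \<in> I \<Longrightarrow> ccomp (Ident (ch_on X I) M) i = Ident X (cobj M i)"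
  unfolding ch_on_def by simp

lemma ch_on_Ident_hom:
  assumes M: "chain_complex X I M"
  shows "Ident (ch_on X I) M \<in> hom (ch_on X I) M M"
proof (rule ch_on_homI[OF M M])
  fix i assume i: "i \<in> I"
  show "ccomp (Ident (ch_on X I) M) i \<in> hom X (cobj M i) (cobj M i)"
    using i Ident_hom chain_complexD(1)[OF M i] by simp
  assume i': "i - 1 \<in> I"
  show "cdiff M i \<cdot> ccomp (Ident (ch_on X I) M) i = ccomp (Ident (ch_on X I) M) (i - 1) \<cdot> cdiff M i"
    using i i' chain_complexD(3)[OF M i i'] Ident_Comp Comp_Ident by simp
qed (simp_all add: ch_on_def)

lemma ch_on_Comp_hom:
  assumes f: "f \<in> hom (ch_on X I) M N" and g: "g \<in> hom (ch_on X I) N K"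
  shows "g \<cdot>\<^bsub>ch_on X I\<^esub> f \<in> hom (ch_on X I) M K"
proof (rule ch_on_homI)
  note F = ch_on_homD[OF f] and G = ch_on_homD[OF g]
  show "chain_complex X I M" "chain_complex X I K" using F G by auto
  show "csrc (g \<cdot>\<^bsub>ch_on X I\<^esub> f) = M" "ctgt (g \<cdot>\<^bsub>ch_on X I\<^esub> f) = K"
    using F(1) G(2) by (simp_all add: ch_on_def)
  show "ccomp (g \<cdot>\<^bsub>ch_on X I\<^esub> f) i = undefined" if "i \<notin> I" for i using that by (simp add: ch_on_def)
  fix i assume i: "i \<in> I"
  note fi = F(5)[OF i] and gi = G(5)[OF i]
  show "ccomp (g \<cdot>\<^bsub>ch_on X I\<^esub> f) i \<in> hom X (cobj M i) (cobj K i)" using Comp_hom[OF fi gi] i by simp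
  assume i': "i - 1 \<in> I"
  note fi' = F(5)[OF i'] and gi' = G(5)[OF i']
  note dM = chain_complexD(3)[OF F(3) i i'] and dN = chain_complexD(3)[OF F(4) i i']
    and dK = chain_complexD(3)[OF G(4) i i']
  have "cdiff K i \<cdot> (ccomp g i \<cdot> ccomp f i) = (ccomp g (i - 1) \<cdot> ccomp f (i - 1)) \<cdot> cdiff M i"
    using Comp_assoc[OF fi gi dK] Comp_assoc[OF fi dN gi'] Comp_assoc[OF dM fi' gi'] F(7)[OF i i'] G(7)[OF i i']
    by simp
  then show "cdiff K i \<cdot> ccomp (g \<cdot>\<^bsub>ch_on X I\<^esub> f) i = ccomp (g \<cdot>\<^bsub>ch_on X I\<^esub> f) (i - 1) \<cdot> cdiff M i"
    using i i' by simp
qed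

lemma category_ch_on: "category (ch_on X I)"
proof
  fix f assume "f \<in> Arr (ch_on X I)"
  then have "f \<in> hom (ch_on X I) (csrc f) (ctgt f)" by (simp add: ch_on_def hom_def)
  from ch_on_homD(3,4)[OF this] show "Dom (ch_on X I) f \<in> Obj (ch_on X I)" "Cod (ch_on X I) f \<in> Obj (ch_on X I)"
    by (simp_all add: ch_on_def)
next
  show "A \<in> Obj (ch_on X I) \<Longrightarrow> Ident (ch_on X I) A \<in> hom (ch_on X I) A A" for A
    using ch_on_Ident_hom ch_on_Obj by blast
next
  fix f A B assume f: "f \<in> hom (ch_on X I) A B"
  note F = ch_on_homD[OF f]
  show "f \<cdot>\<^bsub>ch_on X I\<^esub> Ident (ch_on X I) A = f"
    by (rule ch_on_eqI[OF ch_on_Comp_hom[OF ch_on_Ident_hom[OF F(3)] f] f]) (simp add: Comp_Ident[OF F(5)])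
  show "Ident (ch_on X I) B \<cdot>\<^bsub>ch_on X I\<^esub> f = f"
    by (rule ch_on_eqI[OF ch_on_Comp_hom[OF f ch_on_Ident_hom[OF F(4)]] f]) (simp add: Ident_Comp[OF F(5)])
  fix g D assume g: "g \<in> hom (ch_on X I) B D"
  then show "g \<cdot>\<^bsub>ch_on X I\<^esub> f \<in> hom (ch_on X I) A D" using ch_on_Comp_hom f by blast
  fix h E assume h: "h \<in> hom (ch_on X I) D E"
  show "h \<cdot>\<^bsub>ch_on X I\<^esub> (g \<cdot>\<^bsub>ch_on X I\<^esub> f) = (h \<cdot>\<^bsub>ch_on X I\<^esub> g) \<cdot>\<^bsub>ch_on X I\<^esub> f"
    by (rule ch_on_eqI[OF ch_on_Comp_hom[OF ch_on_Comp_hom[OF f g] h] ch_on_Comp_hom[OF f ch_on_Comp_hom[OF g h]]])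
      (simp add: Comp_assoc[OF F(5) ch_on_homD(5)[OF g] ch_on_homD(5)[OF h]])
qed

section \<open>Zero complexes and zero chain maps\<close>

definition zero_cplx :: "int set \<Rightarrow> ('o, 'a) cplx" where
  "zero_cplx I = \<lparr>cobj = restrict (\<lambda>i. zero_of X) I,
    cdiff = (\<lambda>i. if i \<in> I \<and> i - 1 \<in> I then zero_arr X (zero_of X) (zero_of X) else undefined)\<rparr>"

lemma zero_cplx: "chain_complex X I (zero_cplx I)"
proof -
  note z = zero_arr_hom[OF zero_of_Obj zero_of_Obj]
  show ?thesis
    by (rule chain_complexI) (auto simp: zero_cplx_def z zero_comp[OF z])
qed

lemma ch_on_zero_map_hom:
  assumes M: "chain_complex X I M" and N: "chain_complex X I N"
  shows "\<lparr>csrc = M, ctgt = N, ccomp = restrict (\<lambda>i. zero_arr X (cobj M i) (cobj N i)) I\<rparr> \<in> hom (ch_on X I) M N"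
  by (rule ch_on_homI[OF M N])
    (use M N zero_arr_hom chain_complexD(1) in
      \<open>auto simp: zero_comp[OF chain_complexD(3)] comp_zero[OF chain_complexD(3)]\<close>)

lemma is_zero_ch_onI:
  assumes M: "chain_complex X I M" and z: "\<And>i. i \<in> I \<Longrightarrow> is_zero X (cobj M i)"
  shows "is_zero (ch_on X I) M"
  unfolding is_zero_def
proof (intro conjI ballI)
  show "M \<in> Obj (ch_on X I)" using M ch_on_Obj by blast
  fix N assume "N \<in> Obj (ch_on X I)"
  then have N: "chain_complex X I N" using ch_on_Obj by blast
  have "f = g" if "f \<in> hom (ch_on X I) N M" "g \<in> hom (ch_on X I) N M" for f g
    using ch_on_eqI[OF that] to_zero[OF z ch_on_homD(5)[OF that(1)]] to_zero[OF z ch_on_homD(5)[OF that(2)]] by metis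
  then show "\<exists>!f. f \<in> hom (ch_on X I) N M" using ch_on_zero_map_hom[OF N M] by blast
  have "f = g" if "f \<in> hom (ch_on X I) M N" "g \<in> hom (ch_on X I) M N" for f g
    using ch_on_eqI[OF that] from_zero[OF z ch_on_homD(5)[OF that(1)]] from_zero[OF z ch_on_homD(5)[OF that(2)]] by metis
  then show "\<exists>!f. f \<in> hom (ch_on X I) M N" using ch_on_zero_map_hom[OF M N] by blast
qed

lemma is_zero_zero_cplx: "is_zero (ch_on X I) (zero_cplx I)"
  by (rule is_zero_ch_onI[OF zero_cplx]) (simp add: zero_cplx_def is_zero_zero_of)

lemma pointed_category_ch_on: "pointed_category (ch_on X I)"
  using category_ch_on is_zero_zero_cplx
  unfolding pointed_category_def pointed_category_axioms_def pointed_def by blast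

text \<open>\<open>zero_arr\<close> is a definite description, so its components are not visible.
  Factoring it through the zero complex forces each component through a zero object.\<close>

lemma ccomp_zero_arr:
  assumes M: "chain_complex X I M" and N: "chain_complex X I N" and i: "i \<in> I"
  shows "ccomp (zero_arr (ch_on X I) M N) i = zero_arr X (cobj M i) (cobj N i)"
proof -
  interpret ch: pointed_category "ch_on X I" by (rule pointed_category_ch_on)
  have o: "M \<in> Obj (ch_on X I)" "N \<in> Obj (ch_on X I)" "zero_cplx I \<in> Obj (ch_on X I)"
    using M N zero_cplx ch_on_Obj by blast+
  note a = ch.zero_arr_hom[OF o(1,3)] and b = ch.zero_arr_hom[OF o(3,2)]
  have "zero_arr (ch_on X I) M N = zero_arr (ch_on X I) (zero_cplx I) N \<cdot>\<^bsub>ch_on X I\<^esub> zero_arr (ch_on X I) M (zero_cplx I)"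
    using ch.zero_comp[OF a o(2)] by simp
  then have eq: "ccomp (zero_arr (ch_on X I) M N) i
      = ccomp (zero_arr (ch_on X I) (zero_cplx I) N) i \<cdot> ccomp (zero_arr (ch_on X I) M (zero_cplx I)) i"
    using i by simp
  have z: "is_zero X (cobj (zero_cplx I) i)" using i is_zero_zero_of by (simp add: zero_cplx_def)
  note ai = ch_on_homD(5)[OF a i] and bi = ch_on_homD(5)[OF b i]
  show ?thesis
    using eq to_zero[OF z ai] comp_zero[OF bi chain_complexD(1)[OF M i]] by simp
qed

text \<open>The identity of a zero complex equals its zero endomorphism; reading off components
  gives the same equation in each degree.\<close>

lemma is_zero_ch_on_iff:
  assumes M: "chain_complex X I M"
  shows "is_zero (ch_on X I) M \<longleftrightarrow> (\<forall>i\<in>I. is_zero X (cobj M i))"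
proof
  interpret ch: pointed_category "ch_on X I" by (rule pointed_category_ch_on)
  have M': "M \<in> Obj (ch_on X I)" using M ch_on_Obj by blast
  assume "is_zero (ch_on X I) M"
  then have e: "Ident (ch_on X I) M = zero_arr (ch_on X I) M M" using ch.is_zero_iff M' by blast
  show "\<forall>i\<in>I. is_zero X (cobj M i)"
  proof
    fix i assume i: "i \<in> I"
    have "Ident X (cobj M i) = ccomp (zero_arr (ch_on X I) M M) i"
      using arg_cong[OF e, of "\<lambda>f. ccomp f i"] i by simp
    then show "is_zero X (cobj M i)"
      using ccomp_zero_arr[OF M M i] is_zero_iff chain_complexD(1)[OF M i] by simp
  qed
qed (use is_zero_ch_onI M in blast)

lemma isomorphic_ch_on_ccomp:
  assumes "isomorphic (ch_on X I) M N" and i: "i \<in> I"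
  shows "isomorphic X (cobj M i) (cobj N i)"
proof -
  interpret ch: pointed_category "ch_on X I" by (rule pointed_category_ch_on)
  obtain f where f: "f \<in> hom (ch_on X I) M N" "iso (ch_on X I) f" using assms unfolding isomorphic_def by blast
  then obtain g where g: "g \<in> hom (ch_on X I) N M" "g \<cdot>\<^bsub>ch_on X I\<^esub> f = Ident (ch_on X I) M"
    "f \<cdot>\<^bsub>ch_on X I\<^esub> g = Ident (ch_on X I) N" using ch.isoE by metis
  have "ccomp g i \<cdot> ccomp f i = Ident X (cobj M i)" "ccomp f i \<cdot> ccomp g i = Ident X (cobj N i)"
    using arg_cong[OF g(2), of "\<lambda>f. ccomp f i"] arg_cong[OF g(3), of "\<lambda>f. ccomp f i"] i by simp_all
  then show ?thesis
    unfolding isomorphic_def using isoI ch_on_homD(5)[OF f(1) i] ch_on_homD(5)[OF g(1) i] by blast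
qed

section \<open>Degreewise monomorphisms, kernels and cokernels\<close>

lemma monic_ch_onI:
  assumes f: "f \<in> hom (ch_on X I) M N" and m: "\<And>i. i \<in> I \<Longrightarrow> monic X (ccomp f i)"
  shows "monic (ch_on X I) f"
proof -
  interpret ch: pointed_category "ch_on X I" by (rule pointed_category_ch_on)
  show ?thesis
  proof (rule ch.monicI[OF f])
    fix T s t assume s: "s \<in> hom (ch_on X I) T M" and t: "t \<in> hom (ch_on X I) T M"
      and e: "f \<cdot>\<^bsub>ch_on X I\<^esub> s = f \<cdot>\<^bsub>ch_on X I\<^esub> t"
    show "s = t"
    proof (rule ch_on_eqI[OF s t])
      fix i assume i: "i \<in> I"
      have "ccomp f i \<cdot> ccomp s i = ccomp f i \<cdot> ccomp t i"
        using arg_cong[OF e, of "\<lambda>f. ccomp f i"] i by simp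
      then show "ccomp s i = ccomp t i"
        using monicD[OF m[OF i] ch_on_homD(5)[OF f i] ch_on_homD(5)[OF s i] ch_on_homD(5)[OF t i]] by blast
    qed
  qed
qed

text \<open>The factorizations picked in the separate degrees fit together to a chain map: the
  required square commutes after composing with the monic component of \<open>k\<close> in degree
  \<open>i - 1\<close>.\<close>

lemma is_kernel_ch_onI:
  assumes f: "f \<in> hom (ch_on X I) M N" and k: "k \<in> hom (ch_on X I) K M"
    and ker: "\<And>i. i \<in> I \<Longrightarrow> is_kernel X (ccomp f i) (ccomp k i)"
  shows "is_kernel (ch_on X I) f k"
proof -
  interpret ch: pointed_category "ch_on X I" by (rule pointed_category_ch_on)
  note F = ch_on_homD[OF f] and K = ch_on_homD[OF k]
  have D: "Dom X (ccomp k i) = cobj K i" if "i \<in> I" for i using K(5)[OF that] homD by blast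
  note kD = is_kernelD[OF ker F(5)]
  show ?thesis
  proof (rule ch.is_kernelI[OF f k])
    have KO: "K \<in> Obj (ch_on X I)" "N \<in> Obj (ch_on X I)" using K(3) F(4) ch_on_Obj by blast+
    show "f \<cdot>\<^bsub>ch_on X I\<^esub> k = zero_arr (ch_on X I) K N"
      by (rule ch_on_eqI[OF ch.Comp_hom[OF k f] ch.zero_arr_hom[OF KO]])
        (simp add: ccomp_zero_arr[OF K(3) F(4)] kD(2) D)
    show "monic (ch_on X I) k" using monic_ch_onI[OF k] kD(3) by blast
    fix T t assume t: "t \<in> hom (ch_on X I) T M" and z: "f \<cdot>\<^bsub>ch_on X I\<^esub> t = zero_arr (ch_on X I) T N"
    note T = ch_on_homD[OF t]
    have ft: "ccomp f i \<cdot> ccomp t i = zero_arr X (cobj T i) (cobj N i)" if i: "i \<in> I" for i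
      using arg_cong[OF z, of "\<lambda>f. ccomp f i"] i ccomp_zero_arr[OF T(3) F(4) i] by simp
    have "\<exists>u. u \<in> hom X (cobj T i) (cobj K i) \<and> ccomp k i \<cdot> u = ccomp t i" if i: "i \<in> I" for i
      using kD(4)[OF i i T(5)[OF i] ft[OF i]] D[OF i] by simp
    then obtain c where c: "\<And>i. i \<in> I \<Longrightarrow> c i \<in> hom X (cobj T i) (cobj K i)"
      "\<And>i. i \<in> I \<Longrightarrow> ccomp k i \<cdot> c i = ccomp t i" by metis
    define u where "u = \<lparr>csrc = T, ctgt = K, ccomp = restrict c I\<rparr>"
    have u: "u \<in> hom (ch_on X I) T K"
    proof (rule ch_on_homI[OF T(3) K(3)])
      fix i assume i: "i \<in> I" and i': "i - 1 \<in> I"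
      note dT = chain_complexD(3)[OF T(3) i i'] and dK = chain_complexD(3)[OF K(3) i i']
        and dM = chain_complexD(3)[OF K(4) i i']
      have "ccomp k (i - 1) \<cdot> (cdiff K i \<cdot> c i) = (cdiff M i \<cdot> ccomp k i) \<cdot> c i"
        using Comp_assoc[OF c(1)[OF i] dK K(5)[OF i']] K(7)[OF i i'] by simp
      also have "\<dots> = ccomp t (i - 1) \<cdot> cdiff T i"
        using Comp_assoc[OF c(1)[OF i] K(5)[OF i] dM] c(2)[OF i] T(7)[OF i i'] by simp
      also have "\<dots> = ccomp k (i - 1) \<cdot> (c (i - 1) \<cdot> cdiff T i)"
        using Comp_assoc[OF dT c(1)[OF i'] K(5)[OF i']] c(2)[OF i'] by simp
      finally have "cdiff K i \<cdot> c i = c (i - 1) \<cdot> cdiff T i"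
        using monicD[OF kD(3)[OF i' i'] K(5)[OF i'] Comp_hom[OF c(1)[OF i] dK] Comp_hom[OF dT c(1)[OF i']]] by blast
      then show "cdiff K i \<cdot> ccomp u i = ccomp u (i - 1) \<cdot> cdiff T i" using i i' by (simp add: u_def)
    qed (auto simp: u_def c(1))
    moreover have "k \<cdot>\<^bsub>ch_on X I\<^esub> u = t"
      by (rule ch_on_eqI[OF ch.Comp_hom[OF u k] t]) (simp add: u_def c(2))
    ultimately show "\<exists>u. u \<in> hom (ch_on X I) T K \<and> k \<cdot>\<^bsub>ch_on X I\<^esub> u = t" by blast
  qed
qed

text \<open>Dually, the squares of the induced map are checked after precomposing with the component
  of \<open>q\<close> in degree \<open>i\<close>, which is epic as a cokernel.\<close>

lemma is_cokernel_ch_onI: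
  assumes f: "f \<in> hom (ch_on X I) M N" and q: "q \<in> hom (ch_on X I) N Q"
    and coker: "\<And>i. i \<in> I \<Longrightarrow> is_cokernel X (ccomp f i) (ccomp q i)"
  shows "is_cokernel (ch_on X I) f q"
proof -
  interpret ch: pointed_category "ch_on X I" by (rule pointed_category_ch_on)
  note F = ch_on_homD[OF f] and Q = ch_on_homD[OF q]
  have D: "Cod X (ccomp q i) = cobj Q i" if "i \<in> I" for i using Q(5)[OF that] homD by blast
  note qD = is_cokernelD[OF coker F(5)]
  have epi: "s = t" if i: "i \<in> I" and s: "s \<in> hom X (cobj Q i) T" and t: "t \<in> hom X (cobj Q i) T"
    and e: "s \<cdot> ccomp q i = t \<cdot> ccomp q i" for i T s t
    using qD(4)[OF i i _ _ e] D[OF i] s t by simp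
  show ?thesis
  proof (rule ch.is_cokernelI[OF f q])
    have O: "M \<in> Obj (ch_on X I)" "Q \<in> Obj (ch_on X I)" using F(3) Q(4) ch_on_Obj by blast+
    show "q \<cdot>\<^bsub>ch_on X I\<^esub> f = zero_arr (ch_on X I) M Q"
      by (rule ch_on_eqI[OF ch.Comp_hom[OF f q] ch.zero_arr_hom[OF O]])
        (simp add: ccomp_zero_arr[OF F(3) Q(4)] qD(2) D)
    fix T t assume t: "t \<in> hom (ch_on X I) N T" and z: "t \<cdot>\<^bsub>ch_on X I\<^esub> f = zero_arr (ch_on X I) M T"
    note T = ch_on_homD[OF t]
    have tf: "ccomp t i \<cdot> ccomp f i = zero_arr X (cobj M i) (cobj T i)" if i: "i \<in> I" for i
      using arg_cong[OF z, of "\<lambda>f. ccomp f i"] i ccomp_zero_arr[OF F(3) T(4) i] by simp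
    have "\<exists>u. u \<in> hom X (cobj Q i) (cobj T i) \<and> u \<cdot> ccomp q i = ccomp t i" if i: "i \<in> I" for i
      using qD(3)[OF i i T(5)[OF i] tf[OF i]] D[OF i] by auto
    then obtain c where c: "\<And>i. i \<in> I \<Longrightarrow> c i \<in> hom X (cobj Q i) (cobj T i)"
      "\<And>i. i \<in> I \<Longrightarrow> c i \<cdot> ccomp q i = ccomp t i" by metis
    define u where "u = \<lparr>csrc = Q, ctgt = T, ccomp = restrict c I\<rparr>"
    have u: "u \<in> hom (ch_on X I) Q T"
    proof (rule ch_on_homI[OF Q(4) T(4)])
      fix i assume i: "i \<in> I" and i': "i - 1 \<in> I"
      note dT = chain_complexD(3)[OF T(4) i i'] and dQ = chain_complexD(3)[OF Q(4) i i']
        and dN = chain_complexD(3)[OF Q(3) i i']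
      have "(cdiff T i \<cdot> c i) \<cdot> ccomp q i = ccomp t (i - 1) \<cdot> cdiff N i"
        using Comp_assoc[OF Q(5)[OF i] c(1)[OF i] dT] T(7)[OF i i'] c(2)[OF i] by simp
      also have "\<dots> = c (i - 1) \<cdot> (cdiff Q i \<cdot> ccomp q i)"
        using Comp_assoc[OF dN Q(5)[OF i'] c(1)[OF i']] Q(7)[OF i i'] c(2)[OF i'] by simp
      also have "\<dots> = (c (i - 1) \<cdot> cdiff Q i) \<cdot> ccomp q i"
        using Comp_assoc[OF Q(5)[OF i] dQ c(1)[OF i']] by simp
      finally have "cdiff T i \<cdot> c i = c (i - 1) \<cdot> cdiff Q i"
        using epi[OF i Comp_hom[OF c(1)[OF i] dT] Comp_hom[OF dQ c(1)[OF i']]] by blast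
      then show "cdiff T i \<cdot> ccomp u i = ccomp u (i - 1) \<cdot> cdiff Q i" using i i' by (simp add: u_def)
    qed (auto simp: u_def c(1))
    show "\<exists>!u. u \<in> hom (ch_on X I) Q T \<and> u \<cdot>\<^bsub>ch_on X I\<^esub> q = t"
    proof (rule ex1I[of _ u])
      show "u \<in> hom (ch_on X I) Q T \<and> u \<cdot>\<^bsub>ch_on X I\<^esub> q = t"
        using u ch_on_eqI[OF ch.Comp_hom[OF q u] t] by (simp add: u_def c(2))
      fix v assume v: "v \<in> hom (ch_on X I) Q T \<and> v \<cdot>\<^bsub>ch_on X I\<^esub> q = t"
      then have vh: "v \<in> hom (ch_on X I) Q T" and vq: "v \<cdot>\<^bsub>ch_on X I\<^esub> q = t" by auto
      show "v = u"
      proof (rule ch_on_eqI[OF vh u])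
        fix i assume i: "i \<in> I"
        have "ccomp v i \<cdot> ccomp q i = ccomp t i" using arg_cong[OF vq, of "\<lambda>f. ccomp f i"] i by simp
        also have "\<dots> = ccomp u i \<cdot> ccomp q i" using c(2)[OF i] i by (simp add: u_def)
        finally show "ccomp v i = ccomp u i" using epi[OF i ch_on_homD(5)[OF vh i] ch_on_homD(5)[OF u i]] by blast
      qed
    qed
  qed
qed

end

section \<open>The adjunction between truncation and coskeleton\<close>

context semi_abelian_category
begin

text \<open>Keeping \<open>I\<close> as a parameter makes the calculus of zero maps, kernels and
  monomorphisms available both in \<open>ch X\<close> and for truncated complexes.\<close>

sublocale ch: pointed_category "ch_on X I" for I :: "int set"
  by (rule pointed_category_ch_on)

lemmas cplx_obj = chain_complexD(1)[where I = UNIV, OF _ UNIV_I]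
  and cplx_diff = chain_complexD(3)[where I = UNIV, OF _ UNIV_I UNIV_I]
  and cplx_diff_diff = chain_complexD(5)[where I = UNIV, OF _ UNIV_I UNIV_I UNIV_I]
  and cmor_comp = ch_on_homD(5)[where I = UNIV, OF _ UNIV_I]
  and cmor_comm = ch_on_homD(7)[where I = UNIV, OF _ UNIV_I UNIV_I]

lemma cplxI:
  assumes "\<And>i. cobj M i \<in> Obj X" "\<And>i. cdiff M i \<in> hom X (cobj M i) (cobj M (i - 1))"
    "\<And>i. cdiff M i \<cdot> cdiff M (i + 1) = zero_arr X (cobj M (i + 1)) (cobj M (i - 1))"
  shows "chain_complex X UNIV M"
  by (rule chain_complexI) (use assms in auto)

lemma cmorI:
  assumes "chain_complex X UNIV M" "chain_complex X UNIV N" "csrc f = M" "ctgt f = N"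
    "\<And>i. ccomp f i \<in> hom X (cobj M i) (cobj N i)"
    "\<And>i. cdiff N i \<cdot> ccomp f i = ccomp f (i - 1) \<cdot> cdiff M i"
  shows "f \<in> hom (ch_on X UNIV) M N"
  by (rule ch_on_homI) (use assms in auto)

section \<open>Truncation\<close>

lemma tr_obj_complex:
  assumes M: "chain_complex X UNIV M"
  shows "chain_complex X {..m} (tr_obj m M)"
  by (rule chain_complexI)
    (use cplx_obj[OF M] cplx_diff[OF M] cplx_diff_diff[OF M] in \<open>auto simp: tr_obj_def\<close>)

lemma tr_hom:
  assumes f: "f \<in> hom (ch_on X UNIV) M N"
  shows "Farr (tr m) f \<in> hom (ch_on X {..m}) (tr_obj m M) (tr_obj m N)"
proof (rule ch_on_homI)
  note F = ch_on_homD[OF f]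
  show "chain_complex X {..m} (tr_obj m M)" "chain_complex X {..m} (tr_obj m N)"
    using tr_obj_complex F by blast+
qed (use ch_on_homD(1,2)[OF f] cmor_comp[OF f] cmor_comm[OF f] in \<open>auto simp: tr_def tr_obj_def\<close>)

lemma ccomp_tr [simp]: "i \<le> m \<Longrightarrow> ccomp (Farr (tr m) f) i = ccomp f i"
  by (simp add: tr_def)

lemma tr_functor: "is_functor (ch X) (ch_le X m) (tr m)"
  unfolding is_functor_def ch_def ch_le_def
proof (intro conjI ballI impI)
  show "category (ch_on X UNIV)" "category (ch_on X {..m})" by (rule category_ch_on)+
  show "Fobj (tr m) A \<in> Obj (ch_on X {..m})" if "A \<in> Obj (ch_on X UNIV)" for A
    using that tr_obj_complex ch_on_Obj by (simp add: tr_def)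
  show tr: "Farr (tr m) f \<in> hom (ch_on X {..m}) (Fobj (tr m) (Dom (ch_on X UNIV) f)) (Fobj (tr m) (Cod (ch_on X UNIV) f))"
    if "f \<in> Arr (ch_on X UNIV)" for f
    using tr_hom[OF ch.Arr_hom[OF that]] by (simp add: tr_def)
  show "Farr (tr m) (Ident (ch_on X UNIV) A) = Ident (ch_on X {..m}) (Fobj (tr m) A)"
    if "A \<in> Obj (ch_on X UNIV)" for A
  proof -
    have A: "chain_complex X UNIV A" using that ch_on_Obj by blast
    have Fobj: "Fobj (tr m) A = tr_obj m A" by (simp add: tr_def)
    show ?thesis unfolding Fobj
      by (rule ch_on_eqI[OF tr_hom[OF ch_on_Ident_hom[OF A]] ch_on_Ident_hom[OF tr_obj_complex[OF A]]])
        (simp add: tr_obj_def)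
  qed
  fix f g assume f: "f \<in> Arr (ch_on X UNIV)" and g: "g \<in> Arr (ch_on X UNIV)"
    and e: "Dom (ch_on X UNIV) g = Cod (ch_on X UNIV) f"
  note fh = ch.Arr_hom[OF f] and gh = ch.Arr_hom[OF g, unfolded e]
  show "Farr (tr m) (g \<cdot>\<^bsub>ch_on X UNIV\<^esub> f) = Farr (tr m) g \<cdot>\<^bsub>ch_on X {..m}\<^esub> Farr (tr m) f"
    by (rule ch_on_eqI[OF tr_hom[OF ch.Comp_hom[OF fh gh]] ch.Comp_hom[OF tr_hom[OF fh] tr_hom[OF gh]]]) simp
qed

lemma le_diff:
  assumes N: "chain_complex X {..m} N" and "i \<le> m"
  shows "cdiff N i \<in> hom X (cobj N i) (cobj N (i - 1))"
  by (rule chain_complexD(3)[OF N]) (use assms(2) in auto)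

lemma le_obj:
  assumes N: "chain_complex X {..m} N" and "i \<le> m"
  shows "cobj N i \<in> Obj X"
  by (rule chain_complexD(1)[OF N]) (use assms(2) in auto)

lemma le_diff_diff:
  assumes N: "chain_complex X {..m} N" and "i + 1 \<le> m"
  shows "cdiff N i \<cdot> cdiff N (i + 1) = zero_arr X (cobj N (i + 1)) (cobj N (i - 1))"
  by (rule chain_complexD(5)[OF N]) (use assms(2) in auto)

lemma le_comp: "f \<in> hom (ch_on X {..m}) M N \<Longrightarrow> i \<le> m \<Longrightarrow> ccomp f i \<in> hom X (cobj M i) (cobj N i)"
  by (rule ch_on_homD(5)) auto

lemma le_comm:
  "f \<in> hom (ch_on X {..m}) M N \<Longrightarrow> i \<le> m \<Longrightarrow> cdiff N i \<cdot> ccomp f i = ccomp f (i - 1) \<cdot> cdiff M i"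
  by (rule ch_on_homD(7)) auto

section \<open>The coskeleton and its universal property\<close>

lemma cosk_obj_simps:
  "i \<le> m \<Longrightarrow> cobj (cosk_obj X m N) i = cobj N i" "cobj (cosk_obj X m N) (m + 1) = Ker X (cdiff N m)"
  "i > m + 1 \<Longrightarrow> cobj (cosk_obj X m N) i = zero_of X"
  "i \<le> m \<Longrightarrow> cdiff (cosk_obj X m N) i = cdiff N i" "cdiff (cosk_obj X m N) (m + 1) = ker X (cdiff N m)"
  "i > m + 1 \<Longrightarrow> cdiff (cosk_obj X m N) i
    = zero_arr X (cobj (cosk_obj X m N) i) (cobj (cosk_obj X m N) (i - 1))"
  by (simp_all add: cosk_obj_def cosk_cobj_def)

lemma cosk_obj_complex:
  assumes N: "chain_complex X {..m} N"
  shows "chain_complex X UNIV (cosk_obj X m N)"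
proof -
  note d = le_diff[OF N order_refl]
  note k = kerD[OF d]
  have o: "cobj (cosk_obj X m N) i \<in> Obj X" for i
    by (cases rule: degree_cases[of i m]) (simp_all add: cosk_obj_simps le_obj[OF N] Ker_Obj[OF d])
  have h: "cdiff (cosk_obj X m N) i \<in> hom X (cobj (cosk_obj X m N) i) (cobj (cosk_obj X m N) (i - 1))" for i
  proof (cases rule: degree_cases[of i m])
    case 3 then show ?thesis using zero_arr_hom[OF o o] by (simp add: cosk_obj_simps(6))
  qed (use k(1) le_diff[OF N] in \<open>simp_all add: cosk_obj_simps\<close>)
  show ?thesis
  proof (rule cplxI[OF o h])
    fix i
    \<comment> \<open>The split is on the degree of the upper differential: it belongs to
      \<open>N\<close>, is the chosen kernel, or is zero.\<close>
    show "cdiff (cosk_obj X m N) i \<cdot> cdiff (cosk_obj X m N) (i + 1)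
      = zero_arr X (cobj (cosk_obj X m N) (i + 1)) (cobj (cosk_obj X m N) (i - 1))"
    proof (cases rule: degree_cases[of "i + 1" m])
      case 1 then show ?thesis using le_diff_diff[OF N] by (simp add: cosk_obj_simps)
    next
      case 2 then show ?thesis using k(2) by (simp add: cosk_obj_simps)
    next
      case 3 then show ?thesis using comp_zero[OF h o] by (simp add: cosk_obj_simps(6))
    qed
  qed
qed

text \<open>An equality and not just an isomorphism, because \<open>N\<close> and the truncation are
  both \<open>undefined\<close> outside their range. It reflects that the counit of the adjunction
  is an identity.\<close>

lemma tr_cosk:
  assumes N: "chain_complex X {..m} N"
  shows "tr_obj m (cosk_obj X m N) = N"
proof -
  have "cobj (tr_obj m (cosk_obj X m N)) = cobj N"
    using chain_complexD(2)[OF N] by (auto simp: tr_obj_def cosk_obj_simps restrict_def)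
  moreover have "cdiff (tr_obj m (cosk_obj X m N)) = cdiff N"
    using chain_complexD(4)[OF N] by (auto simp: tr_obj_def cosk_obj_simps restrict_def)
  ultimately show ?thesis by simp
qed

text \<open>In degree \<open>m + 1\<close> a map into the coskeleton is determined by its composite
  with the monic kernel, hence by degree \<open>m\<close>; above that the target is zero.
  Functoriality, naturality and uniqueness thereby reduce to degrees up to \<open>m\<close>.\<close>

lemma cosk_hom_eqI:
  assumes N: "chain_complex X {..m} N" and f: "f \<in> hom (ch_on X UNIV) M (cosk_obj X m N)"
    and g: "g \<in> hom (ch_on X UNIV) M (cosk_obj X m N)"
    and eq: "\<And>i. i \<le> m \<Longrightarrow> ccomp f i = ccomp g i"
  shows "f = g"
proof (rule ch_on_eqI[OF f g])
  fix i
  show "ccomp f i = ccomp g i"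
  proof (cases rule: degree_cases[of i m])
    case 2
    note k = kerD[OF le_diff[OF N order_refl]]
    have h: "ccomp f (m + 1) \<in> hom X (cobj M (m + 1)) (Ker X (cdiff N m))"
      "ccomp g (m + 1) \<in> hom X (cobj M (m + 1)) (Ker X (cdiff N m))"
      using cmor_comp[OF f, of "m + 1"] cmor_comp[OF g, of "m + 1"] by (simp_all add: cosk_obj_simps)
    have "ker X (cdiff N m) \<cdot> ccomp f (m + 1) = ker X (cdiff N m) \<cdot> ccomp g (m + 1)"
      using cmor_comm[OF f, of "m + 1"] cmor_comm[OF g, of "m + 1"] eq by (simp add: cosk_obj_simps)
    then show ?thesis using monicD[OF k(3,1) h] 2 by simp
  next
    case 3
    then have "is_zero X (cobj (cosk_obj X m N) i)" using is_zero_zero_of by (simp add: cosk_obj_simps)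
    from to_zero[OF this cmor_comp[OF f]] to_zero[OF this cmor_comp[OF g]] show ?thesis by simp
  qed (rule eq)
qed

text \<open>The transpose of a chain map \<open>tr M \<rightarrow> N\<close> with components \<open>c\<close>; for \<open>M = cosk N'\<close> it is the
  action of \<open>cosk\<close> on a chain map \<open>N' \<rightarrow> N\<close>.\<close>

definition cosk_transpose :: "int \<Rightarrow> ('o, 'a) cplx \<Rightarrow> ('o, 'a) cplx \<Rightarrow> (int \<Rightarrow> 'a) \<Rightarrow> ('o, 'a) cmor" where
  "cosk_transpose m M N c = \<lparr>csrc = M, ctgt = cosk_obj X m N,
    ccomp = (\<lambda>i. if i \<le> m then c i
      else if i = m + 1 then lift X (ker X (cdiff N m)) (c m \<cdot> cdiff M (m + 1))
      else zero_arr X (cobj M i) (cobj (cosk_obj X m N) i))\<rparr>"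

text \<open>The lift in degree \<open>m + 1\<close> exists because
  \<open>cdiff N m \<cdot> (c m \<cdot> cdiff M (m + 1))\<close> can be rewritten with two
  consecutive differentials of \<open>M\<close>. Taking a bare family \<open>c\<close> lets the
  lemma serve both the unit and the action of \<open>cosk\<close> on morphisms.\<close>

lemma cosk_transpose_hom:
  assumes M: "chain_complex X UNIV M" and N: "chain_complex X {..m} N"
    and c: "\<And>i. i \<le> m \<Longrightarrow> c i \<in> hom X (cobj M i) (cobj N i)"
    and comm: "\<And>i. i \<le> m \<Longrightarrow> cdiff N i \<cdot> c i = c (i - 1) \<cdot> cdiff M i"
  shows "cosk_transpose m M N c \<in> hom (ch_on X UNIV) M (cosk_obj X m N)"
proof (rule cmorI[OF M cosk_obj_complex[OF N]])
  note C = cosk_obj_complex[OF N] and dN = le_diff[OF N order_refl]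
  have dM: "cdiff M (m + 1) \<in> hom X (cobj M (m + 1)) (cobj M m)" "cdiff M m \<in> hom X (cobj M m) (cobj M (m - 1))"
    using cplx_diff[OF M, of "m + 1"] cplx_diff[OF M, of m] by simp_all
  have c': "c (m - 1) \<in> hom X (cobj M (m - 1)) (cobj N (m - 1))" using c by simp
  have cd: "c m \<cdot> cdiff M (m + 1) \<in> hom X (cobj M (m + 1)) (cobj N m)" using Comp_hom[OF dM(1) c] by simp
  have "cdiff N m \<cdot> (c m \<cdot> cdiff M (m + 1)) = c (m - 1) \<cdot> (cdiff M m \<cdot> cdiff M (m + 1))"
    using Comp_assoc[OF dM(1) c dN] Comp_assoc[OF dM c'] comm by simp
  also have "\<dots> = zero_arr X (cobj M (m + 1)) (cobj N (m - 1))"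
    using comp_zero[OF c' cplx_obj[OF M]] cplx_diff_diff[OF M] by simp
  finally have z: "cdiff N m \<cdot> (c m \<cdot> cdiff M (m + 1)) = zero_arr X (cobj M (m + 1)) (cobj N (m - 1))" .
  note l = lift_ker[OF dN cd z]
  let ?t = "cosk_transpose m M N c"
  show h: "ccomp ?t i \<in> hom X (cobj M i) (cobj (cosk_obj X m N) i)" for i
    using l(1) c zero_arr_hom[OF cplx_obj[OF M, of i] cplx_obj[OF C, of i]]
    by (auto simp: cosk_transpose_def cosk_obj_simps)
  fix i
  show "cdiff (cosk_obj X m N) i \<cdot> ccomp ?t i = ccomp ?t (i - 1) \<cdot> cdiff M i"
  proof (cases rule: degree_cases[of i m])
    case 1 then show ?thesis using comm by (simp add: cosk_obj_simps cosk_transpose_def)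
  next
    case 2 then show ?thesis using l(2) by (simp add: cosk_obj_simps cosk_transpose_def)
  next
    case 3
    let ?K = "cosk_obj X m N"
    have left: "cdiff ?K i \<cdot> ccomp ?t i = zero_arr X (cobj M i) (cobj ?K (i - 1))"
      using 3 zero_comp[OF h cplx_obj[OF C]] by (simp add: cosk_obj_simps(6))
    show ?thesis
    proof (cases "i = m + 2")
      case True
      \<comment> \<open>In degree \<open>m + 2\<close> the square ends in the kernel object, which
        may be nonzero. It is checked after composing with the monic kernel, where two differentials
        of \<open>M\<close> meet.\<close>
      have i: "i - 1 = m + 1" "m + 1 + 1 = i" using True by simp_all
      have dMi: "cdiff M i \<in> hom X (cobj M i) (cobj M (m + 1))" using cplx_diff[OF M, of i] i by simp
      have lh: "lift X (ker X (cdiff N m)) (c m \<cdot> cdiff M (m + 1)) \<cdot> cdiff M i \<in> hom X (cobj M i) (Ker X (cdiff N m))"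
        using Comp_hom[OF dMi l(1)] .
      have "ker X (cdiff N m) \<cdot> (lift X (ker X (cdiff N m)) (c m \<cdot> cdiff M (m + 1)) \<cdot> cdiff M i)
          = c m \<cdot> (cdiff M (m + 1) \<cdot> cdiff M i)"
        using Comp_assoc[OF dMi l(1) kerD(1)[OF dN]] l(2) Comp_assoc[OF dMi dM(1) c] by simp
      also have "\<dots> = zero_arr X (cobj M i) (cobj N m)"
        using cplx_diff_diff[OF M, of "m + 1"] i comp_zero[OF c cplx_obj[OF M]] by simp
      finally have "lift X (ker X (cdiff N m)) (c m \<cdot> cdiff M (m + 1)) \<cdot> cdiff M i
          = zero_arr X (cobj M i) (Ker X (cdiff N m))"
        using monic_zeroD[OF kerD(3,1)[OF dN] lh] by blast
      then show ?thesis unfolding left i(1) by (simp add: cosk_transpose_def cosk_obj_simps)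
    next
      case False
      then have "i - 1 > m + 1" using 3 by simp
      then have "is_zero X (cobj ?K (i - 1))" using is_zero_zero_of by (simp add: cosk_obj_simps)
      from to_zero[OF this Comp_hom[OF cplx_diff[OF M] h]] left show ?thesis by simp
    qed
  qed
qed (simp_all add: cosk_transpose_def)

lemma ccomp_cosk_transpose [simp]: "i \<le> m \<Longrightarrow> ccomp (cosk_transpose m M N c) i = c i"
  by (simp add: cosk_transpose_def)

lemma Farr_cosk: "Farr (cosk X m) f = cosk_transpose m (cosk_obj X m (csrc f)) (ctgt f) (ccomp f)"
  unfolding cosk_def cosk_transpose_def by (auto simp: cosk_obj_def cosk_cobj_def)

lemma cosk_hom:
  assumes f: "f \<in> hom (ch_on X {..m}) M N"
  shows "Farr (cosk X m) f \<in> hom (ch_on X UNIV) (cosk_obj X m M) (cosk_obj X m N)"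
proof -
  note F = ch_on_homD[OF f]
  show ?thesis unfolding Farr_cosk F(1,2)
    by (rule cosk_transpose_hom[OF cosk_obj_complex[OF F(3)] F(4)])
      (use le_comp[OF f] le_comm[OF f] in \<open>simp_all add: cosk_obj_simps\<close>)
qed

lemma ccomp_cosk [simp]: "i \<le> m \<Longrightarrow> ccomp (Farr (cosk X m) f) i = ccomp f i"
  by (simp add: Farr_cosk)

lemma cosk_functor: "is_functor (ch_le X m) (ch X) (cosk X m)"
  unfolding is_functor_def ch_def ch_le_def
proof (intro conjI ballI impI)
  have Fobj: "Fobj (cosk X m) = cosk_obj X m" by (simp add: cosk_def)
  show "category (ch_on X UNIV)" "category (ch_on X {..m})" by (rule category_ch_on)+
  show "Fobj (cosk X m) A \<in> Obj (ch_on X UNIV)" if "A \<in> Obj (ch_on X {..m})" for A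
    using that cosk_obj_complex ch_on_Obj by (simp add: Fobj)
  show "Farr (cosk X m) f \<in> hom (ch_on X UNIV) (Fobj (cosk X m) (Dom (ch_on X {..m}) f))
      (Fobj (cosk X m) (Cod (ch_on X {..m}) f))" if "f \<in> Arr (ch_on X {..m})" for f
    using cosk_hom[OF ch.Arr_hom[OF that]] by (simp add: Fobj)
  show "Farr (cosk X m) (Ident (ch_on X {..m}) A) = Ident (ch_on X UNIV) (Fobj (cosk X m) A)"
    if "A \<in> Obj (ch_on X {..m})" for A
  proof -
    have A: "chain_complex X {..m} A" using that ch_on_Obj by blast
    show ?thesis unfolding Fobj
      by (rule cosk_hom_eqI[OF A cosk_hom[OF ch_on_Ident_hom[OF A]] ch_on_Ident_hom[OF cosk_obj_complex[OF A]]])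
        (simp add: cosk_obj_simps)
  qed
  fix f g assume f: "f \<in> Arr (ch_on X {..m})" and g: "g \<in> Arr (ch_on X {..m})"
    and e: "Dom (ch_on X {..m}) g = Cod (ch_on X {..m}) f"
  note fh = ch.Arr_hom[OF f] and gh = ch.Arr_hom[OF g, unfolded e]
  show "Farr (cosk X m) (g \<cdot>\<^bsub>ch_on X {..m}\<^esub> f) = Farr (cosk X m) g \<cdot>\<^bsub>ch_on X UNIV\<^esub> Farr (cosk X m) f"
    by (rule cosk_hom_eqI[OF ch_on_homD(4)[OF gh] cosk_hom[OF ch.Comp_hom[OF fh gh]]
          ch.Comp_hom[OF cosk_hom[OF fh] cosk_hom[OF gh]]]) simp
qed

text \<open>Transpose of the identity. In degree \<open>m + 1\<close> its component is
  \<open>cdiff M (m + 1)\<close> corestricted to the kernel of \<open>cdiff M m\<close>.\<close>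

definition cosk_unit :: "int \<Rightarrow> ('o, 'a) cplx \<Rightarrow> ('o, 'a) cmor" where
  "cosk_unit m M = cosk_transpose m M (tr_obj m M) (\<lambda>i. Ident X (cobj M i))"

lemma cosk_unit_hom:
  assumes M: "chain_complex X UNIV M"
  shows "cosk_unit m M \<in> hom (ch_on X UNIV) M (cosk_obj X m (tr_obj m M))"
  unfolding cosk_unit_def
  by (rule cosk_transpose_hom[OF M tr_obj_complex[OF M]])
    (simp_all add: tr_obj_def Ident_hom cplx_obj[OF M] Comp_Ident[OF cplx_diff[OF M]] Ident_Comp[OF cplx_diff[OF M]])

lemma ccomp_cosk_unit [simp]: "i \<le> m \<Longrightarrow> ccomp (cosk_unit m M) i = Ident X (cobj M i)"
  by (simp add: cosk_unit_def)

lemma tr_cosk_adjunction: "adjunction (ch X) (ch_le X m) (tr m) (cosk X m) (cosk_unit m)"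
  unfolding adjunction_def
proof (intro conjI ballI)
  show "is_functor (ch X) (ch_le X m) (tr m)" "is_functor (ch_le X m) (ch X) (cosk X m)"
    by (rule tr_functor cosk_functor)+
  have FT: "Fobj (tr m) = tr_obj m" and FC: "Fobj (cosk X m) = cosk_obj X m" by (simp_all add: tr_def cosk_def)
  show "nat_trans (ch X) (ch X) id_fctr (comp_fctr (cosk X m) (tr m)) (cosk_unit m)"
    unfolding nat_trans_def ch_def id_fctr_def comp_fctr_def
  proof (intro conjI ballI)
    fix A assume "A \<in> Obj (ch_on X UNIV)"
    then show "cosk_unit m A \<in> hom (ch_on X UNIV) (Fobj \<lparr>Fobj = \<lambda>A. A, Farr = \<lambda>f. f\<rparr> A)
        (Fobj \<lparr>Fobj = \<lambda>A. Fobj (cosk X m) (Fobj (tr m) A), Farr = \<lambda>f. Farr (cosk X m) (Farr (tr m) f)\<rparr> A)"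
      using cosk_unit_hom ch_on_Obj by (simp add: FT FC)
  next
    fix f assume "f \<in> Arr (ch_on X UNIV)"
    then obtain A B where AB: "Dom (ch_on X UNIV) f = A" "Cod (ch_on X UNIV) f = B"
      and f: "f \<in> hom (ch_on X UNIV) A B" using ch.Arr_hom by blast
    note F = ch_on_homD[OF f]
    have "Farr (cosk X m) (Farr (tr m) f) \<cdot>\<^bsub>ch_on X UNIV\<^esub> cosk_unit m A = cosk_unit m B \<cdot>\<^bsub>ch_on X UNIV\<^esub> f"
      by (rule cosk_hom_eqI[OF tr_obj_complex[OF F(4)] ch.Comp_hom[OF cosk_unit_hom[OF F(3)] cosk_hom[OF tr_hom[OF f]]]
            ch.Comp_hom[OF f cosk_unit_hom[OF F(4)]]])
        (simp add: Comp_Ident[OF cmor_comp[OF f]] Ident_Comp[OF cmor_comp[OF f]])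
    then show "Farr \<lparr>Fobj = \<lambda>A. Fobj (cosk X m) (Fobj (tr m) A), Farr = \<lambda>f. Farr (cosk X m) (Farr (tr m) f)\<rparr> f
        \<cdot>\<^bsub>ch_on X UNIV\<^esub> cosk_unit m (Dom (ch_on X UNIV) f)
      = cosk_unit m (Cod (ch_on X UNIV) f) \<cdot>\<^bsub>ch_on X UNIV\<^esub> Farr \<lparr>Fobj = \<lambda>A. A, Farr = \<lambda>f. f\<rparr> f"
      by (simp add: AB)
  qed
  fix M N f assume M: "M \<in> Obj (ch X)" and N: "N \<in> Obj (ch_le X m)" and f: "f \<in> hom (ch X) M (Fobj (cosk X m) N)"
  have M: "chain_complex X UNIV M" and N: "chain_complex X {..m} N"
    and f: "f \<in> hom (ch_on X UNIV) M (cosk_obj X m N)"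
    using M N f ch_on_Obj by (auto simp: ch_def ch_le_def FC)
  have fi: "ccomp f i \<in> hom X (cobj M i) (cobj N i)" if "i \<le> m" for i
    using cmor_comp[OF f, of i] that by (simp add: cosk_obj_simps)
  \<comment> \<open>Transposing back is restriction to the degrees up to \<open>m\<close>, where the
    coskeleton coincides with \<open>N\<close>.\<close>
  define g where "g = \<lparr>csrc = tr_obj m M, ctgt = N, ccomp = restrict (ccomp f) {..m}\<rparr>"
  have g: "g \<in> hom (ch_on X {..m}) (tr_obj m M) N"
  proof (rule ch_on_homI[OF tr_obj_complex[OF M] N])
    fix i assume "i \<in> {..m}" "i - 1 \<in> {..m}"
    then show "cdiff N i \<cdot> ccomp g i = ccomp g (i - 1) \<cdot> cdiff (tr_obj m M) i"
      using cmor_comm[OF f, of i] by (simp add: cosk_obj_simps g_def tr_obj_def)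
  qed (use fi in \<open>auto simp: g_def tr_obj_def\<close>)
  have gf: "Farr (cosk X m) g \<cdot>\<^bsub>ch_on X UNIV\<^esub> cosk_unit m M = f"
    by (rule cosk_hom_eqI[OF N ch.Comp_hom[OF cosk_unit_hom[OF M] cosk_hom[OF g]] f])
      (simp add: g_def Comp_Ident[OF fi])
  have "h = g" if h: "h \<in> hom (ch_on X {..m}) (tr_obj m M) N"
    and hf: "Farr (cosk X m) h \<cdot>\<^bsub>ch_on X UNIV\<^esub> cosk_unit m M = f" for h
  proof (rule ch_on_eqI[OF h g])
    fix i assume "i \<in> {..m}"
    then have i: "i \<le> m" by simp
    have hi: "ccomp h i \<in> hom X (cobj M i) (cobj N i)" using le_comp[OF h i] i by (simp add: tr_obj_def)
    have "ccomp h i \<cdot> Ident X (cobj M i) = ccomp f i" using arg_cong[OF hf, of "\<lambda>f. ccomp f i"] i by simp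
    then show "ccomp h i = ccomp g i" using i by (simp add: g_def Comp_Ident[OF hi])
  qed
  then show "\<exists>!g. g \<in> hom (ch_le X m) (Fobj (tr m) M) N \<and> Farr (cosk X m) g \<cdot>\<^bsub>ch X\<^esub> cosk_unit m M = f"
    unfolding ch_def ch_le_def FT using g gf by blast
qed

text \<open>Truncating a coskeleton returns the original complex, and the unit at a coskeleton is
  the identity. The universal property of the unit at \<open>cosk_obj X m A\<close> then says that
  \<open>cosk\<close> is bijective on hom-sets.\<close>

lemma cosk_full_faithful: "full_faithful (ch_le X m) (ch X) (cosk X m)"
  unfolding full_faithful_def
proof (intro ballI)
  fix A B assume "A \<in> Obj (ch_le X m)" "B \<in> Obj (ch_le X m)"
  then have A: "chain_complex X {..m} A" and B: "chain_complex X {..m} B"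
    using ch_on_Obj by (auto simp: ch_le_def)
  note CA = cosk_obj_complex[OF A]
  have "cosk_unit m (cosk_obj X m A) \<in> hom (ch_on X UNIV) (cosk_obj X m A) (cosk_obj X m A)"
    using cosk_unit_hom[OF CA, of m] by (simp add: tr_cosk[OF A])
  from cosk_hom_eqI[OF A this ch_on_Ident_hom[OF CA]]
  have unit: "cosk_unit m (cosk_obj X m A) = Ident (ch_on X UNIV) (cosk_obj X m A)" by simp
  have FT: "Fobj (tr m) = tr_obj m" and FC: "Fobj (cosk X m) = cosk_obj X m" by (simp_all add: tr_def cosk_def)
  have U: "\<exists>!g. g \<in> hom (ch_on X {..m}) A B \<and> Farr (cosk X m) g = f"
    if f: "f \<in> hom (ch_on X UNIV) (cosk_obj X m A) (cosk_obj X m B)" for f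
  proof -
    have o: "cosk_obj X m A \<in> Obj (ch_on X UNIV)" "B \<in> Obj (ch_on X {..m})" using CA B ch_on_Obj by blast+
    have "\<forall>M \<in> Obj (ch_on X UNIV). \<forall>N \<in> Obj (ch_on X {..m}). \<forall>f \<in> hom (ch_on X UNIV) M (cosk_obj X m N).
        \<exists>!g. g \<in> hom (ch_on X {..m}) (tr_obj m M) N \<and> Farr (cosk X m) g \<cdot>\<^bsub>ch_on X UNIV\<^esub> cosk_unit m M = f"
      using tr_cosk_adjunction[of m] unfolding adjunction_def ch_def ch_le_def FT FC by blast
    from this[rule_format, OF o f]
    have "\<exists>!g. g \<in> hom (ch_on X {..m}) A B \<and>
        Farr (cosk X m) g \<cdot>\<^bsub>ch_on X UNIV\<^esub> Ident (ch_on X UNIV) (cosk_obj X m A) = f"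
      unfolding unit tr_cosk[OF A] .
    then show ?thesis using ch.Comp_Ident[OF cosk_hom] by metis
  qed
  have "inj_on (Farr (cosk X m)) (hom (ch_on X {..m}) A B)"
    by (rule inj_onI) (use U cosk_hom in blast)
  moreover have "Farr (cosk X m) ` hom (ch_on X {..m}) A B
      = hom (ch_on X UNIV) (cosk_obj X m A) (cosk_obj X m B)"
  proof
    show "hom (ch_on X UNIV) (cosk_obj X m A) (cosk_obj X m B) \<subseteq> Farr (cosk X m) ` hom (ch_on X {..m}) A B"
      using U by blast
  qed (use cosk_hom in blast)
  ultimately show "bij_betw (Farr (cosk X m)) (hom (ch_le X m) A B)
      (hom (ch X) (Fobj (cosk X m) A) (Fobj (cosk X m) B))"
    unfolding bij_betw_def ch_def ch_le_def FC by blast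
qed

section \<open>Extension by zero\<close>

definition ext_obj :: "int \<Rightarrow> ('o, 'a) cplx \<Rightarrow> ('o, 'a) cplx" where
  "ext_obj m N = \<lparr>cobj = (\<lambda>i. if i \<le> m then cobj N i else zero_of X),
    cdiff = (\<lambda>i. if i \<le> m then cdiff N i
      else zero_arr X (zero_of X) (if i - 1 \<le> m then cobj N (i - 1) else zero_of X))\<rparr>"

text \<open>Transposes a map from \<open>N\<close> to \<open>tr_obj m M\<close>. The target
  \<open>M\<close> is a separate argument because the truncation does not remember its upper
  degrees.\<close>

definition ext_map :: "int \<Rightarrow> ('o, 'a) cplx \<Rightarrow> ('o, 'a) cplx \<Rightarrow> (int \<Rightarrow> 'a) \<Rightarrow> ('o, 'a) cmor" where
  "ext_map m N M c = \<lparr>csrc = ext_obj m N, ctgt = M,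
    ccomp = (\<lambda>i. if i \<le> m then c i else zero_arr X (zero_of X) (cobj M i))\<rparr>"

lemma ext_obj_simps:
  "i \<le> m \<Longrightarrow> cobj (ext_obj m N) i = cobj N i" "i > m \<Longrightarrow> cobj (ext_obj m N) i = zero_of X"
  "i \<le> m \<Longrightarrow> cdiff (ext_obj m N) i = cdiff N i"
  by (simp_all add: ext_obj_def)

lemma is_zero_ext_obj: "i > m \<Longrightarrow> is_zero X (cobj (ext_obj m N) i)"
  by (simp add: ext_obj_def is_zero_zero_of)

lemma ext_obj_complex:
  assumes N: "chain_complex X {..m} N"
  shows "chain_complex X UNIV (ext_obj m N)"
proof -
  have o: "cobj (ext_obj m N) i \<in> Obj X" for i
    using le_obj[OF N] by (simp add: ext_obj_def)
  have h: "cdiff (ext_obj m N) i \<in> hom X (cobj (ext_obj m N) i) (cobj (ext_obj m N) (i - 1))" for i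
    using le_diff[OF N] le_obj[OF N] zero_arr_hom by (simp add: ext_obj_def)
  show ?thesis
  proof (rule cplxI[OF o h])
    fix i
    show "cdiff (ext_obj m N) i \<cdot> cdiff (ext_obj m N) (i + 1)
      = zero_arr X (cobj (ext_obj m N) (i + 1)) (cobj (ext_obj m N) (i - 1))"
    proof (cases "i + 1 \<le> m")
      case True then show ?thesis using le_diff_diff[OF N] by (simp add: ext_obj_simps)
    next
      case False
      then have "is_zero X (cobj (ext_obj m N) (i + 1))" by (simp add: is_zero_ext_obj)
      moreover have "cdiff (ext_obj m N) (i + 1) \<in> hom X (cobj (ext_obj m N) (i + 1)) (cobj (ext_obj m N) i)"
        using h[of "i + 1"] by simp
      ultimately show ?thesis using from_zero Comp_hom h by blast
    qed
  qed
qed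

lemma tr_ext:
  assumes N: "chain_complex X {..m} N"
  shows "tr_obj m (ext_obj m N) = N"
proof -
  have "cobj (tr_obj m (ext_obj m N)) = cobj N"
    using chain_complexD(2)[OF N] by (auto simp: tr_obj_def ext_obj_simps restrict_def)
  moreover have "cdiff (tr_obj m (ext_obj m N)) = cdiff N"
    using chain_complexD(4)[OF N] by (auto simp: tr_obj_def ext_obj_simps restrict_def)
  ultimately show ?thesis by simp
qed

lemma ext_hom_eqI:
  assumes f: "f \<in> hom (ch_on X UNIV) (ext_obj m N) M" and g: "g \<in> hom (ch_on X UNIV) (ext_obj m N) M"
    and eq: "\<And>i. i \<le> m \<Longrightarrow> ccomp f i = ccomp g i"
  shows "f = g"
proof (rule ch_on_eqI[OF f g])
  fix i
  show "ccomp f i = ccomp g i"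
  proof (cases "i \<le> m")
    case False
    then have "is_zero X (cobj (ext_obj m N) i)" by (simp add: is_zero_ext_obj)
    from from_zero[OF this cmor_comp[OF f]] from_zero[OF this cmor_comp[OF g]] show ?thesis by simp
  qed (rule eq)
qed

lemma ext_map_hom:
  assumes M: "chain_complex X UNIV M" and f: "f \<in> hom (ch_on X {..m}) N (tr_obj m M)"
  shows "ext_map m N M (ccomp f) \<in> hom (ch_on X UNIV) (ext_obj m N) M"
proof -
  note C = ext_obj_complex[OF ch_on_homD(3)[OF f]]
  have fi: "ccomp f i \<in> hom X (cobj N i) (cobj M i)" if "i \<le> m" for i
    using le_comp[OF f that] that by (simp add: tr_obj_def)
  have h: "ccomp (ext_map m N M (ccomp f)) i \<in> hom X (cobj (ext_obj m N) i) (cobj M i)" for i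
    using fi zero_arr_hom cplx_obj[OF M] by (simp add: ext_map_def ext_obj_def)
  show ?thesis
  proof (rule cmorI[OF C M _ _ h])
    fix i
    show "cdiff M i \<cdot> ccomp (ext_map m N M (ccomp f)) i
      = ccomp (ext_map m N M (ccomp f)) (i - 1) \<cdot> cdiff (ext_obj m N) i"
    proof (cases "i \<le> m")
      case True then show ?thesis
        using le_comm[OF f] by (simp add: tr_obj_def ext_map_def ext_obj_simps)
    next
      case False
      then have "is_zero X (cobj (ext_obj m N) i)" by (simp add: is_zero_ext_obj)
      from from_zero[OF this Comp_hom[OF h cplx_diff[OF M]]] from_zero[OF this Comp_hom[OF cplx_diff[OF C] h]]
      show ?thesis by simp
    qed
  qed (simp_all add: ext_map_def)
qed

lemma ccomp_ext_map [simp]: "i \<le> m \<Longrightarrow> ccomp (ext_map m N M c) i = c i"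
  by (simp add: ext_map_def)

text \<open>Extension by zero is left adjoint to \<open>tr m\<close>, which therefore preserves all limits.\<close>

lemma tr_preserves_limits:
  assumes D: "is_functor J (ch X) D" and L: "limit_cone J (ch X) D A l"
  shows "limit_cone J (ch_le X m) (comp_fctr (tr m) D) (Fobj (tr m) A) (\<lambda>j. Farr (tr m) (l j))"
proof -
  have FT: "Fobj (comp_fctr (tr m) D) j = tr_obj m (Fobj D j)" "Farr (comp_fctr (tr m) D) u = Farr (tr m) (Farr D u)"
    "Fobj (tr m) A = tr_obj m A" for j u
    by (simp_all add: comp_fctr_def tr_def)
  have C: "cone J (ch_on X UNIV) D A l" using L unfolding limit_cone_def ch_def by blast
  then have A: "chain_complex X UNIV A" and l: "\<And>j. j \<in> Obj J \<Longrightarrow> l j \<in> hom (ch_on X UNIV) A (Fobj D j)"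
    and lu: "\<And>u. u \<in> Arr J \<Longrightarrow> Farr D u \<cdot>\<^bsub>ch_on X UNIV\<^esub> l (Dom J u) = l (Cod J u)"
    unfolding cone_def ch_on_Obj by simp_all
  have J: "category J" using D unfolding is_functor_def by blast
  have Du: "Farr D u \<in> hom (ch_on X UNIV) (Fobj D (Dom J u)) (Fobj D (Cod J u))" if "u \<in> Arr J" for u
    using D that unfolding is_functor_def ch_def by blast
  have Jo: "Dom J u \<in> Obj J" "Cod J u \<in> Obj J" if "u \<in> Arr J" for u
    using category.Dom_Obj[OF J that] category.Cod_Obj[OF J that] .
  have "cone J (ch_on X {..m}) (comp_fctr (tr m) D) (tr_obj m A) (\<lambda>j. Farr (tr m) (l j))"
    unfolding cone_def FT
  proof (intro conjI ballI)
    show "tr_obj m A \<in> Obj (ch_on X {..m})" using tr_obj_complex[OF A] ch_on_Obj by blast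
    show "Farr (tr m) (l j) \<in> hom (ch_on X {..m}) (tr_obj m A) (tr_obj m (Fobj D j))" if "j \<in> Obj J" for j
      using tr_hom[OF l[OF that]] .
    fix u assume u: "u \<in> Arr J"
    note l1 = l[OF Jo(1)[OF u]] and l2 = l[OF Jo(2)[OF u]]
    show "Farr (tr m) (Farr D u) \<cdot>\<^bsub>ch_on X {..m}\<^esub> Farr (tr m) (l (Dom J u)) = Farr (tr m) (l (Cod J u))"
    proof (rule ch_on_eqI[OF ch.Comp_hom[OF tr_hom[OF l1] tr_hom[OF Du[OF u]]] tr_hom[OF l2]])
      fix i assume "i \<in> {..m}"
      then show "ccomp (Farr (tr m) (Farr D u) \<cdot>\<^bsub>ch_on X {..m}\<^esub> Farr (tr m) (l (Dom J u))) i
          = ccomp (Farr (tr m) (l (Cod J u))) i"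
        using arg_cong[OF lu[OF u], of "\<lambda>f. ccomp f i"] by simp
    qed
  qed
  moreover have "\<exists>!h. h \<in> hom (ch_on X {..m}) B (tr_obj m A) \<and>
      (\<forall>j\<in>Obj J. Farr (tr m) (l j) \<cdot>\<^bsub>ch_on X {..m}\<^esub> h = k j)"
    if K: "cone J (ch_on X {..m}) (comp_fctr (tr m) D) B k" for B k
  proof -
    have B: "chain_complex X {..m} B"
      and k: "\<And>j. j \<in> Obj J \<Longrightarrow> k j \<in> hom (ch_on X {..m}) B (tr_obj m (Fobj D j))"
      and ku: "\<And>u. u \<in> Arr J \<Longrightarrow> Farr (tr m) (Farr D u) \<cdot>\<^bsub>ch_on X {..m}\<^esub> k (Dom J u) = k (Cod J u)"
      using K unfolding cone_def FT using ch_on_Obj by blast+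
    \<comment> \<open>A cone over the truncated diagram is transposed leg by leg to a cone over
      \<open>D\<close> whose vertex is the extension by zero.\<close>
    define k' where "k' = (\<lambda>j. ext_map m B (Fobj D j) (ccomp (k j)))"
    have k': "k' j \<in> hom (ch_on X UNIV) (ext_obj m B) (Fobj D j)" if "j \<in> Obj J" for j
      unfolding k'_def using ext_map_hom[OF ch_on_homD(4)[OF l[OF that]] k[OF that]] .
    have "cone J (ch_on X UNIV) D (ext_obj m B) k'"
      unfolding cone_def
    proof (intro conjI ballI)
      show "ext_obj m B \<in> Obj (ch_on X UNIV)" using ext_obj_complex[OF B] ch_on_Obj by blast
      show "k' j \<in> hom (ch_on X UNIV) (ext_obj m B) (Fobj D j)" if "j \<in> Obj J" for j using k'[OF that] .
      fix u assume u: "u \<in> Arr J"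
      show "Farr D u \<cdot>\<^bsub>ch_on X UNIV\<^esub> k' (Dom J u) = k' (Cod J u)"
      proof (rule ext_hom_eqI[OF ch.Comp_hom[OF k'[OF Jo(1)[OF u]] Du[OF u]] k'[OF Jo(2)[OF u]]])
        fix i assume "i \<le> m"
        then show "ccomp (Farr D u \<cdot>\<^bsub>ch_on X UNIV\<^esub> k' (Dom J u)) i = ccomp (k' (Cod J u)) i"
          using arg_cong[OF ku[OF u], of "\<lambda>f. ccomp f i"] by (simp add: k'_def)
      qed
    qed
    then obtain h where h: "h \<in> hom (ch_on X UNIV) (ext_obj m B) A"
      and hk: "\<And>j. j \<in> Obj J \<Longrightarrow> l j \<cdot>\<^bsub>ch_on X UNIV\<^esub> h = k' j"
      and hu: "\<And>g. \<lbrakk>g \<in> hom (ch_on X UNIV) (ext_obj m B) A; \<forall>j\<in>Obj J. l j \<cdot>\<^bsub>ch_on X UNIV\<^esub> g = k' j\<rbrakk> \<Longrightarrow> g = h"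
      using L unfolding limit_cone_def ch_def by metis
    have th: "Farr (tr m) h \<in> hom (ch_on X {..m}) B (tr_obj m A)"
      using tr_hom[OF h, of m] tr_ext[OF B] by simp
    show ?thesis
    proof (rule ex1I[of _ "Farr (tr m) h"], intro conjI ballI th)
      fix j assume j: "j \<in> Obj J"
      show "Farr (tr m) (l j) \<cdot>\<^bsub>ch_on X {..m}\<^esub> Farr (tr m) h = k j"
      proof (rule ch_on_eqI[OF ch.Comp_hom[OF th tr_hom[OF l[OF j]]] k[OF j]])
        fix i assume "i \<in> {..m}"
        then show "ccomp (Farr (tr m) (l j) \<cdot>\<^bsub>ch_on X {..m}\<^esub> Farr (tr m) h) i = ccomp (k j) i"
          using arg_cong[OF hk[OF j], of "\<lambda>f. ccomp f i"] by (simp add: k'_def)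
      qed
    next
      fix g assume "g \<in> hom (ch_on X {..m}) B (tr_obj m A) \<and>
        (\<forall>j\<in>Obj J. Farr (tr m) (l j) \<cdot>\<^bsub>ch_on X {..m}\<^esub> g = k j)"
      then have g: "g \<in> hom (ch_on X {..m}) B (tr_obj m A)"
        and gk: "\<And>j. j \<in> Obj J \<Longrightarrow> Farr (tr m) (l j) \<cdot>\<^bsub>ch_on X {..m}\<^esub> g = k j" by auto
      note eg = ext_map_hom[OF A g]
      \<comment> \<open>Uniqueness: transposing \<open>g\<close> gives a competitor for
        \<open>h\<close>.\<close>
      have "ext_map m B A (ccomp g) = h"
      proof (rule hu[OF eg], rule ballI)
        fix j assume j: "j \<in> Obj J"
        show "l j \<cdot>\<^bsub>ch_on X UNIV\<^esub> ext_map m B A (ccomp g) = k' j"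
        proof (rule ext_hom_eqI[OF ch.Comp_hom[OF eg l[OF j]] k'[OF j]])
          fix i assume "i \<le> m"
          then show "ccomp (l j \<cdot>\<^bsub>ch_on X UNIV\<^esub> ext_map m B A (ccomp g)) i = ccomp (k' j) i"
            using arg_cong[OF gk[OF j], of "\<lambda>f. ccomp f i"] by (simp add: k'_def)
        qed
      qed
      then show "g = Farr (tr m) h" by (intro ch_on_eqI[OF g th]) auto
    qed
  qed
  ultimately show ?thesis unfolding limit_cone_def ch_le_def FT by blast
qed

lemma tr_localization: "localization (ch X) (ch_le X m) (tr m) (cosk X m) (cosk_unit m)"
  unfolding localization_def preserves_finite_limits_def
  using tr_cosk_adjunction cosk_full_faithful tr_preserves_limits by blast

section \<open>The torsion class, and independence of the torsion-free class from the unit\<close>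

lemma ch_ge_obj_iff: "A \<in> ch_ge_obj X n \<longleftrightarrow> chain_complex X UNIV A \<and> (\<forall>i<n. is_zero X (cobj A i))"
  unfolding ch_ge_obj_def ch_def ch_on_Obj by auto

text \<open>A truncation isomorphic to a zero complex is itself zero, that is, zero in every degree
  up to \<open>n - 1\<close>. Since \<open>ch_ge_obj\<close> admits arbitrary zero objects, the two
  classes agree literally.\<close>

lemma loc_torsion_tr: "loc_torsion (ch X) (ch_le X (n - 1)) (tr (n - 1)) = ch_ge_obj X n"
proof -
  have "(\<exists>Z. is_zero (ch_on X {..n - 1}) Z \<and> isomorphic (ch_on X {..n - 1}) (tr_obj (n - 1) A) Z)
      \<longleftrightarrow> (\<forall>i<n. is_zero X (cobj A i))" if A: "chain_complex X UNIV A" for A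
  proof -
    note T = tr_obj_complex[OF A, of "n - 1"]
    then have TO: "tr_obj (n - 1) A \<in> Obj (ch_on X {..n - 1})" using ch_on_Obj by blast
    have "(\<exists>Z. is_zero (ch_on X {..n - 1}) Z \<and> isomorphic (ch_on X {..n - 1}) (tr_obj (n - 1) A) Z)
        \<longleftrightarrow> is_zero (ch_on X {..n - 1}) (tr_obj (n - 1) A)"
      using ch.is_zero_iso ch.isomorphic_sym ch.zero_isomorphic by blast
    also have "\<dots> \<longleftrightarrow> (\<forall>i<n. is_zero X (cobj A i))"
      unfolding is_zero_ch_on_iff[OF T] by (auto simp: tr_obj_def)
    finally show ?thesis .
  qed
  then show ?thesis
    unfolding loc_torsion_def ch_ge_obj_def ch_def ch_le_def by (auto simp: ch_on_Obj tr_def)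
qed

lemma loc_free_cosk_unit:
  assumes "localization (ch X) (ch_le X m) (tr m) (cosk X m) \<eta>"
  shows "loc_free (ch X) \<eta> = loc_free (ch X) (cosk_unit m)"
proof -
  have "adjunction (ch X) (ch_le X m) (tr m) (cosk X m) \<eta>" using assms unfolding localization_def by blast
  then show ?thesis
    using ch.loc_free_unit_cong[where I = UNIV] tr_cosk_adjunction[of m] unfolding ch_def by blast
qed

section \<open>The coreflector\<close>

lemma cot'_obj_simps:
  "i > n \<Longrightarrow> cobj (cot'_obj X n M) i = cobj M i" "cobj (cot'_obj X n M) n = Ker X (cdiff M n)"
  "i < n \<Longrightarrow> cobj (cot'_obj X n M) i = zero_of X"
  "i > n + 1 \<Longrightarrow> cdiff (cot'_obj X n M) i = cdiff M i"
  "cdiff (cot'_obj X n M) (n + 1) = lift X (ker X (cdiff M n)) (cdiff M (n + 1))"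
  "i \<le> n \<Longrightarrow> cdiff (cot'_obj X n M) i = zero_arr X (cobj (cot'_obj X n M) i) (cobj (cot'_obj X n M) (i - 1))"
  by (simp_all add: cot'_obj_def cot'_cobj_def)

lemma is_zero_cot'_obj: "i < n \<Longrightarrow> is_zero X (cobj (cot'_obj X n M) i)"
  by (simp add: cot'_obj_simps is_zero_zero_of)

text \<open>Counit of the coreflection, and later the torsion part of \<open>M\<close>. Being monic
  in each degree, it lets identities about \<open>cot'_obj\<close> be checked inside
  \<open>M\<close>.\<close>

definition cot_incl :: "int \<Rightarrow> ('o, 'a) cplx \<Rightarrow> ('o, 'a) cmor" where
  "cot_incl n M = \<lparr>csrc = cot'_obj X n M, ctgt = M,
    ccomp = (\<lambda>i. if i > n then Ident X (cobj M i) else if i = n then ker X (cdiff M n)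
      else zero_arr X (zero_of X) (cobj M i))\<rparr>"

lemma cot_incl_simps:
  "csrc (cot_incl n M) = cot'_obj X n M" "ctgt (cot_incl n M) = M"
  "i > n \<Longrightarrow> ccomp (cot_incl n M) i = Ident X (cobj M i)" "ccomp (cot_incl n M) n = ker X (cdiff M n)"
  "i < n \<Longrightarrow> ccomp (cot_incl n M) i = zero_arr X (zero_of X) (cobj M i)"
  by (simp_all add: cot_incl_def)

lemma cot'_complex:
  assumes M: "chain_complex X UNIV M"
  shows cot'_obj_complex: "chain_complex X UNIV (cot'_obj X n M)"
    and cot_incl_hom: "cot_incl n M \<in> hom (ch_on X UNIV) (cot'_obj X n M) M"
    and monic_cot_incl_comp: "monic X (ccomp (cot_incl n M) i)"
proof -
  let ?K = "cot'_obj X n M" and ?j = "ccomp (cot_incl n M)"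
  note d = cplx_diff[OF M] and O = cplx_obj[OF M]
  note k = kerD[OF d[of n]]
  have o: "cobj ?K i \<in> Obj X" for i
    by (cases rule: degree_trichotomy[of n i]) (simp_all add: cot'_obj_simps O Ker_Obj[OF d])
  have j: "?j i \<in> hom X (cobj ?K i) (cobj M i)" for i
    by (cases rule: degree_trichotomy[of n i])
      (simp_all add: cot'_obj_simps cot_incl_simps Ident_hom O k(1) zero_arr_hom)
  show mj: "monic X (?j i)" for i
    by (cases rule: degree_trichotomy[of n i])
      (simp_all add: cot_incl_simps monic_Ident O k(3) monic_from_zero[OF is_zero_zero_of zero_arr_hom])
  have d1: "cdiff M (n + 1) \<in> hom X (cobj M (n + 1)) (cobj M n)" using d[of "n + 1"] by simp
  note l = lift_ker[OF d d1 cplx_diff_diff[OF M]]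
  have h: "cdiff ?K i \<in> hom X (cobj ?K i) (cobj ?K (i - 1))" for i
  proof (cases rule: degree_cases[of i n])
    case 1 then show ?thesis using zero_arr_hom[OF o o] by (simp add: cot'_obj_simps(6))
  qed (use l(1) d in \<open>simp_all add: cot'_obj_simps\<close>)
  have comm: "cdiff M i \<cdot> ?j i = ?j (i - 1) \<cdot> cdiff ?K i" for i
  proof (cases rule: degree_cases[of i n])
    case 1
    have z: "cdiff M i \<cdot> ?j i = zero_arr X (cobj ?K i) (cobj M (i - 1))"
    proof (cases "i = n")
      case True then show ?thesis using k(2) by (simp add: cot'_obj_simps cot_incl_simps)
    next
      case False
      then have "i < n" using 1 by simp
      from from_zero[OF is_zero_cot'_obj[OF this] Comp_hom[OF j d]] show ?thesis .
    qed
    then show ?thesis using 1 comp_zero[OF j o] by (simp add: cot'_obj_simps(6))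
  next
    case 2 then show ?thesis using l(2) Comp_Ident[OF d1] by (simp add: cot'_obj_simps cot_incl_simps)
  next
    case 3 then show ?thesis using Comp_Ident[OF d] Ident_Comp[OF d] by (simp add: cot'_obj_simps cot_incl_simps)
  qed
  show C: "chain_complex X UNIV ?K"
  proof (rule cplxI[OF o h])
    fix i
    have h': "cdiff ?K (i + 1) \<in> hom X (cobj ?K (i + 1)) (cobj ?K i)"
      and d': "cdiff M (i + 1) \<in> hom X (cobj M (i + 1)) (cobj M i)" using h[of "i + 1"] d[of "i + 1"] by simp_all
    note dd = Comp_hom[OF h' h]
    \<comment> \<open>The complex condition is inherited from \<open>M\<close> by cancelling the
      monic component of the inclusion in degree \<open>i - 1\<close>.\<close>
    have "?j (i - 1) \<cdot> (cdiff ?K i \<cdot> cdiff ?K (i + 1)) = (cdiff M i \<cdot> ?j i) \<cdot> cdiff ?K (i + 1)"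
      using Comp_assoc[OF h' h j] comm by simp
    also have "\<dots> = (cdiff M i \<cdot> cdiff M (i + 1)) \<cdot> ?j (i + 1)"
      using Comp_assoc[OF h' j d] comm[of "i + 1"] Comp_assoc[OF j d' d] by simp
    also have "\<dots> = zero_arr X (cobj ?K (i + 1)) (cobj M (i - 1))"
      using cplx_diff_diff[OF M] zero_comp[OF j O] by simp
    finally show "cdiff ?K i \<cdot> cdiff ?K (i + 1) = zero_arr X (cobj ?K (i + 1)) (cobj ?K (i - 1))"
      using monic_zeroD[OF mj j dd] by blast
  qed
  show "cot_incl n M \<in> hom (ch_on X UNIV) ?K M"
    by (rule cmorI[OF C M _ _ j comm]) (simp_all add: cot_incl_simps)
qed

lemma monic_cot_incl: "chain_complex X UNIV M \<Longrightarrow> monic (ch_on X UNIV) (cot_incl n M)"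
  using monic_ch_onI cot_incl_hom monic_cot_incl_comp by blast

lemma cot'_obj_ge: "chain_complex X UNIV M \<Longrightarrow> cot'_obj X n M \<in> ch_ge_obj X n"
  unfolding ch_ge_obj_iff using cot'_obj_complex is_zero_cot'_obj by blast

definition cot_transpose :: "int \<Rightarrow> ('o, 'a) cplx \<Rightarrow> ('o, 'a) cplx \<Rightarrow> (int \<Rightarrow> 'a) \<Rightarrow> ('o, 'a) cmor" where
  "cot_transpose n A M c = \<lparr>csrc = A, ctgt = cot'_obj X n M,
    ccomp = (\<lambda>i. if i > n then c i else if i = n then lift X (ker X (cdiff M n)) (c n)
      else zero_arr X (cobj A i) (cobj (cot'_obj X n M) i))\<rparr>"

text \<open>The composite \<open>cdiff M n \<cdot> ccomp f n\<close> passes through degree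
  \<open>n - 1\<close> of \<open>A\<close>, a zero object, so the component of \<open>f\<close> in
  degree \<open>n\<close> factors through the kernel.\<close>

lemma cot_transpose:
  assumes A: "A \<in> ch_ge_obj X n" and f: "f \<in> hom (ch_on X UNIV) A M"
  shows cot_transpose_hom: "cot_transpose n A M (ccomp f) \<in> hom (ch_on X UNIV) A (cot'_obj X n M)"
    and cot_incl_transpose: "cot_incl n M \<cdot>\<^bsub>ch_on X UNIV\<^esub> cot_transpose n A M (ccomp f) = f"
proof -
  let ?K = "cot'_obj X n M" and ?j = "ccomp (cot_incl n M)" and ?t = "cot_transpose n A M (ccomp f)"
  have AC: "chain_complex X UNIV A" and Az: "\<And>i. i < n \<Longrightarrow> is_zero X (cobj A i)"
    using A unfolding ch_ge_obj_iff by auto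
  note M = ch_on_homD(4)[OF f] and fc = cmor_comp[OF f] and fm = cmor_comm[OF f]
  note K = cot'_obj_complex[OF M, of n] and j = cmor_comp[OF cot_incl_hom[OF M, of n]]
    and jm = cmor_comm[OF cot_incl_hom[OF M, of n]]
  have "ccomp f (n - 1) \<cdot> cdiff A n = zero_arr X (cobj A n) (cobj M (n - 1))"
    using from_zero[OF Az fc] zero_comp[OF cplx_diff[OF AC] cplx_obj[OF M]] by simp
  then have "cdiff M n \<cdot> ccomp f n = zero_arr X (cobj A n) (cobj M (n - 1))" using fm by simp
  note l = lift_ker[OF cplx_diff[OF M] fc this]
  have t: "ccomp ?t i \<in> hom X (cobj A i) (cobj ?K i)" for i
    by (cases rule: degree_trichotomy[of n i])
      (use l(1) fc zero_arr_hom cplx_obj[OF AC] in \<open>simp_all add: cot_transpose_def cot'_obj_simps\<close>)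
  have jt: "?j i \<cdot> ccomp ?t i = ccomp f i" for i
  proof (cases rule: degree_trichotomy[of n i])
    case 3
    from from_zero[OF Az[OF 3] Comp_hom[OF t j]] from_zero[OF Az[OF 3] fc] show ?thesis by simp
  qed (use l(2) Ident_Comp[OF fc] in \<open>simp_all add: cot_transpose_def cot_incl_simps\<close>)
  show h: "?t \<in> hom (ch_on X UNIV) A ?K"
  proof (rule cmorI[OF AC K _ _ t])
    fix i
    note dA = cplx_diff[OF AC, of i] and dK = cplx_diff[OF K, of i] and dM = cplx_diff[OF M, of i]
    have "?j (i - 1) \<cdot> (cdiff ?K i \<cdot> ccomp ?t i) = cdiff M i \<cdot> (?j i \<cdot> ccomp ?t i)"
      using Comp_assoc[OF t dK j] Comp_assoc[OF t j dM] jm by simp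
    also have "\<dots> = ?j (i - 1) \<cdot> (ccomp ?t (i - 1) \<cdot> cdiff A i)"
      using Comp_assoc[OF dA t j] jt fm by simp
    finally show "cdiff ?K i \<cdot> ccomp ?t i = ccomp ?t (i - 1) \<cdot> cdiff A i"
      using monicD[OF monic_cot_incl_comp[OF M] j Comp_hom[OF t dK] Comp_hom[OF dA t]] by blast
  qed (simp_all add: cot_transpose_def)
  show "cot_incl n M \<cdot>\<^bsub>ch_on X UNIV\<^esub> ?t = f"
    by (rule ch_on_eqI[OF ch.Comp_hom[OF h cot_incl_hom[OF M]] f]) (simp add: jt)
qed

lemma cot_hom_eqI:
  assumes "f \<in> hom (ch_on X UNIV) A (cot'_obj X n M)" "g \<in> hom (ch_on X UNIV) A (cot'_obj X n M)"
    and "chain_complex X UNIV M"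
    and "cot_incl n M \<cdot>\<^bsub>ch_on X UNIV\<^esub> f = cot_incl n M \<cdot>\<^bsub>ch_on X UNIV\<^esub> g"
  shows "f = g"
  using ch.monicD[OF monic_cot_incl cot_incl_hom] assms by blast

text \<open>Presents the action of \<open>cot'\<close> as the transpose of \<open>f\<close>
  restricted along \<open>cot_incl\<close>, so that functoriality and naturality follow by
  cancelling the inclusion.\<close>

lemma Farr_cot':
  assumes f: "f \<in> hom (ch_on X UNIV) M N"
  shows "Farr (cot' X n) f = cot_transpose n (cot'_obj X n M) N (ccomp (f \<cdot>\<^bsub>ch_on X UNIV\<^esub> cot_incl n M))"
proof -
  have "Farr (cot' X n) f = \<lparr>csrc = cot'_obj X n M, ctgt = cot'_obj X n N, ccomp = (\<lambda>i. if i > n then ccomp f i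
      else if i = n then lift X (ker X (cdiff N n)) (ccomp f n \<cdot> ker X (cdiff M n))
      else zero_arr X (cobj (cot'_obj X n M) i) (cobj (cot'_obj X n N) i))\<rparr>"
    unfolding cot'_def fctr.simps ch_on_homD(1,2)[OF f] by (auto simp: cot'_obj_def)
  then show ?thesis
    unfolding cot_transpose_def by (auto simp: cot_incl_simps Comp_Ident[OF cmor_comp[OF f]])
qed

lemma cot'_hom:
  assumes f: "f \<in> hom (ch_on X UNIV) M N"
  shows "Farr (cot' X n) f \<in> hom (ch_on X UNIV) (cot'_obj X n M) (cot'_obj X n N)"
    and "cot_incl n N \<cdot>\<^bsub>ch_on X UNIV\<^esub> Farr (cot' X n) f = f \<cdot>\<^bsub>ch_on X UNIV\<^esub> cot_incl n M"
  unfolding Farr_cot'[OF f]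
  using cot_transpose[OF cot'_obj_ge ch.Comp_hom[OF cot_incl_hom f]] ch_on_homD(3)[OF f] by blast+

lemma cot'_coreflector: "coreflector (ch X) (ch_ge_obj X n) (cot' X n)"
  unfolding coreflector_def adjunction_def ch_def
proof (intro exI conjI ballI)
  let ?C = "ch_on X UNIV" and ?S = "ch_ge_obj X n"
  let ?F = "full_subcat ?C ?S"
  \<comment> \<open>The unit at \<open>A\<close> transposes the identity and is therefore a right
    inverse of the monic \<open>cot_incl n A\<close>.\<close>
  let ?\<eta> = "\<lambda>A. cot_transpose n A A (ccomp (Ident ?C A))"
  have FC: "Fobj (cot' X n) = cot'_obj X n" by (simp add: cot'_def)
  show "is_functor ?F ?C id_fctr"
    unfolding is_functor_def
  proof (intro conjI ballI impI)
    show "category ?F" by (rule category_full_subcat[OF category_ch_on])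
    show "category ?C" by (rule category_ch_on)
  qed (auto simp: id_fctr_def full_subcat_simps intro: ch.Arr_hom)
  show "is_functor ?C ?F (cot' X n)"
    unfolding is_functor_def
  proof (intro conjI ballI impI)
    show "category ?F" by (rule category_full_subcat[OF category_ch_on])
    show "category ?C" by (rule category_ch_on)
    show "Fobj (cot' X n) A \<in> Obj ?F" if "A \<in> Obj ?C" for A
      using that cot'_obj_complex cot'_obj_ge by (simp add: FC full_subcat_simps ch_on_Obj)
    show "Farr (cot' X n) f \<in> hom ?F (Fobj (cot' X n) (Dom ?C f)) (Fobj (cot' X n) (Cod ?C f))"
      if "f \<in> Arr ?C" for f
      unfolding FC full_subcat_hom
      using cot'_hom(1)[OF ch.Arr_hom[OF that]] cot'_obj_ge ch_on_homD(3,4)[OF ch.Arr_hom[OF that]] by blast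
    show "Farr (cot' X n) (Ident ?C A) = Ident ?F (Fobj (cot' X n) A)" if "A \<in> Obj ?C" for A
    proof -
      have A: "chain_complex X UNIV A" using that ch_on_Obj by blast
      note I = ch_on_Ident_hom[OF A] and I' = ch_on_Ident_hom[OF cot'_obj_complex[OF A]]
      show ?thesis unfolding FC full_subcat_simps
        by (rule cot_hom_eqI[OF cot'_hom(1)[OF I] I' A])
          (simp add: cot'_hom(2)[OF I] ch.Comp_Ident[OF cot_incl_hom[OF A]] ch.Ident_Comp[OF cot_incl_hom[OF A]])
    qed
    fix f g assume f: "f \<in> Arr ?C" and g: "g \<in> Arr ?C" and e: "Dom ?C g = Cod ?C f"
    note fh = ch.Arr_hom[OF f] and gh = ch.Arr_hom[OF g, unfolded e]
    note A = ch_on_homD(3)[OF fh] and B = ch_on_homD(4)[OF fh] and D = ch_on_homD(4)[OF gh]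
    note iA = cot_incl_hom[OF A, of n] and iB = cot_incl_hom[OF B, of n] and iD = cot_incl_hom[OF D, of n]
    show "Farr (cot' X n) (g \<cdot>\<^bsub>?C\<^esub> f) = Farr (cot' X n) g \<cdot>\<^bsub>?F\<^esub> Farr (cot' X n) f"
      unfolding full_subcat_simps
    proof (rule cot_hom_eqI[OF cot'_hom(1)[OF ch.Comp_hom[OF fh gh]] ch.Comp_hom[OF cot'_hom(1)[OF fh] cot'_hom(1)[OF gh]] D])
      show "cot_incl n (Cod ?C g) \<cdot>\<^bsub>?C\<^esub> Farr (cot' X n) (g \<cdot>\<^bsub>?C\<^esub> f)
        = cot_incl n (Cod ?C g) \<cdot>\<^bsub>?C\<^esub> (Farr (cot' X n) g \<cdot>\<^bsub>?C\<^esub> Farr (cot' X n) f)"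
        using cot'_hom(2)[OF ch.Comp_hom[OF fh gh], of n] cot'_hom(2)[OF fh, of n] cot'_hom(2)[OF gh, of n]
          ch.Comp_assoc[OF iA fh gh] ch.Comp_assoc[OF cot'_hom(1)[OF fh] iB gh]
          ch.Comp_assoc[OF cot'_hom(1)[OF fh] cot'_hom(1)[OF gh] iD] by simp
    qed
  qed
  have \<eta>: "?\<eta> A \<in> hom ?C A (cot'_obj X n A)" "cot_incl n A \<cdot>\<^bsub>?C\<^esub> ?\<eta> A = Ident ?C A" if A: "A \<in> ?S" for A
    using cot_transpose[OF A ch_on_Ident_hom] A unfolding ch_ge_obj_iff by blast+
  show "nat_trans ?F ?F id_fctr (comp_fctr (cot' X n) id_fctr) ?\<eta>"
    unfolding nat_trans_def
  proof (intro conjI ballI)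
    show "?\<eta> A \<in> hom ?F (Fobj id_fctr A) (Fobj (comp_fctr (cot' X n) id_fctr) A)" if "A \<in> Obj ?F" for A
    proof -
      have A: "A \<in> ?S" using that by (simp add: full_subcat_simps)
      then show ?thesis using \<eta>(1)[OF A] cot'_obj_ge unfolding full_subcat_hom ch_ge_obj_iff
        by (simp add: FC id_fctr_def comp_fctr_def ch_ge_obj_iff)
    qed
    fix f assume "f \<in> Arr ?F"
    then have f: "f \<in> hom ?C (Dom ?C f) (Cod ?C f)" and A: "Dom ?C f \<in> ?S" and B: "Cod ?C f \<in> ?S"
      by (auto simp: full_subcat_simps intro: ch.Arr_hom)
    have AC: "chain_complex X UNIV (Dom ?C f)" and BC: "chain_complex X UNIV (Cod ?C f)"
      using A B unfolding ch_ge_obj_iff by auto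
    note iA = cot_incl_hom[OF AC, of n] and iB = cot_incl_hom[OF BC, of n]
    have "Farr (cot' X n) f \<cdot>\<^bsub>?C\<^esub> ?\<eta> (Dom ?C f) = ?\<eta> (Cod ?C f) \<cdot>\<^bsub>?C\<^esub> f"
    proof (rule cot_hom_eqI[OF ch.Comp_hom[OF \<eta>(1)[OF A] cot'_hom(1)[OF f]] ch.Comp_hom[OF f \<eta>(1)[OF B]] BC])
      show "cot_incl n (Cod ?C f) \<cdot>\<^bsub>?C\<^esub> (Farr (cot' X n) f \<cdot>\<^bsub>?C\<^esub> ?\<eta> (Dom ?C f))
        = cot_incl n (Cod ?C f) \<cdot>\<^bsub>?C\<^esub> (?\<eta> (Cod ?C f) \<cdot>\<^bsub>?C\<^esub> f)"
        using ch.Comp_assoc[OF \<eta>(1)[OF A] cot'_hom(1)[OF f] iB] cot'_hom(2)[OF f, of n]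
          ch.Comp_assoc[OF \<eta>(1)[OF A] iA f] \<eta>(2)[OF A] ch.Comp_assoc[OF f \<eta>(1)[OF B] iB] \<eta>(2)[OF B]
          ch.Comp_Ident[OF f] ch.Ident_Comp[OF f] by simp
    qed
    then show "Farr (comp_fctr (cot' X n) id_fctr) f \<cdot>\<^bsub>?F\<^esub> ?\<eta> (Dom ?F f) = ?\<eta> (Cod ?F f) \<cdot>\<^bsub>?F\<^esub> Farr id_fctr f"
      by (simp add: comp_fctr_def id_fctr_def full_subcat_simps)
  qed
  fix A B f assume "A \<in> Obj ?F" "B \<in> Obj ?C" "f \<in> hom ?F A (Fobj (cot' X n) B)"
  then have A: "A \<in> ?S" and B: "chain_complex X UNIV B" and f: "f \<in> hom ?C A (cot'_obj X n B)"
    unfolding full_subcat_hom full_subcat_simps ch_on_Obj FC by auto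
  have AC: "chain_complex X UNIV A" using A unfolding ch_ge_obj_iff by auto
  note iA = cot_incl_hom[OF AC, of n] and iB = cot_incl_hom[OF B, of n]
  \<comment> \<open>Composing a transposed map with \<open>cot_incl\<close> recovers
    \<open>g\<close>. This yields both that the \<open>g\<close> defined below is sent to
    \<open>f\<close> and that it is the only such map.\<close>
  have transpose: "cot_incl n B \<cdot>\<^bsub>?C\<^esub> (Farr (cot' X n) g \<cdot>\<^bsub>?C\<^esub> ?\<eta> A) = g" if g: "g \<in> hom ?C A B" for g
    using ch.Comp_assoc[OF \<eta>(1)[OF A] cot'_hom(1)[OF g] iB] cot'_hom(2)[OF g, of n]
      ch.Comp_assoc[OF \<eta>(1)[OF A] iA g] \<eta>(2)[OF A] ch.Comp_Ident[OF g] by simp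
  define g where "g = cot_incl n B \<cdot>\<^bsub>?C\<^esub> f"
  have g: "g \<in> hom ?C A B" unfolding g_def using ch.Comp_hom[OF f iB] .
  have gf: "Farr (cot' X n) g \<cdot>\<^bsub>?C\<^esub> ?\<eta> A = f"
  proof (rule cot_hom_eqI[OF ch.Comp_hom[OF \<eta>(1)[OF A] cot'_hom(1)[OF g]] f B])
    show "cot_incl n B \<cdot>\<^bsub>?C\<^esub> (Farr (cot' X n) g \<cdot>\<^bsub>?C\<^esub> ?\<eta> A) = cot_incl n B \<cdot>\<^bsub>?C\<^esub> f"
      unfolding transpose[OF g] by (rule g_def)
  qed
  have "h = g" if h: "h \<in> hom ?C A B" "Farr (cot' X n) h \<cdot>\<^bsub>?C\<^esub> ?\<eta> A = f" for h
    using transpose[OF h(1)] h(2) g_def by simp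
  then have "\<exists>!g. g \<in> hom ?C A B \<and> Farr (cot' X n) g \<cdot>\<^bsub>?C\<^esub> ?\<eta> A = f" using g gf by blast
  then show "\<exists>!g. g \<in> hom ?C (Fobj id_fctr A) B \<and> Farr (cot' X n) g \<cdot>\<^bsub>?F\<^esub> ?\<eta> A = f"
    by (simp add: id_fctr_def full_subcat_simps)
qed

section \<open>Torsion theories\<close>

text \<open>The unit annihilates \<open>cot_incl\<close>, so when it is monic
  \<open>cot_incl\<close> is zero. Its components then give the claim: an identity that vanishes in
  degrees above \<open>n\<close>, a vanishing kernel of \<open>cdiff A n\<close> in degree
  \<open>n\<close>.\<close>

lemma loc_free_cosk_unit_iff:
  assumes A: "chain_complex X UNIV A"
  shows "monic (ch_on X UNIV) (cosk_unit (n - 1) A)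
    \<longleftrightarrow> monic X (cdiff A n) \<and> (\<forall>i>n. is_zero X (cobj A i))"
proof
  let ?u = "cosk_unit (n - 1) A" and ?C = "cosk_obj X (n - 1) (tr_obj (n - 1) A)"
  note u = cosk_unit_hom[OF A, of "n - 1"] and T = tr_obj_complex[OF A, of "n - 1"]
  note j = cot_incl_hom[OF A, of n]
  {
    assume m: "monic (ch_on X UNIV) ?u"
    have o: "cot'_obj X n A \<in> Obj (ch_on X UNIV)" "?C \<in> Obj (ch_on X UNIV)"
      using ch.homD[OF j] ch.homD[OF u] by blast+
    \<comment> \<open>The source of the composite is zero in all degrees below \<open>n\<close>, and
      these degrees determine maps into this coskeleton.\<close>
    have "?u \<cdot>\<^bsub>ch_on X UNIV\<^esub> cot_incl n A = zero_arr (ch_on X UNIV) (cot'_obj X n A) ?C"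
    proof (rule cosk_hom_eqI[OF T ch.Comp_hom[OF j u] ch.zero_arr_hom[OF o]])
      fix i assume "i \<le> n - 1"
      then have z: "is_zero X (cobj (cot'_obj X n A) i)" by (simp add: is_zero_cot'_obj)
      show "ccomp (?u \<cdot>\<^bsub>ch_on X UNIV\<^esub> cot_incl n A) i
          = ccomp (zero_arr (ch_on X UNIV) (cot'_obj X n A) ?C) i"
        using from_zero[OF z cmor_comp[OF ch.Comp_hom[OF j u]]]
          from_zero[OF z cmor_comp[OF ch.zero_arr_hom[OF o]]] by simp
    qed
    from ch.monic_zeroD[OF m u j this]
    have "cot_incl n A = zero_arr (ch_on X UNIV) (cot'_obj X n A) A" .
    then have z: "ccomp (cot_incl n A) i = zero_arr X (cobj (cot'_obj X n A) i) (cobj A i)" for i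
      using ccomp_zero_arr[OF cot'_obj_complex[OF A] A UNIV_I] by simp
    have "is_zero X (cobj A i)" if "i > n" for i
      using z[of i] that is_zero_iff[OF cplx_obj[OF A]] by (simp add: cot_incl_simps cot'_obj_simps)
    moreover have "monic X (cdiff A n)"
    proof (rule monic_if_trivial_kernel[OF cplx_diff[OF A]])
      fix T t assume "t \<in> hom X T (cobj A n)" "cdiff A n \<cdot> t = zero_arr X T (cobj A (n - 1))"
      from kerD(4)[OF cplx_diff[OF A] this] obtain v where
        v: "v \<in> hom X T (Ker X (cdiff A n))" "ker X (cdiff A n) \<cdot> v = t" by blast
      then show "t = zero_arr X T (cobj A n)"
        using z[of n] zero_comp[OF v(1) cplx_obj[OF A]] by (simp add: cot_incl_simps cot'_obj_simps)
    qed
    ultimately show "monic X (cdiff A n) \<and> (\<forall>i>n. is_zero X (cobj A i))" by blast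
  next
    assume m: "monic X (cdiff A n) \<and> (\<forall>i>n. is_zero X (cobj A i))"
    show "monic (ch_on X UNIV) ?u"
    proof (rule monic_ch_onI[OF u])
      fix i
      show "monic X (ccomp ?u i)"
      proof (cases rule: degree_trichotomy[of n i])
        case 1 then show ?thesis using m monic_from_zero cmor_comp[OF u] by blast
      next
        case 2
        \<comment> \<open>Commutation in degree \<open>n\<close> exhibits \<open>cdiff A n\<close>
          as a composite whose first factor is the component of the unit, which is therefore
          monic.\<close>
        have "cdiff ?C n \<cdot> ccomp ?u n = ccomp ?u (n - 1) \<cdot> cdiff A n" using cmor_comm[OF u] .
        then have "cdiff ?C n \<cdot> ccomp ?u n = cdiff A n" using Ident_Comp[OF cplx_diff[OF A]] by simp
        then show ?thesis
          using monic_cancel[OF cmor_comp[OF u] cplx_diff[OF cosk_obj_complex[OF T]]] m 2 by metis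
      next
        case 3 then show ?thesis using monic_Ident cplx_obj[OF A] by simp
      qed
    qed
  }
qed

lemma loc_free_iff:
  "A \<in> loc_free (ch X) (cosk_unit (n - 1))
    \<longleftrightarrow> chain_complex X UNIV A \<and> monic X (cdiff A n) \<and> (\<forall>i>n. is_zero X (cobj A i))"
  unfolding loc_free_def ch_def using loc_free_cosk_unit_iff ch_on_Obj by auto

text \<open>Only degree \<open>n\<close> involves the image factorization; in the other degrees the
  sequence is degenerate. The conclusions about \<open>e\<close> and about the unchanged
  differentials are exported for the later proof that \<open>Q\<close> is proper when
  \<open>A\<close> is.\<close>

lemma torsion_sequence:
  assumes A: "chain_complex X UNIV A"
  obtains Q q e where "q \<in> hom (ch_on X UNIV) A Q" "short_exact (ch_on X UNIV) (cot_incl n A) q"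
    "monic X (cdiff Q n)" "\<And>i. i > n \<Longrightarrow> is_zero X (cobj Q i)" "\<And>i. i < n \<Longrightarrow> cdiff Q i = cdiff A i"
    "normal_epi X e" "e \<in> hom X (cobj A n) (cobj Q n)" "cdiff Q n \<cdot> e = cdiff A n"
proof -
  note d = cplx_diff[OF A] and O = cplx_obj[OF A] and j = cot_incl_hom[OF A, of n]
  note k = kerD[OF d[of n]]
  obtain I e m where e: "e \<in> hom X (cobj A n) I" and m: "m \<in> hom X I (cobj A (n - 1))" "m \<cdot> e = cdiff A n"
    "monic X m" and coker: "is_cokernel X (ker X (cdiff A n)) e"
    using image_factorization[OF d ker_is_kernel[OF d]] .
  have I: "I \<in> Obj X" using e homD by blast
  have ne: "normal_epi X e" using coker unfolding normal_epi_def by blast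
  define ob where "ob = (\<lambda>i. if i < n then cobj A i else if i = n then I else zero_of X)"
  have oo: "ob i \<in> Obj X" for i using O I by (simp add: ob_def)
  define Q where "Q = \<lparr>cobj = ob, cdiff = (\<lambda>i. if i < n then cdiff A i else if i = n then m
    else zero_arr X (ob i) (ob (i - 1)))\<rparr>"
  define q where "q = \<lparr>csrc = A, ctgt = Q, ccomp = (\<lambda>i. if i < n then Ident X (cobj A i) else if i = n then e
    else zero_arr X (cobj A i) (zero_of X))\<rparr>"
  have Q_simps: "i < n \<Longrightarrow> cobj Q i = cobj A i" "cobj Q n = I" "i > n \<Longrightarrow> cobj Q i = zero_of X"
    "i < n \<Longrightarrow> cdiff Q i = cdiff A i" "cdiff Q n = m" "i > n \<Longrightarrow> cdiff Q i = zero_arr X (cobj Q i) (cobj Q (i - 1))" for i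
    by (simp_all add: Q_def ob_def)
  have q_simps: "i < n \<Longrightarrow> ccomp q i = Ident X (cobj A i)" "ccomp q n = e"
    "i > n \<Longrightarrow> ccomp q i = zero_arr X (cobj A i) (zero_of X)" for i
    by (simp_all add: q_def)
  have zQ: "is_zero X (cobj Q i)" if "i > n" for i using that is_zero_zero_of by (simp add: Q_simps)
  have QO: "cobj Q i \<in> Obj X" for i using oo by (simp add: Q_def)
  have Qd: "cdiff Q i \<in> hom X (cobj Q i) (cobj Q (i - 1))" for i
    by (cases rule: degree_trichotomy[of n i]) (use d m(1) zero_arr_hom QO in \<open>simp_all add: Q_simps\<close>)
  have qh: "ccomp q i \<in> hom X (cobj A i) (cobj Q i)" for i
    by (cases rule: degree_trichotomy[of n i])
      (use e zero_arr_hom O Ident_hom in \<open>simp_all add: Q_simps q_simps\<close>)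
  \<comment> \<open>Makes \<open>q\<close> commute with the differentials in degree
    \<open>n + 1\<close>; it holds because \<open>m\<close> is monic and \<open>m \<cdot> e\<close>
    is \<open>cdiff A n\<close>.\<close>
  have ee: "e \<cdot> cdiff A (n + 1) = zero_arr X (cobj A (n + 1)) I"
  proof -
    have d1: "cdiff A (n + 1) \<in> hom X (cobj A (n + 1)) (cobj A n)" using d[of "n + 1"] by simp
    have "m \<cdot> (e \<cdot> cdiff A (n + 1)) = zero_arr X (cobj A (n + 1)) (cobj A (n - 1))"
      using Comp_assoc[OF d1 e m(1)] m(2) cplx_diff_diff[OF A] by simp
    then show ?thesis using monic_zeroD[OF m(3,1) Comp_hom[OF d1 e]] by blast
  qed
  have comm: "cdiff Q i \<cdot> ccomp q i = ccomp q (i - 1) \<cdot> cdiff A i" for i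
  proof (cases rule: degree_trichotomy[of n i])
    case 1
    have left: "cdiff Q i \<cdot> ccomp q i = zero_arr X (cobj A i) (cobj Q (i - 1))"
      using 1 zero_comp[OF qh QO] by (simp add: Q_simps(6))
    show ?thesis
    proof (cases "i = n + 1")
      case True
      then show ?thesis unfolding left using ee by (simp add: Q_simps q_simps)
    next
      case False
      then have "is_zero X (cobj Q (i - 1))" using zQ 1 by simp
      from to_zero[OF this Comp_hom[OF d qh]] show ?thesis unfolding left by simp
    qed
  next
    case 2 then show ?thesis using m(2) Ident_Comp[OF d] by (simp add: Q_simps q_simps)
  next
    case 3 then show ?thesis using Ident_Comp[OF d] Comp_Ident[OF d] by (simp add: Q_simps q_simps)
  qed
  have jz: "ccomp (cot_incl n A) i \<in> hom X (zero_of X) (cobj A i)" if "i < n" for i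
    using cmor_comp[OF j, of i] that by (simp add: cot'_obj_simps)
  have coker_i: "is_cokernel X (ccomp (cot_incl n A) i) (ccomp q i)" for i
  proof (cases rule: degree_trichotomy[of n i])
    case 1
    have "ccomp q i \<in> hom X (cobj A i) (zero_of X)" using qh[of i] 1 by (simp add: Q_simps)
    from zero_cokernel_Ident[OF is_zero_zero_of this] 1 show ?thesis by (simp add: cot_incl_simps)
  next
    case 2 then show ?thesis using coker by (simp add: cot_incl_simps q_simps)
  next
    case 3 then show ?thesis using Ident_cokernel_zero[OF is_zero_zero_of jz[OF 3]] by (simp add: q_simps)
  qed
  have ker_i: "is_kernel X (ccomp q i) (ccomp (cot_incl n A) i)" for i
  proof (cases rule: degree_trichotomy[of n i])
    case 1
    have "ccomp q i \<in> hom X (cobj A i) (zero_of X)" using qh[of i] 1 by (simp add: Q_simps)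
    from Ident_kernel_zero[OF is_zero_zero_of this] 1 show ?thesis by (simp add: cot_incl_simps)
  next
    case 2
    \<comment> \<open>A map killed by \<open>e\<close> is killed by \<open>m \<cdot> e\<close>,
      which is \<open>cdiff A n\<close>, so the chosen kernel of \<open>cdiff A n\<close> is also a
      kernel of \<open>e\<close>.\<close>
    have "is_kernel X e (ker X (cdiff A n))"
    proof (rule is_kernelI[OF e k(1)])
      show "e \<cdot> ker X (cdiff A n) = zero_arr X (Ker X (cdiff A n)) I"
        using is_cokernelD(2)[OF coker k(1)] homD[OF e] by simp
      fix T t assume t: "t \<in> hom X T (cobj A n)" and z: "e \<cdot> t = zero_arr X T I"
      have "T \<in> Obj X" using t homD by blast
      then have "cdiff A n \<cdot> t = zero_arr X T (cobj A (n - 1))"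
        using Comp_assoc[OF t e m(1)] m(2) z comp_zero[OF m(1)] by simp
      from k(4)[OF t this] show "\<exists>u. u \<in> hom X T (Ker X (cdiff A n)) \<and> ker X (cdiff A n) \<cdot> u = t" .
    qed (rule k(3))
    then show ?thesis using 2 by (simp add: cot_incl_simps q_simps)
  next
    case 3 then show ?thesis using zero_kernel_Ident[OF is_zero_zero_of jz[OF 3]] by (simp add: q_simps)
  qed
  have QC: "chain_complex X UNIV Q"
  proof (rule cplxI[OF QO Qd])
    fix i
    have Qd': "cdiff Q (i + 1) \<in> hom X (cobj Q (i + 1)) (cobj Q i)"
      and d': "cdiff A (i + 1) \<in> hom X (cobj A (i + 1)) (cobj A i)" using Qd[of "i + 1"] d[of "i + 1"] by simp_all
    \<comment> \<open>Since the components of \<open>q\<close> are epic, the complex condition for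
      \<open>Q\<close> descends from the one for \<open>A\<close>.\<close>
    have "normal_epi X (ccomp q (i + 1))" using coker_i unfolding normal_epi_def by blast
    note epi = normal_epiD[OF this qh Comp_hom[OF Qd' Qd] zero_arr_hom[OF QO QO]]
    have "(cdiff Q i \<cdot> cdiff Q (i + 1)) \<cdot> ccomp q (i + 1) = cdiff Q i \<cdot> (ccomp q i \<cdot> cdiff A (i + 1))"
      using Comp_assoc[OF qh Qd' Qd] comm[of "i + 1"] by simp
    also have "\<dots> = ccomp q (i - 1) \<cdot> (cdiff A i \<cdot> cdiff A (i + 1))"
      using Comp_assoc[OF d' qh Qd] comm[of i] Comp_assoc[OF d' d qh] by simp
    also have "\<dots> = zero_arr X (cobj Q (i + 1)) (cobj Q (i - 1)) \<cdot> ccomp q (i + 1)"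
      using cplx_diff_diff[OF A] comp_zero[OF qh O] zero_comp[OF qh QO] by simp
    finally show "cdiff Q i \<cdot> cdiff Q (i + 1) = zero_arr X (cobj Q (i + 1)) (cobj Q (i - 1))" by (rule epi)
  qed
  have q: "q \<in> hom (ch_on X UNIV) A Q"
    by (rule cmorI[OF A QC _ _ qh comm]) (simp_all add: q_def)
  have "short_exact (ch_on X UNIV) (cot_incl n A) q"
    unfolding short_exact_def
    using is_kernel_ch_onI[OF q j ker_i] is_cokernel_ch_onI[OF j q coker_i] by blast
  moreover have "e \<in> hom X (cobj A n) (cobj Q n)" "cdiff Q n \<cdot> e = cdiff A n"
    using e m(2) by (simp_all add: Q_simps)
  ultimately show thesis using that[OF q] m(3) zQ ne by (simp add: Q_simps)
qed

lemma replete_ch_ge_obj: "replete (ch X) (ch_ge_obj X n)"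
  unfolding replete_def
proof (intro conjI ballI impI)
  show "ch_ge_obj X n \<subseteq> Obj (ch X)" unfolding ch_ge_obj_def by blast
  fix A B assume A: "A \<in> ch_ge_obj X n" and B: "B \<in> Obj (ch X)" and AB: "isomorphic (ch X) A B"
  have "is_zero X (cobj B i)" if "i < n" for i
    using is_zero_iso[OF _ isomorphic_ch_on_ccomp[OF AB[unfolded ch_def] UNIV_I]] A that
    unfolding ch_ge_obj_iff by blast
  then show "B \<in> ch_ge_obj X n" using B unfolding ch_ge_obj_def by blast
qed

text \<open>By naturality the unit at \<open>B\<close>, followed by a morphism between coskeleta,
  equals the unit at \<open>A\<close> after \<open>f\<close>. With \<open>f\<close> monic this
  composite is monic, and so is its first factor.\<close>

lemma replete_loc_free: "replete (ch X) (loc_free (ch X) (cosk_unit m))"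
  unfolding replete_def
proof (intro conjI ballI impI)
  show "loc_free (ch X) (cosk_unit m) \<subseteq> Obj (ch X)" unfolding loc_free_def by blast
  let ?G = "comp_fctr (cosk X m) (tr m)"
  fix A B assume "A \<in> loc_free (ch X) (cosk_unit m)" "B \<in> Obj (ch X)" "isomorphic (ch X) A B"
  then have A: "A \<in> Obj (ch_on X UNIV)" "monic (ch_on X UNIV) (cosk_unit m A)"
    and B: "B \<in> Obj (ch_on X UNIV)" and AB: "isomorphic (ch_on X UNIV) B A"
    unfolding loc_free_def ch_def using ch.isomorphic_sym by auto
  obtain f g where f: "f \<in> hom (ch_on X UNIV) B A" and g: "g \<in> hom (ch_on X UNIV) A B"
    and gf: "g \<cdot>\<^bsub>ch_on X UNIV\<^esub> f = Ident (ch_on X UNIV) B"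
    using AB ch.isoE unfolding isomorphic_def by metis
  have fm: "monic (ch_on X UNIV) f" using ch.monic_cancel[OF f g] gf ch.monic_Ident[OF B] by simp
  have AC: "chain_complex X UNIV A" and BC: "chain_complex X UNIV B" using A B ch_on_Obj by blast+
  note uA = cosk_unit_hom[OF AC, of m] and uB = cosk_unit_hom[OF BC, of m]
  have "Farr (cosk X m) (Farr (tr m) f) \<cdot>\<^bsub>ch_on X UNIV\<^esub> cosk_unit m B = cosk_unit m A \<cdot>\<^bsub>ch_on X UNIV\<^esub> f"
    using tr_cosk_adjunction[of m] f ch.homD[OF f]
    unfolding adjunction_def nat_trans_def ch_def by (auto simp: comp_fctr_def id_fctr_def)
  moreover have "monic (ch_on X UNIV) (cosk_unit m A \<cdot>\<^bsub>ch_on X UNIV\<^esub> f)" using ch.monic_comp[OF f fm uA A(2)] .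
  ultimately have "monic (ch_on X UNIV) (cosk_unit m B)"
    using ch.monic_cancel[OF uB cosk_hom[OF tr_hom[OF f]]] by simp
  then show "B \<in> loc_free (ch X) (cosk_unit m)" using B unfolding loc_free_def ch_def by blast
qed

text \<open>Followed by the unit of \<open>B\<close>, the map \<open>f\<close> lands in a coskeleton
  and vanishes in degrees below \<open>n\<close>, hence vanishes altogether; the unit is monic and
  cancels.\<close>

lemma torsion_to_free_zero:
  assumes A: "A \<in> ch_ge_obj X n" and B: "B \<in> loc_free (ch X) (cosk_unit (n - 1))"
    and f: "f \<in> hom (ch_on X UNIV) A B"
  shows "zero_mor (ch_on X UNIV) f"
proof -
  have BC: "chain_complex X UNIV B" and m: "monic (ch_on X UNIV) (cosk_unit (n - 1) B)"
    using B unfolding loc_free_def ch_def using ch_on_Obj by blast+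
  have Az: "\<And>i. i < n \<Longrightarrow> is_zero X (cobj A i)" using A unfolding ch_ge_obj_iff by blast
  note u = cosk_unit_hom[OF BC, of "n - 1"]
  have uf: "cosk_unit (n - 1) B \<cdot>\<^bsub>ch_on X UNIV\<^esub> f \<in> hom (ch_on X UNIV) A (cosk_obj X (n - 1) (tr_obj (n - 1) B))"
    using ch.Comp_hom[OF f u] .
  have z: "zero_arr (ch_on X UNIV) A (cosk_obj X (n - 1) (tr_obj (n - 1) B))
      \<in> hom (ch_on X UNIV) A (cosk_obj X (n - 1) (tr_obj (n - 1) B))"
    using ch.zero_arr_hom ch.homD[OF uf] by blast
  have "cosk_unit (n - 1) B \<cdot>\<^bsub>ch_on X UNIV\<^esub> f = zero_arr (ch_on X UNIV) A (cosk_obj X (n - 1) (tr_obj (n - 1) B))"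
  proof (rule cosk_hom_eqI[OF tr_obj_complex[OF BC] uf z])
    fix i assume "i \<le> n - 1"
    then have "is_zero X (cobj A i)" using Az by simp
    from from_zero[OF this cmor_comp[OF uf]] from_zero[OF this cmor_comp[OF z]]
    show "ccomp (cosk_unit (n - 1) B \<cdot>\<^bsub>ch_on X UNIV\<^esub> f) i
      = ccomp (zero_arr (ch_on X UNIV) A (cosk_obj X (n - 1) (tr_obj (n - 1) B))) i" by simp
  qed
  then show ?thesis using ch.monic_zeroD[OF m u f] ch.zero_mor_iff[OF f] by blast
qed

lemma tr_torsion_theory:
  "torsion_theory (ch X) (short_exact (ch X)) (ch_ge_obj X n) (loc_free (ch X) (cosk_unit (n - 1)))"
  unfolding torsion_theory_def
proof (intro conjI ballI)
  show "replete (ch X) (ch_ge_obj X n)" "replete (ch X) (loc_free (ch X) (cosk_unit (n - 1)))"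
    by (rule replete_ch_ge_obj replete_loc_free)+
  show "zero_mor (ch X) f" if "A \<in> ch_ge_obj X n" "B \<in> loc_free (ch X) (cosk_unit (n - 1))" "f \<in> hom (ch X) A B"
    for A B f using torsion_to_free_zero that unfolding ch_def by blast
  fix A assume "A \<in> Obj (ch X)"
  then have A: "chain_complex X UNIV A" using ch_on_Obj unfolding ch_def by blast
  obtain Q q where q: "q \<in> hom (ch_on X UNIV) A Q" "short_exact (ch_on X UNIV) (cot_incl n A) q"
    "monic X (cdiff Q n)" "\<And>i. i > n \<Longrightarrow> is_zero X (cobj Q i)"
    using torsion_sequence[OF A] by metis
  then have "Q \<in> loc_free (ch X) (cosk_unit (n - 1))" unfolding loc_free_iff using ch_on_homD(4) by blast
  then show "\<exists>K\<in>ch_ge_obj X n. \<exists>Q\<in>loc_free (ch X) (cosk_unit (n - 1)).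
      \<exists>k\<in>hom (ch X) K A. \<exists>q\<in>hom (ch X) A Q. short_exact (ch X) k q"
    using q cot_incl_hom[OF A] cot'_obj_ge[OF A] unfolding ch_def by blast
qed

text \<open>The test map \<open>j\<close> is the counit of extension by zero at the domain of
  \<open>f\<close>. Its composite with \<open>f\<close> vanishes because the codomain of
  \<open>f\<close> is zero below \<open>n\<close>, so \<open>j\<close> is zero; yet below
  \<open>n\<close> its components are identities.\<close>

lemma ch_ge_obj_subobject:
  assumes m: "monic (ch X) f" and B: "Cod (ch X) f \<in> ch_ge_obj X n"
  shows "Dom (ch X) f \<in> ch_ge_obj X n"
proof -
  define A where "A = Dom (ch_on X UNIV) f"
  define B' where "B' = Cod (ch_on X UNIV) f"
  have m': "monic (ch_on X UNIV) f" using m unfolding ch_def .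
  have f: "f \<in> hom (ch_on X UNIV) A B'"
    using m' ch.Arr_hom unfolding monic_def A_def B'_def by blast
  note AC = ch_on_homD(3)[OF f]
  have Bz: "\<And>i. i < n \<Longrightarrow> is_zero X (cobj B' i)" using B unfolding ch_ge_obj_iff B'_def ch_def by blast
  note T = tr_obj_complex[OF AC, of "n - 1"]
  define j where "j = ext_map (n - 1) (tr_obj (n - 1) A) A (ccomp (Ident (ch_on X {..n - 1}) (tr_obj (n - 1) A)))"
  have j: "j \<in> hom (ch_on X UNIV) (ext_obj (n - 1) (tr_obj (n - 1) A)) A"
    unfolding j_def using ext_map_hom[OF AC ch_on_Ident_hom[OF T]] .
  have fj: "f \<cdot>\<^bsub>ch_on X UNIV\<^esub> j \<in> hom (ch_on X UNIV) (ext_obj (n - 1) (tr_obj (n - 1) A)) B'"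
    using ch.Comp_hom[OF j f] .
  then have z: "zero_arr (ch_on X UNIV) (ext_obj (n - 1) (tr_obj (n - 1) A)) B'
      \<in> hom (ch_on X UNIV) (ext_obj (n - 1) (tr_obj (n - 1) A)) B'"
    using ch.zero_arr_hom ch.homD by blast
  have "f \<cdot>\<^bsub>ch_on X UNIV\<^esub> j = zero_arr (ch_on X UNIV) (ext_obj (n - 1) (tr_obj (n - 1) A)) B'"
  proof (rule ext_hom_eqI[OF fj z])
    fix i assume "i \<le> n - 1"
    then have "is_zero X (cobj B' i)" using Bz by simp
    from to_zero[OF this cmor_comp[OF fj]] to_zero[OF this cmor_comp[OF z]]
    show "ccomp (f \<cdot>\<^bsub>ch_on X UNIV\<^esub> j) i
      = ccomp (zero_arr (ch_on X UNIV) (ext_obj (n - 1) (tr_obj (n - 1) A)) B') i" by simp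
  qed
  from ch.monic_zeroD[OF m' f j this]
  have j0: "j = zero_arr (ch_on X UNIV) (ext_obj (n - 1) (tr_obj (n - 1) A)) A" .
  have "is_zero X (cobj A i)" if i: "i < n" for i
  proof -
    have "ccomp j i = Ident X (cobj A i)" using i by (simp add: j_def tr_obj_def)
    moreover have "ccomp j i = zero_arr X (cobj A i) (cobj A i)"
      using ccomp_zero_arr[OF ext_obj_complex[OF T] AC UNIV_I, of i] i
      by (simp add: j0 ext_obj_simps tr_obj_def)
    ultimately show ?thesis using is_zero_iff[OF cplx_obj[OF AC]] by simp
  qed
  then show ?thesis using AC unfolding ch_ge_obj_iff A_def ch_def by blast
qed

section \<open>Proper morphisms\<close>

definition proper_arr :: "'a \<Rightarrow> bool" where
  "proper_arr d \<longleftrightarrow> (\<forall>m e. normal_epi X e \<and> monic X m \<and> Dom X m = Cod X e \<and> d = m \<cdot> e \<longrightarrow> normal_mono X m)"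

lemma proper_iff: "proper X M \<longleftrightarrow> (\<forall>i. proper_arr (cdiff M i))"
  unfolding proper_def proper_arr_def by blast

lemma proper_arrI:
  assumes d: "d \<in> hom X A B"
    and "\<And>I e m. \<lbrakk>e \<in> hom X A I; normal_epi X e; m \<in> hom X I B; monic X m; m \<cdot> e = d\<rbrakk> \<Longrightarrow> normal_mono X m"
  shows "proper_arr d"
  unfolding proper_arr_def
proof (intro allI impI, elim conjE)
  fix m e assume e: "normal_epi X e" and m: "monic X m" and c: "Dom X m = Cod X e" and dme: "d = m \<cdot> e"
  have eA: "e \<in> Arr X" and mA: "m \<in> Arr X"
    using e m unfolding normal_epi_def is_cokernel_def monic_def by blast+
  note eh = Arr_hom[OF eA] and mh = Arr_hom[OF mA, unfolded c]
  have "Dom X e = A" "Cod X m = B" using Comp_hom[OF eh mh] d unfolding dme hom_def by simp_all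
  with eh mh show "normal_mono X m" using assms(2)[of e "Cod X e" m] e m dme by simp
qed

text \<open>The image is a quotient of a zero object, hence zero, and a morphism out of a zero
  object is a kernel of the identity of its codomain.\<close>

lemma proper_arr_from_zero: "is_zero X A \<Longrightarrow> d \<in> hom X A B \<Longrightarrow> proper_arr d"
  by (rule proper_arrI, assumption) (use normal_epi_from_zero normal_mono_from_zero homD in metis)

text \<open>Here the image is a subobject of a zero object, hence zero again.\<close>

lemma proper_arr_to_zero: "is_zero X B \<Longrightarrow> d \<in> hom X A B \<Longrightarrow> proper_arr d"
  by (rule proper_arrI, assumption) (use monic_to_zero normal_mono_from_zero homD in metis)

text \<open>In a factorization of a monomorphism the normal epimorphism is also monic, hence
  invertible, so \<open>m\<close> is \<open>d\<close> up to isomorphism.\<close>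

lemma proper_arr_normal_mono:
  assumes d: "d \<in> hom X A B" "normal_mono X d"
  shows "proper_arr d"
proof (rule proper_arrI[OF d(1)])
  fix I e m assume e: "e \<in> hom X A I" "normal_epi X e" and m: "m \<in> hom X I B" "monic X m" "m \<cdot> e = d"
  have "monic X e" using monic_cancel[OF e(1) m(1)] m(3) normal_mono_monic[OF d(2)] by simp
  then obtain g where "g \<in> hom X I A" "g \<cdot> e = Ident X A" "e \<cdot> g = Ident X I"
    using normal_epi_monic_split[OF e] by blast
  then show "normal_mono X m" using normal_mono_precomp_split_epi[OF e(1)] m d(2) by blast
qed

text \<open>A factorization of \<open>d\<close> becomes one of \<open>k \<cdot> d\<close> by
  composing its monic part with \<open>k\<close>; normality then descends by
  \<open>normal_mono_cancel\<close>.\<close>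

lemma proper_arr_cancel:
  assumes d: "d \<in> hom X A B" and k: "k \<in> hom X B D" "monic X k" and p: "proper_arr (k \<cdot> d)"
  shows "proper_arr d"
proof (rule proper_arrI[OF d])
  fix I e m assume e: "e \<in> hom X A I" "normal_epi X e" and m: "m \<in> hom X I B" "monic X m" "m \<cdot> e = d"
  have "monic X (k \<cdot> m)" using monic_comp[OF m(1,2) k] .
  moreover have "k \<cdot> d = (k \<cdot> m) \<cdot> e" using Comp_assoc[OF e(1) m(1) k(1)] m(3) by simp
  moreover have "Dom X (k \<cdot> m) = Cod X e" using homD[OF Comp_hom[OF m(1) k(1)]] homD[OF e(1)] by simp
  ultimately have "normal_mono X (k \<cdot> m)" using p e(2) unfolding proper_arr_def by blast
  then show "normal_mono X m" using normal_mono_cancel[OF m(1) k] by blast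
qed

lemma proper_arr_image:
  assumes e: "e \<in> hom X A I" "normal_epi X e" and m: "m \<in> hom X I B" "monic X m" and p: "proper_arr (m \<cdot> e)"
  shows "normal_mono X m"
  using p e(2) m(2) homD[OF e(1)] homD[OF m(1)] unfolding proper_arr_def by blast

text \<open>Properness is applied to the factorization of \<open>d\<close> as \<open>d\<close> after
  an identity, an identity being the cokernel of a map from zero.\<close>

lemma proper_arr_monic:
  assumes d: "d \<in> hom X A B" "monic X d" and p: "proper_arr d"
  shows "normal_mono X d"
proof -
  have A: "A \<in> Obj X" using d homD by blast
  have "normal_epi X (Ident X A)"
    using Ident_cokernel_zero[OF is_zero_zero_of zero_arr_hom[OF zero_of_Obj A]] unfolding normal_epi_def by blast
  then show ?thesis using proper_arr_image[OF Ident_hom[OF A] _ d] p Comp_Ident[OF d(1)] by simp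
qed

section \<open>Restriction to proper complexes\<close>

lemma pch_Obj: "M \<in> Obj (pch X) \<longleftrightarrow> chain_complex X UNIV M \<and> (\<forall>i. proper_arr (cdiff M i))"
  unfolding pch_def full_subcat_simps proper_iff[symmetric] ch_def using ch_on_Obj by auto

lemma pch_hom: "f \<in> hom (pch X) M N \<longleftrightarrow> f \<in> hom (ch_on X UNIV) M N \<and> proper X M \<and> proper X N"
  unfolding pch_def full_subcat_hom ch_def by simp

lemma ch_ge_obj_pch: "ch_ge_obj X n \<inter> Obj (pch X) = pch_ge_obj X n"
  unfolding ch_ge_obj_def pch_ge_obj_def pch_def full_subcat_simps by blast

text \<open>In a proper complex a monic differential is automatically normal, which turns the
  description of the torsion-free class into that of \<open>MN_obj\<close>.\<close>

lemma loc_free_pch: "loc_free (ch X) (cosk_unit (n - 1)) \<inter> Obj (pch X) = MN_obj X n"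
  unfolding MN_obj_def
proof (intro set_eqI)
  fix A
  have "normal_mono X (cdiff A n) \<longleftrightarrow> monic X (cdiff A n)" if "A \<in> Obj (pch X)"
  proof -
    have A: "chain_complex X UNIV A" "proper_arr (cdiff A n)" using that unfolding pch_Obj by auto
    show ?thesis using proper_arr_monic[OF cplx_diff[OF A(1)] _ A(2)] normal_mono_monic by blast
  qed
  then show "A \<in> loc_free (ch X) (cosk_unit (n - 1)) \<inter> Obj (pch X)
    \<longleftrightarrow> A \<in> {M \<in> Obj (pch X). normal_mono X (cdiff M n) \<and> (\<forall>i>n. is_zero X (cobj M i))}"
    unfolding Int_iff loc_free_iff mem_Collect_eq using pch_Obj by blast
qed

text \<open>A zero morphism of \<open>pch X\<close> has to factor through a zero object of that
  subcategory; the zero complex is proper and serves both categories.\<close>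

lemma zero_mor_pch:
  assumes f: "f \<in> hom (pch X) A B" and z: "zero_mor (ch_on X UNIV) f"
  shows "zero_mor (pch X) f"
proof -
  let ?Z = "zero_cplx UNIV"
  have fh: "f \<in> hom (ch_on X UNIV) A B" using f unfolding pch_hom by blast
  have AO: "A \<in> Obj (ch_on X UNIV)" and BO: "B \<in> Obj (ch_on X UNIV)" using ch.homD[OF fh] by blast+
  have Z: "is_zero (ch_on X UNIV) ?Z" by (rule is_zero_zero_cplx)
  have ZO: "?Z \<in> Obj (ch_on X UNIV)" using Z unfolding is_zero_def by blast
  have "proper_arr (cdiff ?Z i)" for i
    using proper_arr_from_zero[OF _ cplx_diff[OF zero_cplx, of i]] is_zero_zero_of by (simp add: zero_cplx_def)
  then have Zp: "proper X ?Z" unfolding proper_iff by blast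
  note a = ch.zero_arr_hom[OF AO ZO] and b = ch.zero_arr_hom[OF ZO BO]
  have "f = zero_arr (ch_on X UNIV) ?Z B \<cdot>\<^bsub>ch_on X UNIV\<^esub> zero_arr (ch_on X UNIV) A ?Z"
    using z ch.zero_mor_iff[OF fh] ch.zero_comp[OF a BO] by simp
  moreover have "is_zero (pch X) ?Z"
    unfolding is_zero_def
  proof (intro conjI ballI)
    show "?Z \<in> Obj (pch X)" using ZO Zp by (simp add: pch_def full_subcat_simps ch_def)
    fix C assume "C \<in> Obj (pch X)"
    then have C: "C \<in> Obj (ch_on X UNIV)" "proper X C" by (simp_all add: pch_def full_subcat_simps ch_def)
    show "\<exists>!f. f \<in> hom (pch X) C ?Z" "\<exists>!f. f \<in> hom (pch X) ?Z C"
      unfolding pch_hom using Z C Zp unfolding is_zero_def by simp_all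
  qed
  moreover have "f \<in> Arr (pch X)" "Dom (pch X) f = A" "Cod (pch X) f = B" using f unfolding hom_def by auto
  moreover have "zero_arr (ch_on X UNIV) A ?Z \<in> hom (pch X) A ?Z" "zero_arr (ch_on X UNIV) ?Z B \<in> hom (pch X) ?Z B"
    using a b f Zp unfolding pch_hom by auto
  moreover have "Comp (pch X) = Comp (ch_on X UNIV)" by (simp add: pch_def full_subcat_simps ch_def)
  ultimately show ?thesis unfolding zero_mor_def by auto
qed

lemma isomorphic_pchD:
  assumes "isomorphic (pch X) A B"
  shows "isomorphic (ch X) A B"
proof -
  obtain f where f: "f \<in> hom (pch X) A B" "iso (pch X) f" using assms unfolding isomorphic_def by blast
  obtain g where "g \<in> hom (pch X) B A" "g \<cdot>\<^bsub>pch X\<^esub> f = Ident (pch X) A" "f \<cdot>\<^bsub>pch X\<^esub> g = Ident (pch X) B"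
    using f unfolding iso_def hom_def by auto
  then have "iso (ch_on X UNIV) f" "f \<in> hom (ch_on X UNIV) A B"
    using f ch.isoI unfolding pch_hom by (auto simp: pch_def full_subcat_simps ch_def)
  then show ?thesis unfolding isomorphic_def ch_def by blast
qed

lemma replete_pch: "replete (ch X) S \<Longrightarrow> replete (pch X) (S \<inter> Obj (pch X))"
  unfolding replete_def using isomorphic_pchD by (auto simp: pch_def full_subcat_simps)

text \<open>Above degree \<open>n\<close>, including the lift in degree \<open>n + 1\<close>,
  composing with the monic inclusion gives a differential of \<open>A\<close>, so properness
  cancels. In the remaining degrees the target is zero.\<close>

lemma proper_cot'_obj:
  assumes A: "chain_complex X UNIV A" and p: "proper X A"
  shows "proper X (cot'_obj X n A)"
  unfolding proper_iff
proof
  fix i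
  let ?K = "cot'_obj X n A"
  note K = cplx_diff[OF cot'_obj_complex[OF A, of n]] and j = cot_incl_hom[OF A, of n]
  show "proper_arr (cdiff ?K i)"
  proof (cases "i > n")
    case True
    have d: "cdiff A i \<in> hom X (cobj A i) (cobj A (i - 1))" by (rule cplx_diff[OF A])
    have "ccomp (cot_incl n A) (i - 1) \<cdot> cdiff ?K i = cdiff A i"
      using cmor_comm[OF j, of i] True Comp_Ident[OF d] by (simp add: cot_incl_simps)
    moreover have "proper_arr (cdiff A i)" using p unfolding proper_iff by blast
    ultimately show ?thesis
      using proper_arr_cancel[OF K cmor_comp[OF j] monic_cot_incl_comp[OF A]] by metis
  next
    case False
    then show ?thesis using proper_arr_to_zero[OF is_zero_cot'_obj K] by simp
  qed
qed

text \<open>The torsion sequence formed in \<open>ch X\<close> stays in \<open>pch X\<close> once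
  \<open>A\<close> is proper, so the same kernel part and quotient serve here.\<close>

lemma pch_torsion_theory:
  "torsion_theory (pch X) (pch_short_exact X) (pch_ge_obj X n) (MN_obj X n)"
  unfolding torsion_theory_def
proof (intro conjI ballI)
  show "replete (pch X) (pch_ge_obj X n)" "replete (pch X) (MN_obj X n)"
    using replete_pch[OF replete_ch_ge_obj] replete_pch[OF replete_loc_free]
    unfolding ch_ge_obj_pch[symmetric] loc_free_pch[symmetric] by blast+
  show "zero_mor (pch X) f" if "A \<in> pch_ge_obj X n" "B \<in> MN_obj X n" "f \<in> hom (pch X) A B" for A B f
  proof (rule zero_mor_pch[OF that(3)])
    show "zero_mor (ch_on X UNIV) f"
      using that torsion_to_free_zero unfolding pch_hom ch_ge_obj_pch[symmetric] loc_free_pch[symmetric] by blast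
  qed
  fix A assume "A \<in> Obj (pch X)"
  then have A: "chain_complex X UNIV A" and p: "\<And>i. proper_arr (cdiff A i)" unfolding pch_Obj by auto
  then have pA: "proper X A" unfolding proper_iff by blast
  obtain Q q e where q: "q \<in> hom (ch_on X UNIV) A Q" and ex: "short_exact (ch_on X UNIV) (cot_incl n A) q"
    and mQ: "monic X (cdiff Q n)" and zQ: "\<And>i. i > n \<Longrightarrow> is_zero X (cobj Q i)"
    and Qd: "\<And>i. i < n \<Longrightarrow> cdiff Q i = cdiff A i"
    and e: "normal_epi X e" "e \<in> hom X (cobj A n) (cobj Q n)" "cdiff Q n \<cdot> e = cdiff A n"
    using torsion_sequence[OF A] by metis
  note QC = ch_on_homD(4)[OF q]
  note d = cplx_diff[OF QC]
  \<comment> \<open>\<open>cdiff Q n\<close> is the monic part of a factorization of the proper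
    morphism \<open>cdiff A n\<close>.\<close>
  have nQ: "normal_mono X (cdiff Q n)" using proper_arr_image[OF e(2,1) d mQ] e(3) p by simp
  have "proper_arr (cdiff Q i)" for i
  proof (cases rule: degree_trichotomy[of n i])
    case 1 then show ?thesis using proper_arr_from_zero[OF zQ d] by blast
  next
    case 2 then show ?thesis using proper_arr_normal_mono[OF d nQ] by simp
  next
    case 3 then show ?thesis using p Qd by simp
  qed
  then have QO: "Q \<in> Obj (pch X)" and pQ: "proper X Q" unfolding pch_Obj proper_iff using QC by blast+
  have "Q \<in> MN_obj X n" unfolding MN_obj_def using QO nQ zQ by blast
  moreover have pK: "proper X (cot'_obj X n A)" using proper_cot'_obj[OF A pA] .
  then have "cot'_obj X n A \<in> pch_ge_obj X n"
    unfolding ch_ge_obj_pch[symmetric] using cot'_obj_ge[OF A] cot'_obj_complex[OF A] pch_Obj proper_iff by blast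
  moreover have "cot_incl n A \<in> hom (pch X) (cot'_obj X n A) A" "q \<in> hom (pch X) A Q"
    unfolding pch_hom using cot_incl_hom[OF A] q pA pQ pK by blast+
  moreover from this have "pch_short_exact X (cot_incl n A) q"
    unfolding pch_short_exact_def using ex by (simp add: hom_def ch_def)
  ultimately show "\<exists>K\<in>pch_ge_obj X n. \<exists>Q\<in>MN_obj X n. \<exists>k\<in>hom (pch X) K A. \<exists>q\<in>hom (pch X) A Q. pch_short_exact X k q"
    by blast
qed

end

theorem theorem3p11:
  fixes X :: "('o, 'a) cat" and n :: int
  assumes "semi_abelian X"
  shows
    "(\<exists>\<eta>. localization (ch X) (ch_le X (n - 1)) (tr (n - 1)) (cosk X (n - 1)) \<eta>) \<and>
     (\<forall>\<eta>. localization (ch X) (ch_le X (n - 1)) (tr (n - 1)) (cosk X (n - 1)) \<eta> \<longrightarrow>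
        hereditary_torsion_theory (ch X) (short_exact (ch X))
          (loc_torsion (ch X) (ch_le X (n - 1)) (tr (n - 1))) (loc_free (ch X) \<eta>)) \<and>
     equivalent_cats
       (full_subcat (ch X) (loc_torsion (ch X) (ch_le X (n - 1)) (tr (n - 1)))) (ch_ge X n) \<and>
     coreflector (ch X) (ch_ge_obj X n) (cot' X n) \<and>
     (\<forall>\<eta>. localization (ch X) (ch_le X (n - 1)) (tr (n - 1)) (cosk X (n - 1)) \<eta> \<longrightarrow>
        ch_ge_obj X n \<inter> Obj (pch X) = pch_ge_obj X n \<and>
        loc_free (ch X) \<eta> \<inter> Obj (pch X) = MN_obj X n \<and>
        torsion_theory (pch X) (pch_short_exact X) (pch_ge_obj X n) (MN_obj X n))"
proof -
  interpret semi_abelian_category X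
    using assms by (simp add: semi_abelian_category_def semi_abelian_category_axioms_def
        pointed_category_def pointed_category_axioms_def semi_abelian_def)
  have "category (ch_ge X n)" unfolding ch_ge_def ch_def by (rule category_full_subcat[OF category_ch_on])
  then have "equivalent_cats
      (full_subcat (ch X) (loc_torsion (ch X) (ch_le X (n - 1)) (tr (n - 1)))) (ch_ge X n)"
    unfolding loc_torsion_tr ch_ge_def by (rule equivalent_cats_refl)
  \<comment> \<open>Established for the explicit unit; \<open>loc_free_cosk_unit\<close> carries it
    over to an arbitrary \<eta>.\<close>
  moreover have "hereditary_torsion_theory (ch X) (short_exact (ch X)) (ch_ge_obj X n)
      (loc_free (ch X) (cosk_unit (n - 1)))"
    unfolding hereditary_torsion_theory_def using tr_torsion_theory ch_ge_obj_subobject by blast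
  ultimately show ?thesis
    using tr_localization cot'_coreflector ch_ge_obj_pch loc_free_pch pch_torsion_theory
      loc_free_cosk_unit[of "n - 1"] unfolding loc_torsion_tr by metis
qed

end
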